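(* Let $K\ge 2$. The parameter manifold of the family of Concrete distributions $C(\boldsymbol\beta,\tau)$, equipped with its information metric, is (isometric to) hyperbolic space $\mathbb{H}^K$ with sectional curvature $-1/\ell^2$, where $$\ell = \sqrt{\frac{(K-1)(K\pi^2/6+1)}{K+1}} .$$
   Context: The simplex is $S_K = \{(x_1,\ldots,x_K)\in\mathbb{R}^K : \sum_{i=1}^K x_i = 1,\ x_i\ge 0\}$; densities on $S_K$ are with respect to Lebesgue measure $dx_1\cdots dx_{K-1}$ in the first $K-1$ coordinates, with $x_K = 1-\sum_{i=1}^{K-1}x_i$. For $\boldsymbol\beta=(\beta_1,\ldots,\beta_K)$ with all $\beta_i>0$ and $\tau>0$, the Concrete distribution $C(\boldsymbol\beta,\tau)$ is the probability distribution on $S_K$ with density $$f(\mathbf x) = \frac{(K-1)!\,\tau^{K-1}}{(\sum_{j=1}^K\beta_j/x_j^\tau)^K}\prod_{i=1}^K\frac{\beta_i}{x_i^{\tau+1}} .$$ It is invariant under $\boldsymbol\beta\to\lambda\boldsymbol\beta$, $\lambda>0$, so the family is a $K$-dimensional manifold: it is the set of all $(\boldsymbol\beta,\tau)$ with $\beta_i>0$, $\tau>0$, modulo this scaling (equivalently, with the constraint $\sum_{i=1}^K\beta_i=1$, in which case $\beta_1,\ldots,\beta_{K-1},\tau$ are independent coordinates). The information (Fisher–Rao) metric is the Riemannian metric $ds^2=\sum_{a,b=1}^K\mathcal{I}_{ab}\,d\eta_a\,d\eta_b$, where $\eta_1,\ldots,\eta_K$ are independent coordinates on this manifold and $\mathcal{I}_{ab}=\mathbb{E}\big(\frac{\partial\log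 f}{\partial\eta_a}\frac{\partial\log f}{\partial\eta_b}\big)$, with expectation over $\mathbf X\sim C(\boldsymbol\beta,\tau)$; it does not depend on the choice of coordinates. *)

theory Defs
  imports "HOL-Analysis.Analysis"
begin

section \<open>Riemannian geometry on open subsets of Euclidean spaces\<close>

text \<open>
  All manifolds here are covered by a single chart, so a manifold is an open set \<open>S\<close> of a
  Euclidean space, and a metric is a function \<open>g\<close> such that \<open>g p u v\<close> is the inner
  product of the tangent vectors \<open>u\<close> and \<open>v\<close> at \<open>p\<close>.
\<close>

definition dir_deriv :: "('a::real_normed_vector \<Rightarrow> 'b::real_normed_vector) \<Rightarrow> 'a \<Rightarrow> 'a \<Rightarrow> 'b"
  where "dir_deriv F p u = vector_derivative (\<lambda>t::real. F (p + t *\<^sub>R u)) (at 0)"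

primrec Ck_on :: "nat \<Rightarrow> 'a::euclidean_space set \<Rightarrow> ('a \<Rightarrow> 'b::real_normed_vector) \<Rightarrow> bool" where
  "Ck_on 0 S f \<longleftrightarrow> continuous_on S f"
| "Ck_on (Suc k) S f \<longleftrightarrow> (\<forall>x\<in>S. f differentiable (at x)) \<and>
     (\<forall>v. Ck_on k S (\<lambda>x. frechet_derivative f (at x) v))"

definition smooth_on :: "'a::euclidean_space set \<Rightarrow> ('a \<Rightarrow> 'b::real_normed_vector) \<Rightarrow> bool"
  where "smooth_on S f \<longleftrightarrow> (\<forall>k. Ck_on k S f)"

definition riemannian_isometry ::
  "('a::euclidean_space \<Rightarrow> 'b::euclidean_space) \<Rightarrow>
   'a set \<Rightarrow> ('a \<Rightarrow> 'a \<Rightarrow> 'a \<Rightarrow> real) \<Rightarrow> 'b set \<Rightarrow> ('b \<Rightarrow> 'b \<Rightarrow> 'b \<Rightarrow> real) \<Rightarrow> bool"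
  where "riemannian_isometry \<Phi> S g T h \<longleftrightarrow>
    open S \<and> open T \<and> bij_betw \<Phi> S T \<and> smooth_on S \<Phi> \<and> smooth_on T (inv_into S \<Phi>) \<and>
    (\<forall>p\<in>S. \<forall>u v. h (\<Phi> p) (frechet_derivative \<Phi> (at p) u) (frechet_derivative \<Phi> (at p) v) = g p u v)"

text \<open>
  \<open>christoffel g p u v\<close> is \<open>\<nabla>\<^sub>u V\<close> at \<open>p\<close> for the Levi-Civita connection, where \<open>V\<close> is
  the vector field with constant coefficients \<open>v\<close>; it is given by the Koszul formula, with the
  index raised by means of the nondegenerate form \<open>g p\<close>.
\<close>

definition christoffel :: "('a::euclidean_space \<Rightarrow> 'a \<Rightarrow> 'a \<Rightarrow> real) \<Rightarrow> 'a \<Rightarrow> 'a \<Rightarrow> 'a \<Rightarrow> 'a"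
  where "christoffel g p u v = (THE w. \<forall>z. g p w z =
    (dir_deriv (\<lambda>q. g q v z) p u + dir_deriv (\<lambda>q. g q u z) p v - dir_deriv (\<lambda>q. g q u v) p z) / 2)"

text \<open>
  \<open>R(u,v)w = \<nabla>\<^sub>u \<nabla>\<^sub>v w - \<nabla>\<^sub>v \<nabla>\<^sub>u w\<close> for constant (hence commuting) fields; with this sign
  round spheres have positive sectional curvature.
\<close>

definition riemann_curvature ::
  "('a::euclidean_space \<Rightarrow> 'a \<Rightarrow> 'a \<Rightarrow> real) \<Rightarrow> 'a \<Rightarrow> 'a \<Rightarrow> 'a \<Rightarrow> 'a \<Rightarrow> 'a"
  where "riemann_curvature g p u v w =
      dir_deriv (\<lambda>q. christoffel g q v w) p u + christoffel g p u (christoffel g p v w)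
    - dir_deriv (\<lambda>q. christoffel g q u w) p v - christoffel g p v (christoffel g p u w)"

definition sectional_curvature ::
  "('a::euclidean_space \<Rightarrow> 'a \<Rightarrow> 'a \<Rightarrow> real) \<Rightarrow> 'a \<Rightarrow> 'a \<Rightarrow> 'a \<Rightarrow> real"
  where "sectional_curvature g p u v =
    g p (riemann_curvature g p u v v) u / (g p u u * g p v v - (g p u v)\<^sup>2)"

definition has_constant_curvature ::
  "'a::euclidean_space set \<Rightarrow> ('a \<Rightarrow> 'a \<Rightarrow> 'a \<Rightarrow> real) \<Rightarrow> real \<Rightarrow> bool"
  where "has_constant_curvature S g \<kappa> \<longleftrightarrow>
    (\<forall>p\<in>S. \<forall>u v. u \<noteq> v \<and> independent {u, v} \<longrightarrow> sectional_curvature g p u v = \<kappa>)"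

text \<open>
  Hyperbolic space in the upper half-space model \<open>{(x, y). y > 0}\<close> with the metric
  \<open>r\<^sup>2 (dx\<^sub>1\<^sup>2 + \<dots> + dx\<^sub>m\<^sup>2 + dy\<^sup>2) / y\<^sup>2\<close>; its dimension is \<open>CARD('m) + 1\<close>.
\<close>

definition half_space :: "((real^'m) \<times> real) set"
  where "half_space = {p. snd p > 0}"

definition hyperbolic_metric ::
  "real \<Rightarrow> (real^'m) \<times> real \<Rightarrow> (real^'m) \<times> real \<Rightarrow> (real^'m) \<times> real \<Rightarrow> real"
  where "hyperbolic_metric r p u v = r\<^sup>2 * (u \<bullet> v) / (snd p)\<^sup>2"


section \<open>Concrete distributions and their information metric\<close>

text \<open>
  The \<open>K = CARD('m) + 1\<close> coordinates are indexed by the type \<open>'m option\<close>: the indices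
  \<open>Some j\<close> are the first \<open>K - 1\<close> ones, and \<open>None\<close> is the last one.
\<close>

definition prob_simplex :: "(real^'k) set"
  where "prob_simplex = {x. (\<Sum>i\<in>UNIV. x $ i) = 1 \<and> (\<forall>i. x $ i \<ge> 0)}"

definition append_last :: "real^('m::finite) \<Rightarrow> real^('m option)"
  where "append_last u = (\<chi> i. case i of Some j \<Rightarrow> u $ j | None \<Rightarrow> 1 - (\<Sum>j\<in>UNIV. u $ j))"

definition concrete_density :: "real^'k \<Rightarrow> real \<Rightarrow> real^'k \<Rightarrow> real"
  where "concrete_density \<beta> \<tau> x =
    fact (CARD('k) - 1) * \<tau> ^ (CARD('k) - 1) / (\<Sum>j\<in>UNIV. \<beta> $ j / (x $ j) powr \<tau>) ^ CARD('k)
      * (\<Prod>i\<in>UNIV. \<beta> $ i / (x $ i) powr (\<tau> + 1))"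

definition concrete_distribution :: "real^('m::finite option) \<Rightarrow> real \<Rightarrow> (real^('m option)) measure"
  where "concrete_distribution \<beta> \<tau> =
    distr (density lborel (\<lambda>u::real^'m.
        ennreal (indicator prob_simplex (append_last u) * concrete_density \<beta> \<tau> (append_last u))))
      borel append_last"

text \<open>
  The parameter manifold, in the global coordinates \<open>(\<beta>\<^sub>1, \<dots>, \<beta>\<^sub>K\<^sub>-\<^sub>1, \<tau>)\<close>, where the scaling
  freedom is removed by the constraint that the entries of \<open>\<beta>\<close> sum to one.
\<close>

definition concrete_params :: "((real^'m) \<times> real) set"
  where "concrete_params = {(b, \<tau>). (\<forall>i. append_last b $ i > 0) \<and> \<tau> > 0}"

definition concrete_log_likelihood :: "real^('m::finite option) \<Rightarrow> (real^'m) \<times> real \<Rightarrow> real"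
  where "concrete_log_likelihood x p = ln (concrete_density (append_last (fst p)) (snd p) x)"

definition fisher_information ::
  "(real^'m) \<times> real \<Rightarrow> (real^'m) \<times> real \<Rightarrow> (real^'m) \<times> real \<Rightarrow> real"
  where "fisher_information p a b =
    (\<integral>x. dir_deriv (concrete_log_likelihood x) p a * dir_deriv (concrete_log_likelihood x) p b
      \<partial>concrete_distribution (append_last (fst p)) (snd p))"

text \<open>
  \<open>Basis\<close> consists of the unit vectors of the coordinates \<open>(\<beta>\<^sub>1, \<dots>, \<beta>\<^sub>K\<^sub>-\<^sub>1, \<tau>)\<close>, and
  \<open>u \<bullet> a\<close> is the value of the corresponding coordinate differential on \<open>u\<close>.
\<close>

definition information_metric ::
  "(real^'m) \<times> real \<Rightarrow> (real^'m) \<times> real \<Rightarrow> (real^'m) \<times> real \<Rightarrow> real"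
  where "information_metric p u v =
    (\<Sum>a\<in>Basis. \<Sum>b\<in>Basis. fisher_information p a b * (u \<bullet> a) * (v \<bullet> b))"

end

theory Submission
  imports Defs "HOL-Probability.Probability"
begin

text \<open>
  If \<open>z\<^sub>i > 0\<close> are independent Frechet variables, i.e. \<open>e\<^sub>i = \<beta>\<^sub>i z\<^sub>i\<^bsup>-\<tau>\<^esup>\<close> are independent standard exponential
  variables, then the Concrete distribution is the law of \<open>z / \<Sum>z\<close>. The sum \<open>T = \<Sum>e\<close> is independent of
  \<open>z / \<Sum>z\<close> and \<open>E T\<^sup>2 = K (K + 1)\<close>, so the Fisher information is
  \<open>E[(T s\<^sub>a) (T s\<^sub>b)] / (K (K + 1))\<close> for the scores \<open>s\<^sub>a\<close>, where every \<open>T s\<^sub>a\<close> is a polynomial in the \<open>e\<^sub>i\<close> and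
  \<open>ln e\<^sub>i\<close>. With \<open>V = e - 1\<close>, \<open>W = ln e + \<gamma>\<close> and \<open>Q = 1 + V (1 - W)\<close> it has the Hoeffding decomposition
  \<open>T s = \<Sum>\<^sub>j (c (K - 1) Q\<^sub>j + d\<^sub>j V\<^sub>j) + c \<Sum>\<^bsub>j \<noteq> k\<^esub> V\<^sub>j W\<^sub>k\<close> into orthogonal terms, whose second moments follow
  from the derivatives of the Gamma function at 1, 2 and 3. In the coordinates \<open>\<phi>\<^sub>i = ln \<beta>\<^sub>i / \<tau>\<close> and \<open>y = 1 / \<tau>\<close> the
  metric becomes \<open>(q(d\<phi>) + l\<^sup>2 dy\<^sup>2) / y\<^sup>2\<close> with the constant quadratic form
  \<open>q(a) = (K \<Sum>a\<^sub>i\<^sup>2 - (\<Sum>a\<^sub>i)\<^sup>2) / (K + 1)\<close> on \<open>\<real>\<^sup>K\<close> modulo constants, and a linear map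
  turns \<open>q\<close> into \<open>l\<^sup>2\<close> times the Euclidean form.
\<close>

section \<open>Constant curvature of the half-space metric\<close>

text \<open>The score contains the shares e_i / T, in which numerator and denominator are dependent.
  Multiplying each of the two scores by T clears the denominators, and the factor T^2 that this
  costs is moved into the measure. The independence that permits it is never stated as such: it is
  checked along every ray, where the radial integral of the reweighted product density is a Gamma
  integral that returns exactly the Concrete density. The normalisation K (K + 1) is the second
  moment of T, a Gamma variable of shape K.

  The coordinates \<phi> can be read off from the score: expressing ln z_i through ln e_i leaves the
  coefficient d\<beta>_i / \<beta>_i - (d\<tau> / \<tau>) ln \<beta>_i, which is \<tau> d\<phi>_i.
  Since Q is orthogonal to V, no term mixes d\<tau> with d\<phi>. With \<zeta> = pi^2 / 6, the
  square of d\<tau> / \<tau> receives K (K - 1)^2 \<zeta> from the Q_j and K (K - 1) (\<zeta> + 1)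
  from the products V_j W_k, together K (K - 1) (K \<zeta> + 1); division by K (K + 1) gives
  l^2.\<close>

lemma dir_deriv_eq:
  assumes "(F has_derivative F') (at p)"
  shows "dir_deriv F p u = F' u"
proof -
  interpret F': bounded_linear F'
    using assms by (rule has_derivative_bounded_linear)
  have "((\<lambda>t. F (p + t *\<^sub>R u)) has_derivative (\<lambda>t. F' (t *\<^sub>R u))) (at 0)"
    by (rule has_derivative_compose[of "\<lambda>t. p + t *\<^sub>R u" "\<lambda>t. t *\<^sub>R u"])
       (auto intro!: derivative_eq_intros assms)
  then show ?thesis
    unfolding dir_deriv_def
    by (intro vector_derivative_at) (simp add: has_vector_derivative_def F'.scaleR)
qed

lemma dir_deriv_has_field_derivative:
  fixes F :: "'a::real_normed_vector \<Rightarrow> real"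
  assumes "((\<lambda>t. F (p + t *\<^sub>R u)) has_real_derivative D) (at 0)"
  shows "dir_deriv F p u = D"
  unfolding dir_deriv_def
  using assms by (intro vector_derivative_at) (simp add: has_real_derivative_iff_has_vector_derivative)

text \<open>The height times the Christoffel symbol of the half-space model. This bilinear map does
  not depend on the point, so differentiating the symbol only affects the factor 1 / y.\<close>

definition hyp_gamma :: "'a::euclidean_space \<times> real \<Rightarrow> 'a \<times> real \<Rightarrow> 'a \<times> real"
  where "hyp_gamma u v = (u \<bullet> v) *\<^sub>R (0, 1) - snd u *\<^sub>R v - snd v *\<^sub>R u"

lemma hyp_gamma_inner: "hyp_gamma u v \<bullet> z = (u \<bullet> v) * snd z - snd u * (v \<bullet> z) - snd v * (u \<bullet> z)"
  by (cases z) (simp add: hyp_gamma_def inner_diff_left)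

lemma dir_deriv_hyperbolic_metric:
  assumes "snd p > 0"
  shows "dir_deriv (\<lambda>q. hyperbolic_metric r q v z) p u = - 2 * r\<^sup>2 * (v \<bullet> z) * snd u / snd p ^ 3"
  unfolding hyperbolic_metric_def using assms
  by (intro dir_deriv_has_field_derivative)
     (auto intro!: derivative_eq_intros simp: divide_simps power2_eq_square power3_eq_cube)

lemma christoffel_hyperbolic:
  fixes p :: "(real^'m) \<times> real"
  assumes p: "snd p > 0" and r: "r \<noteq> 0"
  shows "christoffel (hyperbolic_metric r) p u v = inverse (snd p) *\<^sub>R hyp_gamma u v"
proof -
  let ?w = "inverse (snd p) *\<^sub>R hyp_gamma u v"
  have w: "hyperbolic_metric r p ?w z =
      (dir_deriv (\<lambda>q. hyperbolic_metric r q v z) p u + dir_deriv (\<lambda>q. hyperbolic_metric r q u z) p v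
       - dir_deriv (\<lambda>q. hyperbolic_metric r q u v) p z) / 2" for z
    unfolding dir_deriv_hyperbolic_metric[OF p] hyperbolic_metric_def[of r p] inner_scaleR_left hyp_gamma_inner
    using p by (simp add: field_simps power2_eq_square power3_eq_cube)
  \<comment> \<open>The definite description in \<open>christoffel\<close> needs uniqueness, that is
    nondegeneracy of the metric: testing against the difference itself shows that its norm is
    zero.\<close>
  have "w' = ?w" if "\<forall>z. hyperbolic_metric r p w' z = hyperbolic_metric r p ?w z" for w'
  proof -
    have "(w' - ?w) \<bullet> (w' - ?w) = 0"
      using that[rule_format, of "w' - ?w"] p r
      unfolding hyperbolic_metric_def inner_diff_left[of w' ?w] by simp
    then show ?thesis
      unfolding inner_eq_zero_iff by (simp only: right_minus_eq)
  qed
  then show ?thesis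
    unfolding christoffel_def w[symmetric] by (intro the_equality) auto
qed

lemma dir_deriv_christoffel_hyperbolic:
  fixes p :: "(real^'m) \<times> real"
  assumes p: "snd p > 0" and r: "r \<noteq> 0"
  shows "dir_deriv (\<lambda>q. christoffel (hyperbolic_metric r) q v w) p u
       = (- snd u / (snd p)\<^sup>2) *\<^sub>R hyp_gamma v w"
proof -
  have "((\<lambda>q. inverse (snd q) *\<^sub>R hyp_gamma v w) has_derivative
      (\<lambda>u. (- snd u / (snd p)\<^sup>2) *\<^sub>R hyp_gamma v w)) (at p)"
    using p by (auto intro!: derivative_eq_intros simp: power2_eq_square divide_simps)
  \<comment> \<open>The closed form of the symbol is known only at positive height, so the
    derivative is transferred on that open set.\<close>
  then have "((\<lambda>q. christoffel (hyperbolic_metric r) q v w) has_derivative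
      (\<lambda>u. (- snd u / (snd p)\<^sup>2) *\<^sub>R hyp_gamma v w)) (at p)"
    by (rule has_derivative_transform_within_open[of _ _ _ _ "{q. snd q > 0}"])
       (use p r in \<open>auto simp: christoffel_hyperbolic intro!: open_Collect_less continuous_intros\<close>)
  then show ?thesis by (rule dir_deriv_eq)
qed

lemma snd_hyp_gamma: "snd (hyp_gamma u v) = u \<bullet> v - 2 * snd u * snd v"
  by (simp add: hyp_gamma_def)

lemma hyp_gamma_scale: "hyp_gamma u (c *\<^sub>R v) = c *\<^sub>R hyp_gamma u v"
  by (simp add: hyp_gamma_def algebra_simps)

lemma riemann_curvature_hyperbolic:
  fixes p :: "(real^'m) \<times> real"
  assumes p: "snd p > 0" and r: "r \<noteq> 0"
  shows "hyperbolic_metric r p (riemann_curvature (hyperbolic_metric r) p u v v) u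
       = - (r\<^sup>2 * ((u \<bullet> u) * (v \<bullet> v) - (u \<bullet> v)\<^sup>2) / snd p ^ 4)"
proof -
  \<comment> \<open>Every term carries 1 / y^2: a product of two symbols has one factor 1 / y each,
    and differentiating 1 / y produces the last two terms.\<close>
  have R: "riemann_curvature (hyperbolic_metric r) p u v v = inverse (snd p ^ 2) *\<^sub>R
      (hyp_gamma u (hyp_gamma v v) - hyp_gamma v (hyp_gamma u v)
       + snd v *\<^sub>R hyp_gamma u v - snd u *\<^sub>R hyp_gamma v v)"
    unfolding riemann_curvature_def
    using p r by (simp add: christoffel_hyperbolic dir_deriv_christoffel_hyperbolic hyp_gamma_scale
        scaleR_diff_right scaleR_add_right power2_eq_square inverse_eq_divide)
  have I: "(hyp_gamma u (hyp_gamma v v) - hyp_gamma v (hyp_gamma u v)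
       + snd v *\<^sub>R hyp_gamma u v - snd u *\<^sub>R hyp_gamma v v) \<bullet> u = (u \<bullet> v)\<^sup>2 - (u \<bullet> u) * (v \<bullet> v)"
    by (simp add: inner_diff_left inner_add_left hyp_gamma_inner snd_hyp_gamma inner_commute[of u v]
        inner_commute[of _ "hyp_gamma _ _"] algebra_simps power2_eq_square)
  show ?thesis
    unfolding R hyperbolic_metric_def[of r p] inner_scaleR_left I
    using p by (simp add: field_simps power2_eq_square power4_eq_xxxx)
qed

text \<open>Equality in Cauchy-Schwarz forces collinearity and hence dependence. The lemma keeps the
  denominator of the sectional curvature away from zero.\<close>

lemma independent_pair_Cauchy_Schwarz:
  fixes u v :: "'a::real_inner"
  assumes "u \<noteq> v" "independent {u, v}"
  shows "(u \<bullet> u) * (v \<bullet> v) - (u \<bullet> v)\<^sup>2 \<noteq> 0"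
proof
  assume "(u \<bullet> u) * (v \<bullet> v) - (u \<bullet> v)\<^sup>2 = 0"
  then have "\<bar>u \<bullet> v\<bar> = norm u * norm v"
    by (simp add: norm_eq_sqrt_inner real_sqrt_mult[symmetric] real_sqrt_unique)
  then have "collinear {0, u, v}"
    using norm_cauchy_schwarz_equal by blast
  then consider "u = 0" | "v = 0" | c where "v = c *\<^sub>R u"
    by (auto simp: collinear_lemma)
  then show False
  proof cases
    case (3 c)
    then have "v \<in> span {u}"
      by (simp add: span_base span_scale)
    then show False
      using assms by (auto simp: insert_commute[of u v] independent_insert)
  qed (use assms dependent_zero in auto)
qed

text \<open>Numerator and denominator are multiples of the same Gram determinant over the same power
  of the height, with the factors - r^2 and r^4.\<close>

theorem hyperbolic_metric_constant_curvature:
  assumes "r \<noteq> 0"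
  shows "has_constant_curvature (half_space :: ((real^'m) \<times> real) set) (hyperbolic_metric r) (- 1 / r\<^sup>2)"
  unfolding has_constant_curvature_def
proof (intro ballI allI impI)
  fix p u v :: "(real^'m) \<times> real"
  assume "p \<in> half_space" and uv: "u \<noteq> v \<and> independent {u, v}"
  then have p: "snd p > 0" by (simp add: half_space_def)
  define D where "D = (u \<bullet> u) * (v \<bullet> v) - (u \<bullet> v)\<^sup>2"
  have D: "D \<noteq> 0" unfolding D_def using uv independent_pair_Cauchy_Schwarz by blast
  have "hyperbolic_metric r p u u * hyperbolic_metric r p v v - (hyperbolic_metric r p u v)\<^sup>2
      = r ^ 4 * D / snd p ^ 4"
    unfolding hyperbolic_metric_def D_def using p
    by (simp add: field_simps power2_eq_square power4_eq_xxxx)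
  then show "sectional_curvature (hyperbolic_metric r) p u v = - 1 / r\<^sup>2"
    unfolding sectional_curvature_def riemann_curvature_hyperbolic[OF p assms] D_def[symmetric]
    using D p assms by (simp add: field_simps power2_eq_square power4_eq_xxxx)
qed

section \<open>Calculus of smooth functions\<close>

text \<open>On an open set the derivatives at its points depend only on the values there, at every
  order.\<close>

lemma Ck_on_cong:
  assumes "open S" "\<And>x. x \<in> S \<Longrightarrow> f x = g x" "Ck_on k S f"
  shows "Ck_on k S g"
  using assms
proof (induction k arbitrary: f g)
  case 0
  then show ?case by (simp cong: continuous_on_cong)
next
  case (Suc k)
  have "g differentiable (at x)" if x: "x \<in> S" for x
  proof -
    have "f differentiable (at x)"
      using x Suc.prems(3) by simp
    then obtain D where "(f has_derivative D) (at x)"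
      unfolding differentiable_def by blast
    then have "(g has_derivative D) (at x)"
      by (rule has_derivative_transform_within_open[OF _ Suc.prems(1) x Suc.prems(2)])
    then show ?thesis unfolding differentiable_def by blast
  qed
  moreover have "Ck_on k S (\<lambda>x. frechet_derivative g (at x) v)" for v
  proof (rule Suc.IH[OF Suc.prems(1)])
    show "Ck_on k S (\<lambda>x. frechet_derivative f (at x) v)"
      using Suc.prems(3) by simp
    show "frechet_derivative f (at x) v = frechet_derivative g (at x) v" if "x \<in> S" for x
      using that Suc.prems by (subst frechet_derivative_transform_within_open[of f x S g]) auto
  qed
  ultimately show ?case by simp
qed

text \<open>Replaces \<open>frechet_derivative\<close> by an explicit derivative formula; the basic
  closure rules below rest on it.\<close>

lemma Ck_on_SucI:
  assumes "open S" "\<And>x. x \<in> S \<Longrightarrow> (f has_derivative f' x) (at x)" "\<And>v. Ck_on k S (\<lambda>x. f' x v)"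
  shows "Ck_on (Suc k) S f"
proof -
  have "frechet_derivative f (at x) = f' x" if "x \<in> S" for x
    using assms(2)[OF that] frechet_derivative_at by metis
  then have "Ck_on k S (\<lambda>x. frechet_derivative f (at x) v)" for v
    by (intro Ck_on_cong[OF assms(1) _ assms(3)]) simp
  then show ?thesis
    using assms(2) by (auto simp: differentiable_def)
qed

text \<open>Derivative formulas such as the product rule contain the function itself, which is then
  needed at order \<open>k\<close> although it is given at order \<open>Suc k\<close>.\<close>

lemma Ck_on_Suc_imp: "Ck_on (Suc k) S f \<Longrightarrow> Ck_on k S f"
proof (induction k arbitrary: f)
  case 0
  then show ?case
    by (auto intro!: differentiable_imp_continuous_on differentiable_at_imp_differentiable_on)
next
  case (Suc k)
  have "f differentiable (at x)" if "x \<in> S" for x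
    using Suc.prems that unfolding Ck_on.simps(2)[of "Suc k"] by blast
  moreover have "Ck_on k S (\<lambda>x. frechet_derivative f (at x) v)" for v
    using Suc.prems unfolding Ck_on.simps(2)[of "Suc k"] by (intro Suc.IH) blast
  ultimately show ?case unfolding Ck_on.simps(2)[of k] by blast
qed

lemma Ck_on_SucD:
  assumes "Ck_on (Suc k) S f"
  shows "\<And>x. x \<in> S \<Longrightarrow> (f has_derivative frechet_derivative f (at x)) (at x)"
    and "\<And>v. Ck_on k S (\<lambda>x. frechet_derivative f (at x) v)"
  using assms by (auto simp: frechet_derivative_works)

lemma Ck_on_const: "open S \<Longrightarrow> Ck_on k S (\<lambda>x. c)"
proof (induction k arbitrary: c)
  case (Suc k)
  show ?case by (rule Ck_on_SucI[OF Suc.prems, of _ "\<lambda>_ _. 0"]) (auto intro: Suc)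
qed simp

lemma Ck_on_bounded_linear:
  assumes "open S" "bounded_linear f"
  shows "Ck_on k S f"
proof (cases k)
  case 0
  then show ?thesis using assms by (simp add: linear_continuous_on)
next
  case (Suc j)
  show ?thesis unfolding Suc
    by (rule Ck_on_SucI[OF assms(1), of _ "\<lambda>_. f"])
       (auto intro: Ck_on_const assms bounded_linear_imp_has_derivative)
qed

lemma Ck_on_bounded_linear_compose:
  assumes "open S" "bounded_linear L" "Ck_on k S f"
  shows "Ck_on k S (\<lambda>x. L (f x))"
  using assms(3)
proof (induction k arbitrary: f)
  case 0
  then show ?case using assms(2) by (auto intro: bounded_linear.continuous_on)
next
  case (Suc k)
  show ?case
  proof (rule Ck_on_SucI[OF assms(1)])
    show "((\<lambda>x. L (f x)) has_derivative (\<lambda>v. L (frechet_derivative f (at x) v))) (at x)" if "x \<in> S" for x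
      using that by (intro bounded_linear.has_derivative[OF assms(2)] Ck_on_SucD(1)[OF Suc.prems])
    show "Ck_on k S (\<lambda>x. L (frechet_derivative f (at x) v))" for v
      by (intro Suc.IH Ck_on_SucD(2)[OF Suc.prems])
  qed
qed

lemma Ck_on_add:
  assumes "open S" "Ck_on k S f" "Ck_on k S g"
  shows "Ck_on k S (\<lambda>x. f x + g x)"
  using assms(2,3)
proof (induction k arbitrary: f g)
  case 0
  then show ?case by (simp add: continuous_on_add)
next
  case (Suc k)
  show ?case
  proof (rule Ck_on_SucI[OF assms(1)])
    show "((\<lambda>x. f x + g x) has_derivative
        (\<lambda>v. frechet_derivative f (at x) v + frechet_derivative g (at x) v)) (at x)" if "x \<in> S" for x
      using that by (intro has_derivative_add Ck_on_SucD(1)[OF Suc.prems(1)] Ck_on_SucD(1)[OF Suc.prems(2)])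
    show "Ck_on k S (\<lambda>x. frechet_derivative f (at x) v + frechet_derivative g (at x) v)" for v
      by (intro Suc.IH Ck_on_SucD(2)[OF Suc.prems(1)] Ck_on_SucD(2)[OF Suc.prems(2)])
  qed
qed

lemma Ck_on_sum:
  assumes "open S" "\<And>i. i \<in> I \<Longrightarrow> Ck_on k S (f i)"
  shows "Ck_on k S (\<lambda>x. \<Sum>i\<in>I. f i x)"
  using assms(2)
proof (induction I rule: infinite_finite_induct)
  case (insert i I)
  then show ?case using Ck_on_add[OF assms(1), of k "f i"] by simp
qed (simp_all add: Ck_on_const assms(1))

lemma Ck_on_mult:
  fixes f g :: "'a::euclidean_space \<Rightarrow> real"
  assumes "open S" "Ck_on k S f" "Ck_on k S g"
  shows "Ck_on k S (\<lambda>x. f x * g x)"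
  using assms(2,3)
proof (induction k arbitrary: f g)
  case 0
  then show ?case by (simp add: continuous_on_mult)
next
  case (Suc k)
  show ?case
  proof (rule Ck_on_SucI[OF assms(1)])
    show "((\<lambda>x. f x * g x) has_derivative
        (\<lambda>v. f x * frechet_derivative g (at x) v + frechet_derivative f (at x) v * g x)) (at x)" if "x \<in> S" for x
      using that by (intro has_derivative_mult Ck_on_SucD(1)[OF Suc.prems(1)] Ck_on_SucD(1)[OF Suc.prems(2)])
    show "Ck_on k S (\<lambda>x. f x * frechet_derivative g (at x) v + frechet_derivative f (at x) v * g x)" for v
      by (intro Ck_on_add assms(1) Suc.IH Ck_on_SucD(2)[OF Suc.prems(1)] Ck_on_SucD(2)[OF Suc.prems(2)]
          Ck_on_Suc_imp[OF Suc.prems(1)] Ck_on_Suc_imp[OF Suc.prems(2)])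
  qed
qed

text \<open>The derivative is built from the derivative of \<open>f\<close> and from the inverse of
  the same \<open>f\<close>, so the induction can keep \<open>f\<close> fixed.\<close>

lemma Ck_on_inverse:
  fixes f :: "'a::euclidean_space \<Rightarrow> real"
  assumes "open S" "Ck_on k S f" and nz: "\<And>x. x \<in> S \<Longrightarrow> f x \<noteq> 0"
  shows "Ck_on k S (\<lambda>x. inverse (f x))"
  using assms(2)
proof (induction k)
  case 0
  then show ?case using nz by (simp add: continuous_on_inverse)
next
  case (Suc k)
  note IH = Suc.IH[OF Ck_on_Suc_imp[OF Suc.prems]]
  show ?case
  proof (rule Ck_on_SucI[OF assms(1)])
    show "((\<lambda>x. inverse (f x)) has_derivative
        (\<lambda>v. - (inverse (f x) * frechet_derivative f (at x) v * inverse (f x)))) (at x)" if "x \<in> S" for x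
      by (rule Deriv.has_derivative_inverse[OF nz[OF that] Ck_on_SucD(1)[OF Suc.prems that]])
    have "Ck_on k S (\<lambda>x. - 1 * (inverse (f x) * frechet_derivative f (at x) v * inverse (f x)))" for v
      by (rule Ck_on_mult[OF assms(1) Ck_on_const[OF assms(1)]
          Ck_on_mult[OF assms(1) Ck_on_mult[OF assms(1) IH Ck_on_SucD(2)[OF Suc.prems]] IH]])
    then show "Ck_on k S (\<lambda>x. - (inverse (f x) * frechet_derivative f (at x) v * inverse (f x)))" for v
      by simp
  qed
qed

text \<open>No induction: a single derivative turns the logarithm into an inverse, which is already
  covered.\<close>

lemma Ck_on_ln:
  fixes f :: "'a::euclidean_space \<Rightarrow> real"
  assumes "open S" "Ck_on k S f" and pos: "\<And>x. x \<in> S \<Longrightarrow> f x > 0"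
  shows "Ck_on k S (\<lambda>x. ln (f x))"
proof (cases k)
  case 0
  then show ?thesis using assms by (simp add: continuous_on_ln less_imp_neq[symmetric])
next
  case (Suc j)
  note f = assms(2)[unfolded Suc]
  have nz: "f x \<noteq> 0" if "x \<in> S" for x using pos[OF that] by simp
  show ?thesis unfolding Suc
  proof (rule Ck_on_SucI[OF assms(1)])
    show "((\<lambda>x. ln (f x)) has_derivative (\<lambda>v. frechet_derivative f (at x) v * inverse (f x))) (at x)"
      if "x \<in> S" for x
      by (rule DERIV_compose_FDERIV[OF DERIV_ln[OF pos[OF that]] Ck_on_SucD(1)[OF f that]])
    show "Ck_on j S (\<lambda>x. frechet_derivative f (at x) v * inverse (f x))" for v
      by (rule Ck_on_mult[OF assms(1) Ck_on_SucD(2)[OF f] Ck_on_inverse[OF assms(1) Ck_on_Suc_imp[OF f] nz]])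
  qed
qed

lemma Ck_on_exp:
  fixes f :: "'a::euclidean_space \<Rightarrow> real"
  assumes "open S" "Ck_on k S f"
  shows "Ck_on k S (\<lambda>x. exp (f x))"
  using assms(2)
proof (induction k)
  case 0
  then show ?case by (simp add: continuous_on_exp)
next
  case (Suc k)
  show ?case
  proof (rule Ck_on_SucI[OF assms(1)])
    show "((\<lambda>x. exp (f x)) has_derivative (\<lambda>v. frechet_derivative f (at x) v * exp (f x))) (at x)"
      if "x \<in> S" for x
      by (rule DERIV_compose_FDERIV[OF DERIV_exp Ck_on_SucD(1)[OF Suc.prems that]])
    show "Ck_on k S (\<lambda>x. frechet_derivative f (at x) v * exp (f x))" for v
      by (rule Ck_on_mult[OF assms(1) Ck_on_SucD(2)[OF Suc.prems] Suc.IH[OF Ck_on_Suc_imp[OF Suc.prems]]])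
  qed
qed

lemma Ck_on_scaleR_const:
  fixes f :: "'a::euclidean_space \<Rightarrow> real"
  assumes "open S" "Ck_on k S f"
  shows "Ck_on k S (\<lambda>x. f x *\<^sub>R c)"
  using assms by (intro Ck_on_bounded_linear_compose[of S "\<lambda>t. t *\<^sub>R c"] bounded_linear_scaleR_left)

lemma Ck_on_componentwise:
  fixes f :: "'a::euclidean_space \<Rightarrow> 'b::euclidean_space"
  assumes "open S" "\<And>b. b \<in> Basis \<Longrightarrow> Ck_on k S (\<lambda>x. f x \<bullet> b)"
  shows "Ck_on k S f"
proof (rule Ck_on_cong[OF assms(1)])
  show "Ck_on k S (\<lambda>x. \<Sum>b\<in>Basis. (f x \<bullet> b) *\<^sub>R b)"
    using assms by (intro Ck_on_sum Ck_on_scaleR_const)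
qed (simp add: euclidean_representation)

section \<open>Logarithmic moments of the exponential distribution\<close>

text \<open>Since both signs of \<open>s\<close> are allowed, exp |s X| is integrable. It bounds the
  sum of the absolute values of the exponential series, which justifies exchanging sum and
  integral.\<close>

lemma mgf_power_series:
  fixes X :: "'a \<Rightarrow> real"
  assumes [measurable]: "X \<in> borel_measurable M"
    and int: "\<And>s. \<bar>s\<bar> < \<delta> \<Longrightarrow> integrable M (\<lambda>x. exp (s * X x))"
    and s: "\<bar>s\<bar> < \<delta>"
  shows "integrable M (\<lambda>x. X x ^ n)"
    and "(\<lambda>n. (\<integral>x. X x ^ n \<partial>M) / fact n * s ^ n) sums (\<integral>x. exp (s * X x) \<partial>M)"
proof -
  have int_abs: "integrable M (\<lambda>x. exp \<bar>s * X x\<bar>)" if "\<bar>s\<bar> < \<delta>" for s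
  proof (rule Bochner_Integration.integrable_bound)
    show "integrable M (\<lambda>x. exp (s * X x) + exp (- s * X x))"
      using int[of s] int[of "- s"] that by simp
    show "AE x in M. norm (exp \<bar>s * X x\<bar>) \<le> norm (exp (s * X x) + exp (- s * X x))"
    proof (intro AE_I2)
      fix x
      have "exp \<bar>s * X x\<bar> \<le> exp (s * X x) + exp (- s * X x)"
        by (cases "s * X x < 0") simp_all
      then show "norm (exp \<bar>s * X x\<bar>) \<le> norm (exp (s * X x) + exp (- s * X x))"
        using add_pos_pos[OF exp_gt_zero exp_gt_zero, of "s * X x" "- s * X x"] by simp
    qed
  qed simp
  \<comment> \<open>A single term of the exponential series is at most the whole sum; this bounds
    every power of X by an exponential.\<close>
  have term_le: "\<bar>y\<bar> ^ k / fact k \<le> exp \<bar>y\<bar>" for y :: real and k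
    using exp_ge_one_plus_x_over_n_power_n sum_le_suminf[OF summable_exp[of "\<bar>y\<bar>"], of "{k}"]
    by (simp add: exp_def field_simps)
  have int_pow: "integrable M (\<lambda>x. X x ^ k)" for k
  proof (rule Bochner_Integration.integrable_bound)
    define r where "r = \<delta> / 2"
    have r: "0 < r" "\<bar>r\<bar> < \<delta>" using s by (auto simp: r_def)
    show "integrable M (\<lambda>x. fact k / r ^ k * exp \<bar>r * X x\<bar>)"
      using int_abs[OF r(2)] by simp
    show "AE x in M. norm (X x ^ k) \<le> norm (fact k / r ^ k * exp \<bar>r * X x\<bar>)"
    proof (intro AE_I2)
      fix x
      show "norm (X x ^ k) \<le> norm (fact k / r ^ k * exp \<bar>r * X x\<bar>)"
        using term_le[of "r * X x" k] r(1)
        by (simp add: abs_mult power_mult_distrib power_abs field_simps)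
    qed
  qed simp
  show "integrable M (\<lambda>x. X x ^ n)" by (rule int_pow)
  let ?f = "\<lambda>k x. (s * X x) ^ k / fact k"
  have "(\<lambda>k. \<integral>x. ?f k x \<partial>M) sums (\<integral>x. (\<Sum>k. ?f k x) \<partial>M)"
  proof (rule sums_integral)
    show i: "integrable M (?f k)" for k
      using int_pow[of k] by (simp add: power_mult_distrib)
    have *: "summable (\<lambda>k. norm (?f k x))" "(\<Sum>k. norm (?f k x)) = exp \<bar>s * X x\<bar>" for x
      using summable_exp[of "\<bar>s * X x\<bar>"] by (simp_all add: exp_def power_abs abs_mult field_simps)
    show "AE x in M. summable (\<lambda>k. norm (?f k x))" using * by simp
    show "summable (\<lambda>k. \<integral>x. norm (?f k x) \<partial>M)"
    proof (rule summableI_nonneg_bounded)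
      fix N
      have "(\<Sum>k<N. \<integral>x. norm (?f k x) \<partial>M) = (\<integral>x. (\<Sum>k<N. norm (?f k x)) \<partial>M)"
        by (intro Bochner_Integration.integral_sum[symmetric] integrable_norm i)
      also have "\<dots> \<le> (\<integral>x. exp \<bar>s * X x\<bar> \<partial>M)"
      proof (intro integral_mono Bochner_Integration.integrable_sum integrable_norm i int_abs s)
        fix x
        show "(\<Sum>k<N. norm (?f k x)) \<le> exp \<bar>s * X x\<bar>"
          unfolding *(2)[symmetric] by (rule sum_le_suminf[OF *(1)]) auto
      qed
      finally show "(\<Sum>k<N. \<integral>x. norm (?f k x) \<partial>M) \<le> (\<integral>x. exp \<bar>s * X x\<bar> \<partial>M)" .
    qed simp
  qed
  then show "(\<lambda>n. (\<integral>x. X x ^ n \<partial>M) / fact n * s ^ n) sums (\<integral>x. exp (s * X x) \<partial>M)"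
    by (simp add: exp_def power_mult_distrib field_simps)
qed

text \<open>The generating function has one derivative by assumption and another by termwise
  differentiation of its moment series; uniqueness of derivatives identifies the moments. No
  differentiation under the integral sign occurs.\<close>

lemma moments_from_mgf:
  fixes X :: "'a \<Rightarrow> real"
  assumes [measurable]: "X \<in> borel_measurable M" and "\<delta> > 0"
    and mgf: "\<And>s. \<bar>s\<bar> < \<delta> \<Longrightarrow> has_bochner_integral M (\<lambda>x. exp (s * X x)) (F s)"
    and F': "\<And>s. \<bar>s\<bar> < \<delta> \<Longrightarrow> (F has_real_derivative F' s) (at s)"
    and F'': "(F' has_real_derivative F'') (at 0)"
  shows "has_bochner_integral M X (F' 0)" "has_bochner_integral M (\<lambda>x. X x ^ 2) F''"
    "integrable M (\<lambda>x. X x ^ n)"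
proof -
  have int: "integrable M (\<lambda>x. exp (s * X x))" if "\<bar>s\<bar> < \<delta>" for s
    using mgf[OF that] by (simp add: has_bochner_integral_iff)
  note ps = mgf_power_series[OF assms(1) int]
  have intpow: "integrable M (\<lambda>x. X x ^ n)" for n
    by (rule mgf_power_series(1)[OF assms(1) int, of \<delta> 0]) (use \<open>\<delta> > 0\<close> in auto)
  define c where "c n = (\<integral>x. X x ^ n \<partial>M) / fact n" for n
  have sums: "(\<lambda>n. c n * s ^ n) sums F s" if "\<bar>s\<bar> < \<delta>" for s
    using ps(2)[OF _ that] has_bochner_integral_integral_eq[OF mgf[OF that]] by (simp add: c_def)
  have D1: "((\<lambda>s. \<Sum>n. c n * s ^ n) has_real_derivative (\<Sum>n. diffs c n * s ^ n)) (at s)" if "\<bar>s\<bar> < \<delta>" for s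
    using that sums by (intro termdiffs_strong'[of \<delta>]) (auto simp: sums_iff)
  have ev: "\<forall>\<^sub>F x in nhds s. \<bar>x\<bar> < \<delta>" if "\<bar>s\<bar> < \<delta>" for s :: real
    using that by (intro eventually_nhds_in_open[of "{x. \<bar>x\<bar> < \<delta>}", simplified] open_Collect_less continuous_intros) 
  \<comment> \<open>The equality is required on a whole neighbourhood of 0, because
    \<open>F'\<close> is differentiated once more.\<close>
  have F'_eq: "F' s = (\<Sum>n. diffs c n * s ^ n)" if "\<bar>s\<bar> < \<delta>" for s
  proof -
    have "(F has_real_derivative (\<Sum>n. diffs c n * s ^ n)) (at s)"
    proof (subst DERIV_cong_ev[OF refl _ refl])
      show "\<forall>\<^sub>F x in nhds s. F x = (\<Sum>n. c n * x ^ n)"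
        using ev[OF that] by eventually_elim (use sums sums_unique in blast)
    qed (rule D1[OF that])
    then show ?thesis using F'[OF that] DERIV_unique by blast
  qed
  have "summable (\<lambda>n. diffs c n * s ^ n)" if "\<bar>s\<bar> < \<delta>" for s
    using that sums by (intro termdiff_converges[of s \<delta>]) (auto simp: sums_iff)
  then have "((\<lambda>s. \<Sum>n. diffs c n * s ^ n) has_real_derivative (\<Sum>n. diffs (diffs c) n * 0 ^ n)) (at 0)"
    using \<open>\<delta> > 0\<close> by (intro termdiffs_strong'[of \<delta>]) auto
  moreover have "\<forall>\<^sub>F s in nhds 0. F' s = (\<Sum>n. diffs c n * s ^ n)"
    using ev[of 0] \<open>\<delta> > 0\<close> by (auto elim!: eventually_mono simp: F'_eq)
  ultimately have "(F' has_real_derivative diffs (diffs c) 0) (at 0)"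
    by (simp add: DERIV_cong_ev[OF refl _ refl] powser_zero)
  then have "F'' = diffs (diffs c) 0"
    using F'' DERIV_unique by blast
  \<comment> \<open>\<open>diffs (diffs c) 0\<close> is 2 * \<open>c 2\<close>, and this 2 cancels
    the factorial in \<open>c 2\<close>.\<close>
  then have "(\<integral>x. X x ^ 2 \<partial>M) = F''"
    by (simp add: diffs_def c_def numeral_2_eq_2)
  then show "has_bochner_integral M (\<lambda>x. X x ^ 2) F''"
    using intpow has_bochner_integral_iff by blast
  have "F' 0 = diffs c 0" using \<open>\<delta> > 0\<close> by (simp add: F'_eq)
  then have "(\<integral>x. X x ^ 1 \<partial>M) = F' 0"
    by (simp add: diffs_def c_def)
  then show "has_bochner_integral M X (F' 0)"
    using intpow[of 1] by (simp add: has_bochner_integral_iff)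
  show "integrable M (\<lambda>x. X x ^ n)" by (rule intpow)
qed

text \<open>The shift by Euler's constant centres \<open>ln\<close> under the exponential distribution.\<close>

definition clog :: "real \<Rightarrow> real"
  where "clog t = ln t + euler_mascheroni"

lemma borel_measurable_clog [measurable]: "clog \<in> borel_measurable borel"
  unfolding clog_def by measurable

text \<open>Multiplying the Erlang density by t^s gives the Gamma integrand at k + 1 + s, up to fact
  k; the exponential factor comes from the shift in \<open>clog\<close>. The bound on
  \<open>s\<close> keeps the argument positive even for \<open>k = 0\<close>.\<close>

lemma mgf_clog_erlang:
  assumes s: "\<bar>s\<bar> < 1"
  shows "has_bochner_integral (density lborel (erlang_density k 1)) (\<lambda>t. exp (s * clog t))
    (exp (euler_mascheroni * s) * Gamma (real k + 1 + s) / fact k)"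
proof (rule has_bochner_integral_nn_integral)
  have pos: "real k + 1 + s > 0" using s by linarith
  show "0 \<le> exp (euler_mascheroni * s) * Gamma (real k + 1 + s) / fact k"
    using pos by (simp add: Gamma_real_nonneg)
  have "(\<integral>\<^sup>+t. ennreal (exp (s * clog t)) \<partial>density lborel (erlang_density k 1)) =
      (\<integral>\<^sup>+t. ennreal (erlang_density k 1 t) * ennreal (exp (s * clog t)) \<partial>lborel)"
    by (intro nn_integral_density) auto
  also have "\<dots> = (\<integral>\<^sup>+t. ennreal (exp (euler_mascheroni * s) / fact k) *
        ennreal (indicator {0..} t * t powr (real k + 1 + s - 1) / exp t) \<partial>lborel)"
  proof (intro nn_integral_cong_AE)
    \<comment> \<open>For \<open>k = 0\<close> the integrands differ at 0: \<open>ln 0 = 0\<close>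
      gives a positive value on the left, whereas \<open>0 powr s = 0\<close> on the right.\<close>
    have "AE t in lborel. t \<noteq> (0::real)" by (rule AE_lborel_singleton)
    then show "AE t in lborel. ennreal (erlang_density k 1 t) * ennreal (exp (s * clog t)) =
      ennreal (exp (euler_mascheroni * s) / fact k) *
        ennreal (indicator {0..} t * t powr (real k + 1 + s - 1) / exp t)"
    proof eventually_elim
      case (elim t)
      show ?case
      proof (cases "t > 0")
        case True
        then have "t powr (real k + 1 + s - 1) = t ^ k * exp (s * ln t)"
          by (simp add: powr_add powr_realpow) (simp add: powr_def)
        then show ?thesis using True
          by (simp add: erlang_density_def clog_def ennreal_mult[symmetric] exp_minus field_simps exp_add)
      qed (use elim in \<open>simp add: erlang_density_def\<close>)
    qed
  qed
  also have "\<dots> = ennreal (exp (euler_mascheroni * s) / fact k) * ennreal (Gamma (real k + 1 + s))"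
    by (simp add: nn_integral_cmult Gamma_conv_nn_integral_real[OF pos])
  also have "\<dots> = ennreal (exp (euler_mascheroni * s) * Gamma (real k + 1 + s) / fact k)"
    using pos by (simp add: ennreal_mult[symmetric] Gamma_real_nonneg)
  finally show "(\<integral>\<^sup>+t. ennreal (exp (s * clog t)) \<partial>density lborel (erlang_density k 1)) = 
    ennreal (exp (euler_mascheroni * s) * Gamma (real k + 1 + s) / fact k)" .
qed auto

text \<open>The generating function is 1 at 0 and has logarithmic derivative Digamma plus Euler's
  constant. Hence its first two derivatives at 0 are \<psi> and the trigamma value plus
  \<psi>^2.\<close>

lemma clog_erlang_moments:
  fixes k :: nat
  defines "M \<equiv> density lborel (erlang_density k 1)"
    and "\<psi> \<equiv> Digamma (real k + 1) + euler_mascheroni"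
  shows "has_bochner_integral M clog \<psi>"
    and "has_bochner_integral M (\<lambda>t. clog t ^ 2) (Polygamma 1 (real k + 1) + \<psi>\<^sup>2)"
    and "integrable M (\<lambda>t. clog t ^ n)"
proof -
  define G where "G s = exp (euler_mascheroni * s) * Gamma (real k + 1 + s) / fact k" for s
  have *: "real k + 1 + s \<notin> \<int>\<^sub>\<le>\<^sub>0" if "\<bar>s\<bar> < 1" for s
    using that nonpos_Ints_nonpos by fastforce
  have D: "(G has_real_derivative G s * (Digamma (real k + 1 + s) + euler_mascheroni)) (at s)"
    if "\<bar>s\<bar> < 1" for s
    unfolding G_def using *[OF that]
    by (auto intro!: derivative_eq_intros simp: field_simps)
  have D': "((\<lambda>s. G s * (Digamma (real k + 1 + s) + euler_mascheroni)) has_real_derivative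
      G 0 * Polygamma 1 (real k + 1) + G 0 * \<psi> * \<psi>) (at 0)"
    using *[of 0] by (auto intro!: derivative_eq_intros D[of 0] simp: \<psi>_def)
  have "Gamma (real k + 1) = fact k"
    using Gamma_fact[of k, where 'a=real] by (simp add: add.commute)
  then have G0: "G 0 = 1" by (simp add: G_def)
  have clog: "clog \<in> borel_measurable M" by (simp add: M_def)
  have mgf: "has_bochner_integral M (\<lambda>x. exp (s * clog x)) (G s)" if "\<bar>s\<bar> < 1" for s
    unfolding M_def G_def by (rule mgf_clog_erlang[OF that])
  note mom = moments_from_mgf[OF clog zero_less_one mgf D D']
  show "has_bochner_integral M clog \<psi>"
    using mom(1) by (simp add: G0 \<psi>_def)
  show "has_bochner_integral M (\<lambda>t. clog t ^ 2) (Polygamma 1 (real k + 1) + \<psi>\<^sup>2)"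
    using mom(2) by (simp add: G0 power2_eq_square)
  show "integrable M (\<lambda>t. clog t ^ n)" by (rule mom(3))
qed

section \<open>Mixed moments of t and ln t under the standard exponential law\<close>

abbreviation exp1 :: "real measure"
  where "exp1 \<equiv> density lborel (exponential_density 1)"

text \<open>The weight t^k turns the exponential density into fact k times an Erlang density, so
  mixed moments reduce to purely logarithmic ones.\<close>

lemma has_bochner_integral_exp1_power:
  assumes [measurable]: "f \<in> borel_measurable borel"
    and "has_bochner_integral (density lborel (erlang_density k 1)) f v"
  shows "has_bochner_integral exp1 (\<lambda>t. t ^ k * f t) (fact k * v)"
proof -
  have "has_bochner_integral lborel (\<lambda>t. erlang_density k 1 t *\<^sub>R f t) v"
    using assms(2) by (simp add: has_bochner_integral_iff integrable_density integral_density)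
  then have "has_bochner_integral lborel (\<lambda>t. fact k * (erlang_density k 1 t *\<^sub>R f t)) (fact k * v)"
    by (rule has_bochner_integral_mult_right)
  also have "(\<lambda>t. fact k * (erlang_density k 1 t *\<^sub>R f t)) = (\<lambda>t. exponential_density 1 t *\<^sub>R (t ^ k * f t))"
    by (auto simp: erlang_density_def)
  finally show ?thesis
    by (intro has_bochner_integral_density) auto
qed

lemma Polygamma_1_1: "Polygamma 1 (1::real) = pi\<^sup>2 / 6"
  using inverse_squares_sums by (simp add: Polygamma_def sums_iff field_simps power2_eq_square)

lemma Digamma_Polygamma_values:
  "Digamma (2::real) = 1 - euler_mascheroni" "Digamma (3::real) = 3 / 2 - euler_mascheroni"
  "Polygamma 1 (2::real) = pi\<^sup>2 / 6 - 1" "Polygamma 1 (3::real) = pi\<^sup>2 / 6 - 5 / 4"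
  using Digamma_plus1[of "1::real"] Digamma_plus1[of "2::real"]
    Polygamma_plus1[of "1::real" 1] Polygamma_plus1[of "2::real" 1]
  by (simp_all add: Polygamma_1_1[simplified])

lemma exp1_moments:
  "has_bochner_integral exp1 (\<lambda>t. 1::real) 1"
  "has_bochner_integral exp1 (\<lambda>t. t) 1"
  "has_bochner_integral exp1 (\<lambda>t. t\<^sup>2) 2"
  "has_bochner_integral exp1 clog 0"
  "has_bochner_integral exp1 (\<lambda>t. t * clog t) 1"
  "has_bochner_integral exp1 (\<lambda>t. t\<^sup>2 * clog t) 3"
  "has_bochner_integral exp1 (\<lambda>t. (clog t)\<^sup>2) (pi\<^sup>2 / 6)"
  "has_bochner_integral exp1 (\<lambda>t. t * (clog t)\<^sup>2) (pi\<^sup>2 / 6)"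
  "has_bochner_integral exp1 (\<lambda>t. t\<^sup>2 * (clog t)\<^sup>2) (2 * (pi\<^sup>2 / 6) + 2)"
proof -
  have one: "has_bochner_integral (density lborel (erlang_density k 1)) (\<lambda>t. 1::real) 1" for k
    using prob_space.prob_space[OF prob_space_erlang_density[of 1 k]]
      has_bochner_integral_real_indicator[of UNIV "density lborel (erlang_density k 1)"]
      prob_space.emeasure_space_1[OF prob_space_erlang_density[of 1 k]]
    by (simp add: indicator_def)
  have "(\<lambda>t. (clog t)\<^sup>2) \<in> borel_measurable borel" by measurable
  note P2 = has_bochner_integral_exp1_power[OF this clog_erlang_moments(2)]
  note P = has_bochner_integral_exp1_power[where f = "\<lambda>_. 1", OF _ one, simplified]
    and P1 = has_bochner_integral_exp1_power[OF _ clog_erlang_moments(1)]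
  show "has_bochner_integral exp1 (\<lambda>t. 1::real) 1" "has_bochner_integral exp1 (\<lambda>t. t) 1"
    "has_bochner_integral exp1 (\<lambda>t. t\<^sup>2) 2"
    using P[of 0] P[of 1] P[of 2] by simp_all
  show "has_bochner_integral exp1 clog 0" "has_bochner_integral exp1 (\<lambda>t. t * clog t) 1"
    "has_bochner_integral exp1 (\<lambda>t. t\<^sup>2 * clog t) 3"
    using P1[of 0] P1[of 1] P1[of 2] by (simp_all add: Digamma_Polygamma_values)
  have "real 2 + 1 = 3" "real 1 + 1 = 2" "real 0 + 1 = 1" by simp_all
  note P2' = P2[of 0, unfolded this] P2[of 1, unfolded this] P2[of 2, unfolded this]
  show "has_bochner_integral exp1 (\<lambda>t. (clog t)\<^sup>2) (pi\<^sup>2 / 6)"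
    using P2'(1) unfolding Polygamma_1_1 by simp
  show "has_bochner_integral exp1 (\<lambda>t. t * (clog t)\<^sup>2) (pi\<^sup>2 / 6)"
    using P2'(2) unfolding Digamma_Polygamma_values by simp
  have "fact 2 * (pi\<^sup>2 / 6 - 5 / 4 + (3 / 2 - euler_mascheroni + euler_mascheroni)\<^sup>2) = 2 * (pi\<^sup>2 / 6) + 2"
    by (simp add: power2_eq_square)
  then show "has_bochner_integral exp1 (\<lambda>t. t\<^sup>2 * (clog t)\<^sup>2) (2 * (pi\<^sup>2 / 6) + 2)"
    using P2'(3) unfolding Digamma_Polygamma_values by (simp only:)
qed

text \<open>Linearity over the nine monomials; the two digits of a coefficient are the exponents of
  t and of \<open>clog t\<close>. The coefficient \<open>c01\<close> drops out of \<open>v\<close>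
  because \<open>clog\<close> is centred.\<close>

lemma exp1_polynomial:
  assumes "\<And>t. f t = c00 + c10 * t + c20 * t\<^sup>2 + c01 * clog t + c11 * (t * clog t) + c21 * (t\<^sup>2 * clog t)
    + c02 * (clog t)\<^sup>2 + c12 * (t * (clog t)\<^sup>2) + c22 * (t\<^sup>2 * (clog t)\<^sup>2)"
    and "v = c00 + c10 + 2 * c20 + c11 + 3 * c21 + (c02 + c12 + 2 * c22) * (pi\<^sup>2 / 6) + 2 * c22"
  shows "has_bochner_integral exp1 f v"
proof -
  have "f = (\<lambda>t. c00 * 1 + c10 * t + c20 * t\<^sup>2 + c01 * clog t + c11 * (t * clog t) + c21 * (t\<^sup>2 * clog t)
    + c02 * (clog t)\<^sup>2 + c12 * (t * (clog t)\<^sup>2) + c22 * (t\<^sup>2 * (clog t)\<^sup>2))"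
    using assms(1) by auto
  moreover have "v = c00 * 1 + c10 * 1 + c20 * 2 + c01 * 0 + c11 * 1 + c21 * 3 + c02 * (pi\<^sup>2 / 6)
    + c12 * (pi\<^sup>2 / 6) + c22 * (2 * (pi\<^sup>2 / 6) + 2)"
    using assms(2) by (simp add: algebra_simps)
  ultimately show ?thesis
    by (simp only:) (intro has_bochner_integral_add has_bochner_integral_mult_right exp1_moments)
qed

text \<open>The V and Q of the decomposition. As V W has mean 1, the constant 1 in
  \<open>exp_proj\<close> is what centres V (1 - W); as V^2 and V^2 W both have mean 1, Q is
  orthogonal to V.\<close>

definition exp_dev :: "real \<Rightarrow> real" where "exp_dev t = t - 1"
definition exp_proj :: "real \<Rightarrow> real" where "exp_proj t = 1 + exp_dev t * (1 - clog t)"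

lemma exp1_score_measurable [measurable]: "exp_dev \<in> borel_measurable borel" "exp_proj \<in> borel_measurable borel"
  unfolding exp_dev_def exp_proj_def by measurable

lemma exp1_score_moments:
  "has_bochner_integral exp1 exp_dev 0"
  "has_bochner_integral exp1 exp_proj 0"
  "has_bochner_integral exp1 clog 0"
  "has_bochner_integral exp1 (\<lambda>t. exp_dev t * exp_dev t) 1"
  "has_bochner_integral exp1 (\<lambda>t. exp_proj t * exp_proj t) (pi\<^sup>2 / 6)"
  "has_bochner_integral exp1 (\<lambda>t. clog t * clog t) (pi\<^sup>2 / 6)"
  "has_bochner_integral exp1 (\<lambda>t. exp_dev t * clog t) 1"
  "has_bochner_integral exp1 (\<lambda>t. exp_proj t * exp_dev t) 0"
  "has_bochner_integral exp1 (\<lambda>t. exp_proj t * clog t) 1"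
  \<comment> \<open>The numerals are the coefficients of the expanded product, in the order c00 c10
    c20 c01 c11 c21 c02 c12 c22.\<close>
  subgoal by (rule exp1_polynomial[of _ "-1" 1 0 0 0 0 0 0 0]) (simp_all add: exp_dev_def)
  subgoal by (rule exp1_polynomial[of _ 0 1 0 1 "-1" 0 0 0 0]) (simp_all add: exp_dev_def exp_proj_def algebra_simps)
  subgoal by (rule exp1_moments)
  subgoal by (rule exp1_polynomial[of _ 1 "-2" 1 0 0 0 0 0 0]) (simp_all add: exp_dev_def algebra_simps power2_eq_square)
  subgoal by (rule exp1_polynomial[of _ 0 0 1 0 2 "-2" 1 "-2" 1])
      (simp_all add: exp_dev_def exp_proj_def algebra_simps power2_eq_square)
  subgoal by (rule exp1_polynomial[of _ 0 0 0 0 0 0 1 0 0]) (simp_all add: power2_eq_square)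
  subgoal by (rule exp1_polynomial[of _ 0 0 0 "-1" 1 0 0 0 0]) (simp_all add: exp_dev_def algebra_simps)
  subgoal by (rule exp1_polynomial[of _ 0 "-1" 1 "-1" 2 "-1" 0 0 0])
      (simp_all add: exp_dev_def exp_proj_def algebra_simps power2_eq_square)
  subgoal by (rule exp1_polynomial[of _ 0 0 0 0 1 0 1 "-1" 0]) 
      (simp_all add: exp_dev_def exp_proj_def algebra_simps power2_eq_square)
  done

section \<open>Second moments of the score polynomial\<close>

text \<open>The second moment of the score depends on the laws only through these mean values, so
  they are abstracted; the instance takes Frechet laws and functions of e_i. For \<open>q\<close>
  times \<open>w\<close> integrability suffices, since this product always meets the integral of a
  further centred factor.\<close>

locale score_product =
  fixes \<nu> :: "'k::finite \<Rightarrow> real measure" and v w q :: "'k \<Rightarrow> real \<Rightarrow> real" and \<zeta> :: real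
  assumes prob: "\<And>i. prob_space (\<nu> i)"
    and v: "\<And>i. has_bochner_integral (\<nu> i) (v i) 0"
    and w: "\<And>i. has_bochner_integral (\<nu> i) (w i) 0"
    and q: "\<And>i. has_bochner_integral (\<nu> i) (q i) 0"
    and vv: "\<And>i. has_bochner_integral (\<nu> i) (\<lambda>x. v i x * v i x) 1"
    and ww: "\<And>i. has_bochner_integral (\<nu> i) (\<lambda>x. w i x * w i x) \<zeta>"
    and qq: "\<And>i. has_bochner_integral (\<nu> i) (\<lambda>x. q i x * q i x) \<zeta>"
    and vw: "\<And>i. has_bochner_integral (\<nu> i) (\<lambda>x. v i x * w i x) 1"
    and qv: "\<And>i. has_bochner_integral (\<nu> i) (\<lambda>x. q i x * v i x) 0"
    and qw: "\<And>i. integrable (\<nu> i) (\<lambda>x. q i x * w i x)"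
begin

sublocale product_sigma_finite \<nu>
  by (rule product_sigma_finite.intro) (rule prob_space_imp_sigma_finite[OF prob])

abbreviation "N \<equiv> Pi\<^sub>M UNIV \<nu>"

lemma has_bochner_integral_one: "has_bochner_integral (\<nu> i) (\<lambda>_. 1::real) 1"
  using prob_space.prob_space[OF prob[of i]] finite_measure.integrable_const[of "\<nu> i" "1::real"]
    prob_space.finite_measure[OF prob[of i]]
  by (simp add: has_bochner_integral_iff)

lemma product_has_bochner_integral:
  fixes h :: "'k \<Rightarrow> real \<Rightarrow> real"
  assumes "\<And>i. has_bochner_integral (\<nu> i) (h i) (\<mu> i)"
  shows "has_bochner_integral N (\<lambda>z. \<Prod>i\<in>UNIV. h i (z i)) (\<Prod>i\<in>UNIV. \<mu> i)"
  using assms product_integrable_prod[of UNIV h] product_integral_prod[of UNIV h]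
  by (simp add: has_bochner_integral_iff)

text \<open>Factors 1 in the remaining coordinates turn the integrand into a full product. If the
  indices differ, a centred factor stands alone and its integral annihilates the product.\<close>

lemma has_bochner_integral_two:
  fixes f g :: "'k \<Rightarrow> real \<Rightarrow> real"
  assumes fg: "has_bochner_integral (\<nu> j) (\<lambda>x. f j x * g j x) c"
    and f: "\<And>i. has_bochner_integral (\<nu> i) (f i) 0" and g: "\<And>i. has_bochner_integral (\<nu> i) (g i) 0"
  shows "has_bochner_integral N (\<lambda>z. f j (z j) * g k (z k)) (if j = k then c else 0)"
proof (cases "j = k")
  case True
  have "has_bochner_integral N (\<lambda>z. \<Prod>i\<in>UNIV. if i = j then f i (z i) * g i (z i) else 1)
      (\<Prod>i\<in>UNIV. if i = j then c else 1)"
    by (rule product_has_bochner_integral[of "\<lambda>i x. if i = j then f i x * g i x else 1"])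
       (use fg has_bochner_integral_one in auto)
  then show ?thesis using True by simp
next
  case False
  have "has_bochner_integral N
      (\<lambda>z. \<Prod>i\<in>UNIV. (if i = j then f i (z i) else 1) * (if i = k then g i (z i) else 1))
      (\<Prod>i\<in>UNIV. if i = j then 0 else if i = k then 0 else 1)"
    by (rule product_has_bochner_integral[of "\<lambda>i x. (if i = j then f i x else 1) * (if i = k then g i x else 1)"])
       (use f g has_bochner_integral_one False in auto)
  moreover have "(\<Prod>i\<in>UNIV. if i = j then 0 else if i = k then 0 else 1) = (0::real)"
    by (rule prod_zero) auto
  ultimately show ?thesis using False by (simp add: prod.distrib)
qed

text \<open>Some coordinate always carries exactly one centred factor: \<open>k\<close> if
  \<open>i = j\<close>, \<open>j\<close> if \<open>i = k\<close>, and \<open>i\<close> otherwise.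
  This makes one-variable and two-variable terms orthogonal.\<close>

lemma has_bochner_integral_three:
  fixes f :: "'k \<Rightarrow> real \<Rightarrow> real"
  assumes f: "\<And>i. has_bochner_integral (\<nu> i) (f i) 0"
    and fv: "\<And>i. integrable (\<nu> i) (\<lambda>x. f i x * v i x)"
    and fw: "\<And>i. integrable (\<nu> i) (\<lambda>x. f i x * w i x)"
    and jk: "j \<noteq> k"
  shows "has_bochner_integral N (\<lambda>z. f i (z i) * (v j (z j) * w k (z k))) 0"
proof -
  define h where "h l x = (if l = i then f l x else 1) * ((if l = j then v l x else 1) * (if l = k then w l x else 1))"
    for l x
  have "integrable (\<nu> l) (h l)" for l
    unfolding h_def using f[of l] fv[of l] fw[of l] v[of l] w[of l] has_bochner_integral_one[of l] jk
    by (cases "l = i"; cases "l = j"; cases "l = k") (simp_all add: has_bochner_integral_iff)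
  then have "has_bochner_integral (\<nu> l) (h l) (integral\<^sup>L (\<nu> l) (h l))" for l
    by (simp add: has_bochner_integral_iff)
  then have "has_bochner_integral N (\<lambda>z. \<Prod>l\<in>UNIV. h l (z l)) (\<Prod>l\<in>UNIV. integral\<^sup>L (\<nu> l) (h l))"
    by (rule product_has_bochner_integral)
  moreover have "(\<lambda>z. \<Prod>l\<in>UNIV. h l (z l)) = (\<lambda>z. f i (z i) * (v j (z j) * w k (z k)))"
    by (simp add: h_def prod.distrib)
  moreover have "\<exists>l. integral\<^sup>L (\<nu> l) (h l) = 0"
  proof (cases "i = j")
    case True
    then have "integral\<^sup>L (\<nu> k) (h k) = 0"
      using w[of k] jk jk[symmetric] True unfolding h_def by (simp add: has_bochner_integral_iff)
    then show ?thesis ..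
  next
    case False
    show ?thesis
    proof (cases "i = k")
      case True
      then have "integral\<^sup>L (\<nu> j) (h j) = 0"
        using v[of j] jk jk[symmetric] True unfolding h_def by (simp add: has_bochner_integral_iff)
      then show ?thesis ..
    next
      case neq: False
      then have "integral\<^sup>L (\<nu> i) (h i) = 0"
        using f[of i] False neq unfolding h_def by (simp add: has_bochner_integral_iff)
      then show ?thesis ..
    qed
  qed
  then have "(\<Prod>l\<in>UNIV. integral\<^sup>L (\<nu> l) (h l)) = 0" by (auto intro: prod_zero)
  ultimately show ?thesis by simp
qed

text \<open>Equal pairs give the mean of v^2 times that of w^2, swapped pairs give the mean of v w
  twice. In all other cases coordinate \<open>j\<close> or coordinate \<open>k\<close> carries a
  single centred factor.\<close>

lemma has_bochner_integral_four:
  assumes jk: "j \<noteq> k" and lm: "l \<noteq> m"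
  shows "has_bochner_integral N (\<lambda>z. (v j (z j) * w k (z k)) * (v l (z l) * w m (z m)))
     (if (l, m) = (j, k) then \<zeta> else if (l, m) = (k, j) then 1 else 0)"
proof -
  define h where "h i x = ((if i = j then v i x else 1) * (if i = k then w i x else 1))
      * ((if i = l then v i x else 1) * (if i = m then w i x else 1))" for i x
  have wv: "has_bochner_integral (\<nu> i) (\<lambda>x. w i x * v i x) 1" for i
    using vw[of i] by (simp add: mult.commute)
  note bi = v w vv ww vw wv has_bochner_integral_one
  have "integrable (\<nu> i) (h i)" for i
    unfolding h_def using bi[of i] jk lm
    by (cases "i = j"; cases "i = k"; cases "i = l"; cases "i = m") (simp_all add: has_bochner_integral_iff)
  then have "has_bochner_integral (\<nu> i) (h i) (integral\<^sup>L (\<nu> i) (h i))" for i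
    by (simp add: has_bochner_integral_iff)
  then have "has_bochner_integral N (\<lambda>z. \<Prod>i\<in>UNIV. h i (z i)) (\<Prod>i\<in>UNIV. integral\<^sup>L (\<nu> i) (h i))"
    by (rule product_has_bochner_integral)
  moreover have "(\<lambda>z. \<Prod>i\<in>UNIV. h i (z i)) = (\<lambda>z. (v j (z j) * w k (z k)) * (v l (z l) * w m (z m)))"
    by (simp add: h_def prod.distrib)
  moreover have "(\<Prod>i\<in>UNIV. integral\<^sup>L (\<nu> i) (h i)) =
      (if (l, m) = (j, k) then \<zeta> else if (l, m) = (k, j) then 1 else 0)"
  proof -
    consider "l = j" "m = k" | "l = k" "m = j" | "j \<noteq> l" "j \<noteq> m" | "k \<noteq> l" "k \<noteq> m"
      using jk lm by blast
    then show ?thesis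
    proof cases
      case 1
      have "integral\<^sup>L (\<nu> i) (h i) = (if i = k then \<zeta> else 1)" for i
        unfolding h_def using bi[of i] jk 1
        by (cases "i = j"; cases "i = k") (simp_all add: has_bochner_integral_iff)
      then show ?thesis using 1 by simp
    next
      case 2
      have "integral\<^sup>L (\<nu> i) (h i) = 1" for i
        unfolding h_def using bi[of i] jk 2
        by (cases "i = j"; cases "i = k") (simp_all add: has_bochner_integral_iff)
      then show ?thesis using 2 jk by simp
    next
      case 3
      then have "integral\<^sup>L (\<nu> j) (h j) = 0"
        unfolding h_def using v[of j] jk jk[symmetric] by (simp add: has_bochner_integral_iff)
      then show ?thesis using 3 by (auto intro!: prod_zero)
    next
      case 4
      then have "integral\<^sup>L (\<nu> k) (h k) = 0"
        unfolding h_def using w[of k] jk jk[symmetric] by (simp add: has_bochner_integral_iff)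
      then show ?thesis using 4 by (auto intro!: prod_zero)
    qed
  qed
  ultimately show ?thesis by simp
qed

definition score_poly :: "real \<Rightarrow> ('k \<Rightarrow> real) \<Rightarrow> ('k \<Rightarrow> real) \<Rightarrow> real"
  where "score_poly c d z = (\<Sum>j\<in>UNIV. c * (real CARD('k) - 1) * q j (z j) + d j * v j (z j))
    + c * (\<Sum>(j, k)\<in>{(j, k). j \<noteq> k}. v j (z j) * w k (z k))"

lemma card_offdiag: "card {(j::'k, k). j \<noteq> k} = CARD('k) * (CARD('k) - 1)"
proof -
  have "{(j::'k, k). j \<noteq> k} = UNIV \<times> UNIV - (\<lambda>j. (j, j)) ` UNIV" by auto
  moreover have "card ((\<lambda>j::'k. (j, j)) ` UNIV) = CARD('k)" by (intro card_image) (auto simp: inj_on_def)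
  ultimately show ?thesis
    by (simp add: card_Diff_subset card_cartesian_product diff_mult_distrib2)
qed

text \<open>By orthogonality only two blocks survive. The factor c c' gets K (K - 1)^2 \<zeta> from
  the one-variable terms and K (K - 1) (\<zeta> + 1) from the pairs; terms mixing c with d vanish
  because q is orthogonal to v.\<close>

lemma has_bochner_integral_score:
  "has_bochner_integral N (\<lambda>z. score_poly c d z * score_poly c' d' z)
    ((\<Sum>j\<in>UNIV. d j * d' j) + c * c' * (real CARD('k) * (real CARD('k) - 1) * (real CARD('k) * \<zeta> + 1)))"
proof -
  define K where "K = real CARD('k)"
  define X where "X c d j x = c * (K - 1) * q j x + d j * v j x" for c :: real and d :: "'k \<Rightarrow> real" and j x
  define P where "P = {(j::'k, k). j \<noteq> k}"
  define Z where "Z p z = v (fst p) (z (fst p)) * w (snd p) (z (snd p))" for p z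
  have X0: "has_bochner_integral (\<nu> i) (X c d i) 0" for i c d
    unfolding X_def using has_bochner_integral_add[OF has_bochner_integral_mult_right[OF q[of i], of "c * (K - 1)"]
      has_bochner_integral_mult_right[OF v[of i], of "d i"]] by simp
  have Xv: "integrable (\<nu> i) (\<lambda>x. X c d i x * v i x)" "integrable (\<nu> i) (\<lambda>x. X c d i x * w i x)" for i c d
    using qv[of i] vv[of i] vw[of i] qw[of i]
    by (auto simp: X_def distrib_right mult.assoc has_bochner_integral_iff)
  have XX: "has_bochner_integral (\<nu> i) (\<lambda>x. X c d i x * X c' d' i x)
      (c * c' * (K - 1)\<^sup>2 * \<zeta> + d i * d' i)" for i c d c' d'
  proof -
    have "has_bochner_integral (\<nu> i) (\<lambda>x. c * c' * (K - 1)\<^sup>2 * (q i x * q i x)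
        + (c * (K - 1) * d' i + c' * (K - 1) * d i) * (q i x * v i x) + d i * d' i * (v i x * v i x))
      (c * c' * (K - 1)\<^sup>2 * \<zeta> + (c * (K - 1) * d' i + c' * (K - 1) * d i) * 0 + d i * d' i * 1)"
      by (intro has_bochner_integral_add has_bochner_integral_mult_right qq qv vv)
    then show ?thesis
      by (simp add: X_def algebra_simps power2_eq_square)
  qed
  have S: "score_poly c d z = (\<Sum>j\<in>UNIV. X c d j (z j)) + c * (\<Sum>p\<in>P. Z p z)" for c d z
    by (simp add: score_poly_def X_def K_def P_def Z_def case_prod_beta)
  have XZ: "has_bochner_integral N (\<lambda>z. X c d i (z i) * Z p z) 0" if "p \<in> P" for p i c d
    unfolding Z_def using that by (intro has_bochner_integral_three X0 Xv) (auto simp: P_def)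
  have XX': "has_bochner_integral N (\<lambda>z. X c d i (z i) * X c' d' j (z j))
     (if i = j then c * c' * (K - 1)\<^sup>2 * \<zeta> + d i * d' i else 0)" for i j
    by (intro has_bochner_integral_two XX X0)
  have ZZ: "has_bochner_integral N (\<lambda>z. Z p z * Z r z)
     (if r = p then \<zeta> else if r = prod.swap p then 1 else 0)" if "p \<in> P" "r \<in> P" for p r
  proof -
    obtain j k l m where "p = (j, k)" "r = (l, m)" by (cases p, cases r)
    then show ?thesis
      using has_bochner_integral_four[of j k l m] that by (auto simp: Z_def P_def split: if_splits)
  qed
  have H: "has_bochner_integral N (\<lambda>z.
        (\<Sum>i\<in>UNIV. \<Sum>j\<in>UNIV. X c d i (z i) * X c' d' j (z j))
        + c' * (\<Sum>i\<in>UNIV. \<Sum>p\<in>P. X c d i (z i) * Z p z)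
        + c * (\<Sum>i\<in>UNIV. \<Sum>p\<in>P. X c' d' i (z i) * Z p z)
        + c * c' * (\<Sum>p\<in>P. \<Sum>r\<in>P. Z p z * Z r z))
      ((\<Sum>i\<in>UNIV. \<Sum>j\<in>UNIV. if i = j then c * c' * (K - 1)\<^sup>2 * \<zeta> + d i * d' i else 0)
        + c' * (\<Sum>i\<in>(UNIV::'k set). \<Sum>p\<in>P. 0) + c * (\<Sum>i\<in>(UNIV::'k set). \<Sum>p\<in>P. 0)
        + c * c' * (\<Sum>p\<in>P. \<Sum>r\<in>P. if r = p then \<zeta> else if r = prod.swap p then 1 else 0))"
    by (intro has_bochner_integral_add has_bochner_integral_mult_right has_bochner_integral_sum XX' XZ ZZ)
  have e1: "(\<lambda>z. score_poly c d z * score_poly c' d' z) = (\<lambda>z.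
        (\<Sum>i\<in>UNIV. \<Sum>j\<in>UNIV. X c d i (z i) * X c' d' j (z j))
        + c' * (\<Sum>i\<in>UNIV. \<Sum>p\<in>P. X c d i (z i) * Z p z)
        + c * (\<Sum>i\<in>UNIV. \<Sum>p\<in>P. X c' d' i (z i) * Z p z)
        + c * c' * (\<Sum>p\<in>P. \<Sum>r\<in>P. Z p z * Z r z))"
  proof -
    have "(a + c * b) * (a' + c' * b) = a * a' + c' * (a * b) + c * (a' * b) + c * c' * (b * b)"
      for a b a' :: real by (simp add: algebra_simps)
    then show ?thesis unfolding S sum_product[symmetric] by simp
  qed
  \<comment> \<open>Each ordered pair contributes \<zeta> through itself and 1 through its swap,
    which is a different pair off the diagonal.\<close>
  have e2: "(\<Sum>p\<in>P. \<Sum>r\<in>P. if r = p then \<zeta> else if r = prod.swap p then 1 else 0) = K * (K - 1) * (\<zeta> + 1)"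
  proof -
    have "(\<Sum>r\<in>P. if r = p then \<zeta> else if r = prod.swap p then 1 else 0) = \<zeta> + 1" if p: "p \<in> P" for p
    proof -
      have "(\<Sum>r\<in>P. if r = p then \<zeta> else if r = prod.swap p then 1 else 0)
          = (\<Sum>r\<in>P. (if r = p then \<zeta> else 0) + (if r = prod.swap p then 1 else 0))"
      proof (rule sum.cong[OF refl])
        have "prod.swap p \<noteq> p" using p by (cases p) (auto simp: P_def)
        then show "(if r = p then \<zeta> else if r = prod.swap p then 1 else 0)
          = (if r = p then \<zeta> else 0) + (if r = prod.swap p then 1 else 0)" for r
          by auto
      qed
      also have "\<dots> = (\<Sum>r\<in>P. if r = p then \<zeta> else 0) + (\<Sum>r\<in>P. if r = prod.swap p then 1 else 0)"
        by (rule sum.distrib)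
      also have "\<dots> = \<zeta> + 1"
      proof -
        have "prod.swap p \<in> P" using p by (cases p) (auto simp: P_def)
        moreover have "finite P" by simp
        ultimately show ?thesis using p by (simp only: sum.delta if_True)
      qed
      finally show ?thesis .
    qed
    moreover have "real (card P) = K * (K - 1)"
      unfolding P_def card_offdiag K_def by (simp add: of_nat_diff Suc_leI)
    ultimately show ?thesis by simp
  qed
  have e3: "(\<Sum>i\<in>UNIV. \<Sum>j\<in>UNIV. if i = j then c * c' * (K - 1)\<^sup>2 * \<zeta> + d i * d' i else 0)
      = K * (c * c' * (K - 1)\<^sup>2 * \<zeta>) + (\<Sum>i\<in>UNIV. d i * d' i)"
    by (simp add: sum.distrib K_def)
  have e4: "K * (c * c' * (K - 1)\<^sup>2 * \<zeta>) + s + c * c' * (K * (K - 1) * (\<zeta> + 1))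
      = s + c * c' * (K * (K - 1) * (K * \<zeta> + 1))" for s
    by (simp add: algebra_simps power2_eq_square)
  show ?thesis
    using H by (simp only: e1 e2 e3 e4 K_def[symmetric] sum.neutral_const mult_zero_right add_0_right)
qed

end

section \<open>Sampling the Concrete distribution\<close>

definition frechet_density :: "real \<Rightarrow> real \<Rightarrow> real \<Rightarrow> real"
  where "frechet_density c \<tau> z = (if z > 0 then c * \<tau> * z powr (- \<tau> - 1) * exp (- (c * z powr - \<tau>)) else 0)"

lemma frechet_density_measurable [measurable]: "frechet_density c \<tau> \<in> borel_measurable borel"
  unfolding frechet_density_def by measurable

lemma frechet_density_nonneg: "c > 0 \<Longrightarrow> \<tau> > 0 \<Longrightarrow> frechet_density c \<tau> z \<ge> 0"
  by (simp add: frechet_density_def)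

text \<open>Both laws are compared on the half-lines \<open>{..a}\<close>. The map is decreasing on
  positive reals, so the preimage of such a half-line is an upper one, and exp (- c z^-\<tau>) is an
  antiderivative of the density.\<close>

lemma distr_frechet:
  assumes c: "c > 0" and \<tau>: "\<tau> > 0"
  shows "distr (density lborel (frechet_density c \<tau>)) borel (\<lambda>z. c * z powr - \<tau>) = exp1" (is "?D = _")
proof (rule measure_eqI_generator_eq_countable)
  let ?E = "range (\<lambda>a::real. {..a})"
  show "Int_stable ?E" by (auto simp: Int_stable_def)
  have "sets borel = sigma_sets UNIV ?E"
    unfolding borel_eq_atMost by simp
  then show "sets ?D = sigma_sets UNIV ?E" "sets exp1 = sigma_sets UNIV ?E" by simp_all
  show "?E \<subseteq> Pow UNIV" "range (\<lambda>n::nat. {..real n}) \<subseteq> ?E" "countable (range (\<lambda>n::nat. {..real n}))"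
    by auto
  show "\<Union> (range (\<lambda>n::nat. {..real n})) = UNIV"
    by (auto intro: real_arch_simple)
  show eq: "emeasure ?D X = emeasure exp1 X" if XE: "X \<in> ?E" for X
  proof -
    obtain a where X: "X = {..a}" using XE by auto
    have exp1: "emeasure exp1 {..a} = ennreal (if 0 \<le> a then 1 - exp (- a) else 0)"
      by (subst emeasure_erlang_density) (simp_all add: erlang_CDF_0)
    have D: "emeasure ?D {..a} = (\<integral>\<^sup>+z. ennreal (frechet_density c \<tau> z) * indicator {z. c * z powr - \<tau> \<le> a} z \<partial>lborel)"
      by (subst emeasure_distr; (subst emeasure_density)?) (auto simp: vimage_def)
    show ?thesis
    proof (cases "a > 0")
      case False
      have "(\<integral>\<^sup>+z. ennreal (frechet_density c \<tau> z) * indicator {z. c * z powr - \<tau> \<le> a} z \<partial>lborel) =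
          (\<integral>\<^sup>+z. 0 \<partial>(lborel :: real measure))"
      proof (intro nn_integral_cong)
        fix z :: real
        show "ennreal (frechet_density c \<tau> z) * indicator {z. c * z powr - \<tau> \<le> a} z = 0"
        proof (cases "z > 0")
          case True
          then have "c * z powr - \<tau> > 0" using c by simp
          then show ?thesis using False by (simp add: indicator_def)
        qed (simp add: frechet_density_def)
      qed
      then show ?thesis using False unfolding X D exp1 by auto
    next
      case True
      \<comment> \<open>The point that the decreasing map sends to \<open>a\<close>.\<close>
      define z0 where "z0 = (a / c) powr (- 1 / \<tau>)"
      have z0: "z0 > 0" "c * z0 powr - \<tau> = a"
        using True c \<tau> by (simp_all add: z0_def powr_powr)
      have iff: "c * z powr - \<tau> \<le> a \<longleftrightarrow> z0 \<le> z" if "z > 0" for z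
      proof -
        have "c * z powr - \<tau> \<le> a \<longleftrightarrow> z powr - \<tau> \<le> z0 powr - \<tau>"
          using c z0(2)[symmetric] by simp
        also have "\<dots> \<longleftrightarrow> z0 \<le> z"
        proof
          assume "z powr - \<tau> \<le> z0 powr - \<tau>"
          then show "z0 \<le> z"
            using powr_less_mono2_neg[of "- \<tau>" z z0] that \<tau> by force
        next
          assume "z0 \<le> z"
          then show "z powr - \<tau> \<le> z0 powr - \<tau>"
            using z0 \<tau> by (intro powr_mono2') auto
        qed
        finally show ?thesis .
      qed
      have "(\<integral>\<^sup>+z. ennreal (frechet_density c \<tau> z) * indicator {z. c * z powr - \<tau> \<le> a} z \<partial>lborel) =
          (\<integral>\<^sup>+z. ennreal (frechet_density c \<tau> z) * indicator {z0..} z \<partial>lborel)"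
        using iff z0(1) by (intro nn_integral_cong) (auto simp: frechet_density_def indicator_def)
      also have "\<dots> = 1 - exp (- (c * z0 powr - \<tau>))"
      proof (rule nn_integral_FTC_atLeast)
        show "((\<lambda>z. exp (- (c * z powr - \<tau>))) has_real_derivative frechet_density c \<tau> z) (at z)" if "z0 \<le> z" for z
          using that z0(1) unfolding frechet_density_def
          by (auto intro!: derivative_eq_intros simp: powr_diff field_simps)
        have "((\<lambda>z. exp (- (c * z powr - \<tau>))) \<longlongrightarrow> exp (- (c * 0))) at_top"
          using \<tau> by (intro tendsto_intros tendsto_neg_powr filterlim_ident) auto
        then show "((\<lambda>z. exp (- (c * z powr - \<tau>))) \<longlongrightarrow> 1) at_top" by simp
      qed (use c \<tau> in \<open>auto simp: frechet_density_nonneg\<close>)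
      finally show ?thesis using True unfolding X D exp1 z0(2) by simp
    qed
  qed
  show "emeasure ?D A \<noteq> \<infinity>" if "A \<in> range (\<lambda>n::nat. {..real n})" for A
  proof -
    have "emeasure exp1 A \<le> emeasure exp1 (space exp1)"
      by (rule emeasure_space)
    also have "\<dots> = 1"
      by (intro prob_space.emeasure_space_1 prob_space_exponential_density) simp
    finally show ?thesis using that eq[of A] by (auto simp: top_unique)
  qed
qed

lemma prob_space_frechet:
  assumes "c > 0" "\<tau> > 0"
  shows "prob_space (density lborel (frechet_density c \<tau>))"
proof
  have "emeasure (distr (density lborel (frechet_density c \<tau>)) borel (\<lambda>z. c * z powr - \<tau>)) UNIV = 1"
    unfolding distr_frechet[OF assms]
    using prob_space.emeasure_space_1[OF prob_space_exponential_density[of 1]] by simp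
  then show "emeasure (density lborel (frechet_density c \<tau>)) (space (density lborel (frechet_density c \<tau>))) = 1"
    by (subst (asm) emeasure_distr) auto
qed

lemma has_bochner_integral_frechet:
  fixes g :: "real \<Rightarrow> real"
  assumes "c > 0" "\<tau> > 0" and g: "has_bochner_integral exp1 g v"
  shows "has_bochner_integral (density lborel (frechet_density c \<tau>)) (\<lambda>z. g (c * z powr - \<tau>)) v"
proof -
  have [measurable]: "g \<in> borel_measurable borel"
    using g by (auto simp: has_bochner_integral_iff)
  show ?thesis
    using g unfolding distr_frechet[OF assms(1,2), symmetric]
    by (simp add: has_bochner_integral_iff integrable_distr_eq integral_distr)
qed

lemma nn_integral_frechet:
  fixes g :: "real \<Rightarrow> ennreal"
  assumes "c > 0" "\<tau> > 0" and [measurable]: "g \<in> borel_measurable borel"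
  shows "(\<integral>\<^sup>+z. frechet_density c \<tau> z * g (c * z powr - \<tau>) \<partial>lborel) = (\<integral>\<^sup>+t. g t \<partial>exp1)"
  unfolding distr_frechet[OF assms(1,2), symmetric]
  by (simp add: nn_integral_distr nn_integral_density)

section \<open>Lebesgue measure on vectors, product densities and integration over rays\<close>

lemma Basis_vec_real: "(Basis :: (real^'n) set) = range (\<lambda>i. axis i 1)"
  by (auto simp: Basis_vec_def)

text \<open>Lebesgue measure is characterised by the volumes of boxes. The injection
  \<open>f\<close> will be \<open>Some\<close>: it reads the first K - 1 coordinates of a product
  indexed by an option type as a vector.\<close>

lemma lborel_vec_eq_PiM:
  fixes f :: "'m::finite \<Rightarrow> 'i"
  assumes "inj f"
  shows "(lborel :: (real^'m) measure) =
    distr (Pi\<^sub>M (range f) (\<lambda>_. lborel)) borel (\<lambda>x. \<chi> j. x (f j))"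
proof (rule lborel_eqI)
  interpret product_sigma_finite "\<lambda>_::'i. lborel :: real measure"
    by (rule product_sigma_finite.intro) (rule sigma_finite_lborel)
  fix l u :: "real^'m"
  assume "\<And>b. b \<in> Basis \<Longrightarrow> l \<bullet> b \<le> u \<bullet> b"
  from this[of "axis j 1" for j] have le: "l $ j \<le> u $ j" for j
    by (simp add: Basis_vec_real inner_axis)
  have [measurable]: "(\<lambda>x. \<chi> j. x (f j)) \<in> borel_measurable (Pi\<^sub>M (range f) (\<lambda>_. lborel :: real measure))"
    by (subst borel_measurable_euclidean_space) (simp add: Basis_vec_real inner_axis)
  have "(\<lambda>x. \<chi> j. x (f j)) -` box l u \<inter> space (Pi\<^sub>M (range f) (\<lambda>_. lborel)) =
      Pi\<^sub>E (range f) (\<lambda>i. {l $ inv f i <..< u $ inv f i})"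
    using assms by (auto simp: mem_box Basis_vec_real inner_axis space_PiM PiE_iff)
  then have "emeasure (distr (Pi\<^sub>M (range f) (\<lambda>_. lborel)) borel (\<lambda>x. \<chi> j. x (f j))) (box l u) =
      (\<Prod>i\<in>range f. ennreal (u $ inv f i - l $ inv f i))"
    using le by (subst emeasure_distr) (simp_all add: emeasure_PiM)
  also have "\<dots> = (\<Prod>j\<in>UNIV. ennreal (u $ j - l $ j))"
    using assms by (subst prod.reindex) simp_all
  also have "\<dots> = ennreal (\<Prod>j\<in>UNIV. (u - l) \<bullet> axis j 1)"
    using le by (subst prod_ennreal) (simp_all add: inner_axis)
  also have "(\<Prod>j\<in>UNIV. (u - l) \<bullet> axis j 1) = (\<Prod>b\<in>Basis. (u - l) \<bullet> b)"
    unfolding Basis_vec_real by (subst prod.reindex) (auto simp: inj_on_def axis_eq_axis)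
  finally show "emeasure (distr (Pi\<^sub>M (range f) (\<lambda>_. lborel)) borel (\<lambda>x. \<chi> j. x (f j))) (box l u) =
      ennreal (\<Prod>b\<in>Basis. (u - l) \<bullet> b)" .
qed simp

lemma measurable_vec_nth [measurable]: "(\<lambda>x::real^'n. x $ i) \<in> borel_measurable borel"
  by (intro borel_measurable_continuous_onI continuous_intros)

lemma measurable_vec_lambda:
  assumes "\<And>i. (\<lambda>x. f x i) \<in> borel_measurable M"
  shows "(\<lambda>x. (\<chi> i. f x i) :: real^'n) \<in> borel_measurable M"
  by (subst borel_measurable_euclidean_space) (use assms in \<open>simp add: Basis_vec_real inner_axis\<close>)

definition vec_option :: "real^'m \<Rightarrow> real \<Rightarrow> 'm option \<Rightarrow> real"
  where "vec_option u y i = (case i of None \<Rightarrow> y | Some j \<Rightarrow> u $ j)"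

lemma measurable_vec_option [measurable]:
  assumes [measurable]: "f \<in> borel_measurable M" "g \<in> borel_measurable M"
  shows "(\<lambda>x. vec_option (f x) (g x)) \<in> measurable M (Pi\<^sub>M UNIV (\<lambda>_. lborel))"
proof -
  have "(\<lambda>x. vec_option (f x) (g x) i) \<in> borel_measurable M" for i
    by (cases i) (simp_all add: vec_option_def)
  then have "(\<lambda>x i. vec_option (f x) (g x) i) \<in> measurable M (Pi\<^sub>M UNIV (\<lambda>_. lborel))"
    by (intro measurable_abs_UNIV) simp
  then show ?thesis by simp
qed

lemma nn_integral_PiM_option:
  fixes \<Phi> :: "('m::finite option \<Rightarrow> real) \<Rightarrow> ennreal"
  assumes [measurable]: "\<Phi> \<in> borel_measurable (Pi\<^sub>M UNIV (\<lambda>_. lborel))"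
  shows "(\<integral>\<^sup>+z. \<Phi> z \<partial>Pi\<^sub>M UNIV (\<lambda>_. lborel)) = (\<integral>\<^sup>+u. \<integral>\<^sup>+y. \<Phi> (vec_option u y) \<partial>lborel \<partial>(lborel :: (real^'m) measure))"
proof -
  interpret product_sigma_finite "\<lambda>_::'m option. lborel :: real measure"
    by (rule product_sigma_finite.intro) (rule sigma_finite_lborel)
  let ?P = "Pi\<^sub>M (range Some) (\<lambda>_::'m option. lborel :: real measure)"
  have U: "(UNIV :: 'm option set) = insert None (range Some)"
    by (simp add: UNIV_option_conv)
  have "(\<integral>\<^sup>+z. \<Phi> z \<partial>Pi\<^sub>M UNIV (\<lambda>_. lborel)) = (\<integral>\<^sup>+x. \<integral>\<^sup>+y. \<Phi> (x(None := y)) \<partial>lborel \<partial>?P)"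
    using assms unfolding U by (intro product_nn_integral_insert) auto
  also have "\<dots> = (\<integral>\<^sup>+x. \<integral>\<^sup>+y. \<Phi> (vec_option (\<chi> j. x (Some j)) y) \<partial>lborel \<partial>?P)"
    by (intro nn_integral_cong arg_cong[of _ _ \<Phi>]) (auto simp: vec_option_def fun_eq_iff split: option.splits)
  also have "\<dots> = (\<integral>\<^sup>+u. \<integral>\<^sup>+y. \<Phi> (vec_option u y) \<partial>lborel \<partial>distr ?P borel (\<lambda>x. \<chi> j. x (Some j)))"
  proof (rule nn_integral_distr[symmetric])
    show "(\<lambda>x. \<chi> j. x (Some j)) \<in> borel_measurable ?P"
      by (intro measurable_vec_lambda) simp
  qed measurable
  also have "distr ?P borel (\<lambda>x. \<chi> j. x (Some j)) = (lborel :: (real^'m) measure)"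
    by (rule lborel_vec_eq_PiM[symmetric]) simp
  finally show ?thesis .
qed

lemma nn_integral_lborel_scale:
  fixes H :: "'a::euclidean_space \<Rightarrow> ennreal"
  assumes [measurable]: "H \<in> borel_measurable borel" and r: "r > 0"
  shows "(\<integral>\<^sup>+u. H u \<partial>lborel) = ennreal (r ^ DIM('a)) * (\<integral>\<^sup>+u. H (r *\<^sub>R u) \<partial>lborel)"
proof -
  have "(lborel :: 'a measure) = density (distr lborel borel (\<lambda>x. 0 + r *\<^sub>R x)) (\<lambda>_. \<bar>r\<bar> ^ DIM('a))"
    using r by (intro lborel_affine) simp
  then have "(\<integral>\<^sup>+u. H u \<partial>lborel) = (\<integral>\<^sup>+u. H u \<partial>density (distr lborel borel (\<lambda>x::'a. 0 + r *\<^sub>R x)) (\<lambda>_. \<bar>r\<bar> ^ DIM('a)))"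
    by (rule arg_cong)
  also have "\<dots> = ennreal (r ^ DIM('a)) * (\<integral>\<^sup>+u. H (r *\<^sub>R u) \<partial>lborel)"
    using r by (simp add: nn_integral_density nn_integral_distr nn_integral_cmult)
  finally show ?thesis .
qed

lemma vec_option_append_last:
  "vec_option (r *\<^sub>R u) (r - (\<Sum>j\<in>UNIV. (r *\<^sub>R u) $ j)) = (\<lambda>i. r * append_last u $ i)"
  by (auto simp: vec_option_def append_last_def fun_eq_iff right_diff_distrib sum_distrib_left split: option.splits)

text \<open>
  Polar coordinates \<open>z = r x\<close> with \<open>\<Sum>x = 1\<close>: a translation turns the last coordinate of \<open>z\<close> into \<open>r = \<Sum>z\<close>, and
  for fixed \<open>r\<close> the other \<open>K - 1\<close> coordinates are scaled by \<open>r\<close>.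
\<close>

lemma nn_integral_cone:
  fixes \<Phi> :: "('m::finite option \<Rightarrow> real) \<Rightarrow> ennreal"
  assumes [measurable]: "\<Phi> \<in> borel_measurable (Pi\<^sub>M UNIV (\<lambda>_. lborel))"
    and supp: "\<And>z. \<not> (\<forall>i. z i > 0) \<Longrightarrow> \<Phi> z = 0"
  shows "(\<integral>\<^sup>+z. \<Phi> z \<partial>Pi\<^sub>M UNIV (\<lambda>_. lborel)) =
    (\<integral>\<^sup>+u. \<integral>\<^sup>+r. indicator {0<..} r * ennreal (r ^ CARD('m)) * \<Phi> (\<lambda>i. r * append_last u $ i)
      \<partial>lborel \<partial>(lborel :: (real^'m) measure))"
proof -
  let ?s = "\<lambda>u::real^'m. \<Sum>j\<in>UNIV. u $ j"
  have "(\<integral>\<^sup>+y. \<Phi> (vec_option u y) \<partial>lborel) = (\<integral>\<^sup>+r. \<Phi> (vec_option u (r - ?s u)) \<partial>lborel)" for u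
    using nn_integral_real_affine[of "\<lambda>y. \<Phi> (vec_option u y)" 1 "- ?s u"] by simp
  then have "(\<integral>\<^sup>+z. \<Phi> z \<partial>Pi\<^sub>M UNIV (\<lambda>_. lborel)) =
      (\<integral>\<^sup>+u. \<integral>\<^sup>+r. \<Phi> (vec_option u (r - ?s u)) \<partial>lborel \<partial>(lborel :: (real^'m) measure))"
    by (simp add: nn_integral_PiM_option)
  also have "\<dots> = (\<integral>\<^sup>+r. \<integral>\<^sup>+u. \<Phi> (vec_option u (r - ?s u)) \<partial>(lborel :: (real^'m) measure) \<partial>lborel)"
    by (intro lborel_pair.Fubini'[symmetric]) measurable
  also have "\<dots> = (\<integral>\<^sup>+r. \<integral>\<^sup>+u. indicator {0<..} r * ennreal (r ^ CARD('m)) * \<Phi> (\<lambda>i. r * append_last u $ i)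
      \<partial>(lborel :: (real^'m) measure) \<partial>lborel)"
  proof (rule nn_integral_cong)
    fix r :: real
    show "(\<integral>\<^sup>+u. \<Phi> (vec_option u (r - ?s u)) \<partial>(lborel :: (real^'m) measure)) =
      (\<integral>\<^sup>+u. indicator {0<..} r * ennreal (r ^ CARD('m)) * \<Phi> (\<lambda>i. r * append_last u $ i) \<partial>(lborel :: (real^'m) measure))"
    proof (cases "r > 0")
      case True
      have "(\<integral>\<^sup>+u. \<Phi> (vec_option u (r - ?s u)) \<partial>(lborel :: (real^'m) measure)) =
          ennreal (r ^ CARD('m)) * (\<integral>\<^sup>+u. \<Phi> (vec_option (r *\<^sub>R u) (r - ?s (r *\<^sub>R u))) \<partial>(lborel :: (real^'m) measure))"
        using nn_integral_lborel_scale[of "\<lambda>u::real^'m. \<Phi> (vec_option u (r - ?s u))" r] True by simp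
      also have "\<dots> = (\<integral>\<^sup>+u. ennreal (r ^ CARD('m)) * \<Phi> (vec_option (r *\<^sub>R u) (r - ?s (r *\<^sub>R u))) \<partial>(lborel :: (real^'m) measure))"
        by (intro nn_integral_cmult[symmetric]) measurable
      finally show ?thesis using True unfolding vec_option_append_last by simp
    next
      case False
      \<comment> \<open>The coordinates add up to \<open>r\<close>, which is not positive here, so
        they cannot all be positive.\<close>
      have "\<Phi> (vec_option u (r - ?s u)) = 0" for u
      proof (rule supp, rule)
        assume *: "\<forall>i. vec_option u (r - ?s u) i > 0"
        have "u $ j > 0" for j using *[rule_format, of "Some j"] by (simp add: vec_option_def)
        then have "?s u \<ge> 0" by (intro sum_nonneg) (simp add: less_imp_le)
        moreover have "r - ?s u > 0" using *[rule_format, of None] by (simp add: vec_option_def)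
        ultimately show False using False by simp
      qed
      then show ?thesis using False by simp
    qed
  qed
  also have "\<dots> = (\<integral>\<^sup>+u. \<integral>\<^sup>+r. indicator {0<..} r * ennreal (r ^ CARD('m)) * \<Phi> (\<lambda>i. r * append_last u $ i)
      \<partial>lborel \<partial>(lborel :: (real^'m) measure))"
    unfolding vec_option_append_last[symmetric] by (intro lborel_pair.Fubini') measurable
  finally show ?thesis .
qed

text \<open>A product measure is determined by its values on rectangles, and there the indicator
  factorises, so the integral of the product density splits into one-dimensional masses.\<close>

lemma nn_integral_PiM_density:
  fixes f :: "'k::finite \<Rightarrow> real \<Rightarrow> real" and G :: "('k \<Rightarrow> real) \<Rightarrow> ennreal"
  assumes [measurable]: "\<And>i. f i \<in> borel_measurable borel"
    and nonneg: "\<And>i x. f i x \<ge> 0"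
    and prob: "\<And>i. prob_space (density lborel (f i))"
    and [measurable]: "G \<in> borel_measurable (Pi\<^sub>M UNIV (\<lambda>_. lborel))"
  shows "(\<integral>\<^sup>+z. G z \<partial>Pi\<^sub>M UNIV (\<lambda>i. density lborel (f i))) =
    (\<integral>\<^sup>+z. ennreal (\<Prod>i\<in>UNIV. f i (z i)) * G z \<partial>Pi\<^sub>M UNIV (\<lambda>_. lborel))"
proof -
  interpret L: product_sigma_finite "\<lambda>_::'k. lborel :: real measure"
    by (rule product_sigma_finite.intro) (rule sigma_finite_lborel)
  interpret D: product_sigma_finite "\<lambda>i. density lborel (f i)"
    by (rule product_sigma_finite.intro) (rule prob_space_imp_sigma_finite[OF prob])
  let ?P = "density (Pi\<^sub>M UNIV (\<lambda>_. lborel)) (\<lambda>z. ennreal (\<Prod>i\<in>UNIV. f i (z i)))"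
  have "?P = Pi\<^sub>M UNIV (\<lambda>i. density lborel (f i))"
  proof (rule D.PiM_eqI)
    show "sets ?P = sets (Pi\<^sub>M UNIV (\<lambda>i. density lborel (f i)))"
      by (simp cong: sets_PiM_cong)
    fix A :: "'k \<Rightarrow> real set" assume "\<And>i. i \<in> UNIV \<Longrightarrow> A i \<in> sets (density lborel (f i))"
    then have [measurable]: "A i \<in> sets borel" for i by simp
    have PiE: "Pi\<^sub>E UNIV A \<in> sets (Pi\<^sub>M UNIV (\<lambda>_. lborel :: real measure))"
      by (intro sets_PiM_I_finite) auto
    have ind: "indicator (Pi\<^sub>E UNIV A) z = (\<Prod>i\<in>UNIV. indicator (A i) (z i) :: ennreal)" for z
    proof (cases "z \<in> Pi\<^sub>E UNIV A")
      case True
      then have "z i \<in> A i" for i by auto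
      then show ?thesis using True by simp
    next
      case False
      then obtain i where i: "z i \<notin> A i" by auto
      have "(\<Prod>i\<in>UNIV. indicator (A i) (z i) :: ennreal) = 0"
        by (intro prod_zero bexI[of _ i]) (use i in simp_all)
      then show ?thesis using False by simp
    qed
    have "emeasure ?P (Pi\<^sub>E UNIV A) = (\<integral>\<^sup>+z. (\<Prod>i\<in>UNIV. ennreal (f i (z i)) * indicator (A i) (z i)) \<partial>Pi\<^sub>M UNIV (\<lambda>_. lborel))"
      using PiE nonneg by (subst emeasure_density) (auto simp: ind prod.distrib prod_ennreal)
    also have "\<dots> = (\<Prod>i\<in>UNIV. \<integral>\<^sup>+x. ennreal (f i x) * indicator (A i) x \<partial>lborel)"
      by (rule L.product_nn_integral_prod) auto
    also have "\<dots> = (\<Prod>i\<in>UNIV. emeasure (density lborel (f i)) (A i))"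
      by (intro prod.cong) (simp_all add: emeasure_density)
    finally show "emeasure ?P (Pi\<^sub>E UNIV A) = (\<Prod>i\<in>UNIV. emeasure (density lborel (f i)) (A i))" .
  qed simp
  then show ?thesis
    by (subst nn_integral_density[symmetric]) simp_all
qed

lemma append_last_measurable [measurable]: "append_last \<in> borel_measurable (borel :: (real^'m::finite) measure)"
proof -
  have "(\<lambda>u::real^'m. append_last u $ i) \<in> borel_measurable borel" for i
    by (cases i) (simp_all add: append_last_def)
  then have "(\<lambda>u::real^'m. \<chi> i. append_last u $ i) \<in> borel_measurable borel"
    by (rule measurable_vec_lambda)
  then show ?thesis by simp
qed

lemma concrete_density_measurable [measurable]: "concrete_density \<beta> \<tau> \<in> borel_measurable borel"
  unfolding concrete_density_def by measurable

lemma prob_simplex_measurable [measurable]: "prob_simplex \<in> sets (borel :: (real^'k) measure)"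
  unfolding prob_simplex_def by measurable

lemma sum_append_last: "(\<Sum>i\<in>UNIV. append_last u $ i) = 1"
  by (simp add: UNIV_option_conv append_last_def sum.reindex)

section \<open>The Concrete distribution as projection of a reweighted product law\<close>

definition frechet_sum :: "real^'k \<Rightarrow> real \<Rightarrow> ('k \<Rightarrow> real) \<Rightarrow> real"
  where "frechet_sum \<beta> \<tau> z = (\<Sum>i\<in>UNIV. \<beta> $ i * z i powr - \<tau>)"

definition normalize_sum :: "('k \<Rightarrow> real) \<Rightarrow> real^'k"
  where "normalize_sum z = (\<chi> i. z i / (\<Sum>j\<in>UNIV. z j))"

lemma frechet_sum_measurable [measurable]:
  "frechet_sum \<beta> \<tau> \<in> borel_measurable (Pi\<^sub>M (UNIV::'k::finite set) (\<lambda>_. lborel :: real measure))"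
  unfolding frechet_sum_def by measurable

lemma normalize_sum_measurable [measurable]:
  "normalize_sum \<in> borel_measurable (Pi\<^sub>M (UNIV::'k::finite set) (\<lambda>_. lborel :: real measure))"
  unfolding normalize_sum_def by (intro measurable_vec_lambda) measurable

text \<open>Along the ray through \<open>x\<close> the sum T equals r^-\<tau> S, so the exponential
  factors merge into that of a Frechet density of scale S. The substitution t = S r^-\<tau> leaves
  the integral of t^(K + 1), and (K + 1)! = K (K + 1) (K - 1)! cancels the normalisation and
  supplies the factorial of the Concrete density.\<close>

lemma nn_integral_ray:
  fixes \<beta> x :: "real^'m::finite option"
  defines "K \<equiv> CARD('m option)"
  assumes \<beta>: "\<And>i. \<beta> $ i > 0" and \<tau>: "\<tau> > 0" and x: "\<And>i. x $ i > 0"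
  shows "(\<integral>\<^sup>+r. indicator {0<..} r * ennreal (r ^ CARD('m)) *
      ennreal ((\<Prod>i\<in>UNIV. frechet_density (\<beta> $ i) \<tau> (r * x $ i))
        * ((frechet_sum \<beta> \<tau> (\<lambda>i. r * x $ i))\<^sup>2 / (K * (K + 1)))) \<partial>lborel)
    = ennreal (concrete_density \<beta> \<tau> x)"
proof -
  define S where "S = frechet_sum \<beta> \<tau> (\<lambda>i. x $ i)"
  define B where "B = (\<Prod>i\<in>UNIV. \<beta> $ i * (x $ i powr - \<tau> / x $ i))"
  define C where "C = \<tau> ^ CARD('m) * B / (S ^ K * (K * (K + 1)))"
  have K: "K = Suc CARD('m)" by (simp add: K_def)
  have S: "S > 0" unfolding S_def frechet_sum_def
    using \<beta> x by (intro sum_pos mult_pos_pos) (auto simp: less_imp_neq[symmetric])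
  have B: "B > 0" unfolding B_def
    using \<beta> x by (intro prod_pos) (auto intro!: mult_pos_pos divide_pos_pos simp: less_imp_neq[symmetric])
  have C: "C \<ge> 0" unfolding C_def using S B \<tau> by simp
  \<comment> \<open>The K densities give r^-\<tau> to the power K and the squared sum gives two
    more; one factor belongs to the radial Frechet density, so K + 1 remain. The Jacobian reduces
    r^-K to the 1 / r of that density.\<close>
  have integrand: "r ^ CARD('m) * ((\<Prod>i\<in>UNIV. frechet_density (\<beta> $ i) \<tau> (r * x $ i))
        * ((frechet_sum \<beta> \<tau> (\<lambda>i. r * x $ i))\<^sup>2 / (K * (K + 1)))) =
      C * (frechet_density S \<tau> r * (S * r powr - \<tau>) ^ (K + 1))" if r: "r > 0" for r
  proof -
    define a where "a = r powr - \<tau>"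
    have *: "(r * x $ i) powr - \<tau> = a * x $ i powr - \<tau>" for i
      using r x[of i] by (simp add: a_def powr_mult)
    have **: "y powr (- \<tau> - 1) = y powr - \<tau> / y" if "y > 0" for y
      using that by (simp add: powr_diff)
    have sum: "frechet_sum \<beta> \<tau> (\<lambda>i. r * x $ i) = a * S"
      unfolding frechet_sum_def S_def * by (simp add: sum_distrib_left algebra_simps)
    have "frechet_density (\<beta> $ i) \<tau> (r * x $ i) =
        (\<tau> * a / r) * (\<beta> $ i * (x $ i powr - \<tau> / x $ i)) * exp (- (a * (\<beta> $ i * x $ i powr - \<tau>)))" for i
      using r x[of i] by (simp add: frechet_density_def * **[OF mult_pos_pos[OF r x]] field_simps)
    then have "(\<Prod>i\<in>UNIV. frechet_density (\<beta> $ i) \<tau> (r * x $ i)) = (\<Prod>i\<in>UNIV.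
        (\<tau> * a / r) * (\<beta> $ i * (x $ i powr - \<tau> / x $ i)) * exp (- (a * (\<beta> $ i * x $ i powr - \<tau>))))"
      by (intro prod.cong refl)
    also have "\<dots> = (\<tau> * a / r) ^ K * B * exp (\<Sum>i\<in>UNIV. - (a * (\<beta> $ i * x $ i powr - \<tau>)))"
      unfolding prod.distrib B_def K_def exp_sum[OF finite] prod_constant ..
    also have "(\<Sum>i\<in>UNIV. - (a * (\<beta> $ i * x $ i powr - \<tau>))) = - (a * S)"
      unfolding S_def frechet_sum_def by (simp add: sum_negf sum_distrib_left)
    finally have prod: "(\<Prod>i\<in>UNIV. frechet_density (\<beta> $ i) \<tau> (r * x $ i)) = (\<tau> * a / r) ^ K * B * exp (- (a * S))" .
    have fS: "frechet_density S \<tau> r = S * \<tau> * (a / r) * exp (- (a * S))"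
      using r by (simp add: frechet_density_def **[OF r] a_def mult.commute)
    have "r ^ n * ((\<tau> * a / r) ^ Suc n * B * E * ((a * S)\<^sup>2 / N)) =
        \<tau> ^ n * B / (S ^ Suc n * N) * (S * \<tau> * (a / r) * E * (S * a) ^ (Suc n + 1))" for n E N
      using r S by (cases "N = 0") (simp_all add: field_simps power2_eq_square)
    then show ?thesis
      unfolding sum a_def[symmetric] C_def prod fS K .
  qed
  have "(\<integral>\<^sup>+r. indicator {0<..} r * ennreal (r ^ CARD('m)) *
      ennreal ((\<Prod>i\<in>UNIV. frechet_density (\<beta> $ i) \<tau> (r * x $ i))
        * ((frechet_sum \<beta> \<tau> (\<lambda>i. r * x $ i))\<^sup>2 / (K * (K + 1)))) \<partial>lborel) =
     (\<integral>\<^sup>+r. ennreal C * (ennreal (frechet_density S \<tau> r) * ennreal ((S * r powr - \<tau>) ^ (K + 1))) \<partial>lborel)"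
  proof (rule nn_integral_cong)
    fix r :: real
    show "indicator {0<..} r * ennreal (r ^ CARD('m)) *
        ennreal ((\<Prod>i\<in>UNIV. frechet_density (\<beta> $ i) \<tau> (r * x $ i))
          * ((frechet_sum \<beta> \<tau> (\<lambda>i. r * x $ i))\<^sup>2 / (K * (K + 1)))) =
      ennreal C * (ennreal (frechet_density S \<tau> r) * ennreal ((S * r powr - \<tau>) ^ (K + 1)))"
    proof (cases "r > 0")
      case True
      then show ?thesis
        using integrand[OF True] C S \<tau> \<beta> True
        by (simp add: ennreal_mult[symmetric] ennreal_mult'[symmetric] frechet_density_nonneg prod_nonneg)
    next
      case False
      then show ?thesis by (simp add: frechet_density_def)
    qed
  qed
  also have "\<dots> = ennreal C * (\<integral>\<^sup>+r. frechet_density S \<tau> r * ennreal ((S * r powr - \<tau>) ^ (K + 1)) \<partial>lborel)"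
    by (rule nn_integral_cmult) measurable
  also have "(\<integral>\<^sup>+r. frechet_density S \<tau> r * ennreal ((S * r powr - \<tau>) ^ (K + 1)) \<partial>lborel) =
      (\<integral>\<^sup>+t. ennreal (t ^ (K + 1)) \<partial>exp1)"
    using nn_integral_frechet[OF S \<tau>, of "\<lambda>t. ennreal (t ^ (K + 1))"] by simp
  also have "\<dots> = (\<integral>\<^sup>+t. ennreal (exponential_density 1 t * t ^ (K + 1)) \<partial>lborel)"
    by (subst nn_integral_density) (auto simp: ennreal_mult'' ennreal_mult' exponential_density_def intro!: nn_integral_cong)
  also have "\<dots> = ennreal (fact (K + 1))"
    using nn_integral_erlang_ith_moment[of 1 0 "K + 1"] by simp
  also have "ennreal C * ennreal (fact (K + 1)) = ennreal (C * fact (K + 1))"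
    using C by (simp add: ennreal_mult)
  also have "C * fact (K + 1) = concrete_density \<beta> \<tau> x"
  proof -
    have 1: "\<beta> $ i / x $ i powr (\<tau> + 1) = \<beta> $ i * (x $ i powr - \<tau> / x $ i)" for i
      using x[of i] by (simp add: powr_add powr_minus_divide)
    have 2: "(\<Sum>j\<in>UNIV. \<beta> $ j / x $ j powr \<tau>) = S"
      by (simp add: S_def frechet_sum_def powr_minus_divide)
    have 3: "(fact (K + 1) :: real) = real (K * (K + 1)) * fact (K - 1)"
      using K by (simp add: fact_reduce algebra_simps)
    have 4: "t * B / (s * N) * (N * f) = f * t / s * B" if "N \<noteq> 0" for t s N f
      using that by simp
    have "C * fact (K + 1) = fact (K - 1) * \<tau> ^ CARD('m) / S ^ K * B"
      unfolding C_def 3 by (rule 4) (simp only: of_nat_eq_0_iff, simp add: K)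
    then show ?thesis
      unfolding concrete_density_def 1 2 B_def[symmetric] K_def[symmetric] by (simp add: K)
  qed
  finally show ?thesis .
qed

text \<open>T is independent of the direction, so weighting by T^2 over its mean leaves the law of
  the direction unchanged. The weight is included because each of the two scores will absorb one
  factor T.\<close>

lemma nn_integral_concrete_distribution:
  fixes \<beta> :: "real^'m::finite option"
  defines "K \<equiv> CARD('m option)"
  assumes \<beta>: "\<And>i. \<beta> $ i > 0" and \<tau>: "\<tau> > 0" and [measurable]: "F \<in> borel_measurable borel"
  shows "(\<integral>\<^sup>+x. F x \<partial>concrete_distribution \<beta> \<tau>) =
    (\<integral>\<^sup>+z. ennreal ((frechet_sum \<beta> \<tau> z)\<^sup>2 / (K * (K + 1))) * F (normalize_sum z)
      \<partial>Pi\<^sub>M UNIV (\<lambda>i. density lborel (frechet_density (\<beta> $ i) \<tau>)))"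
proof -
  let ?w = "\<lambda>z. ennreal ((frechet_sum \<beta> \<tau> z)\<^sup>2 / (K * (K + 1)))"
  let ?p = "\<lambda>z. \<Prod>i\<in>UNIV. frechet_density (\<beta> $ i) \<tau> (z i)"
  have fd: "frechet_density (\<beta> $ i) \<tau> x \<ge> 0" for i x
    by (intro frechet_density_nonneg \<beta> \<tau>)
  have "(\<integral>\<^sup>+z. ?w z * F (normalize_sum z) \<partial>Pi\<^sub>M UNIV (\<lambda>i. density lborel (frechet_density (\<beta> $ i) \<tau>))) =
      (\<integral>\<^sup>+z. ennreal (?p z) * (?w z * F (normalize_sum z)) \<partial>Pi\<^sub>M UNIV (\<lambda>_. lborel))"
    by (rule nn_integral_PiM_density) (auto simp: fd intro!: prob_space_frechet \<beta> \<tau>)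
  also have "\<dots> = (\<integral>\<^sup>+u. \<integral>\<^sup>+r. indicator {0<..} r * ennreal (r ^ CARD('m)) *
      (ennreal (?p (\<lambda>i. r * append_last u $ i)) * (?w (\<lambda>i. r * append_last u $ i)
        * F (normalize_sum (\<lambda>i. r * append_last u $ i)))) \<partial>lborel \<partial>(lborel :: (real^'m) measure))"
  proof (rule nn_integral_cone)
    fix z :: "'m option \<Rightarrow> real" assume "\<not> (\<forall>i. 0 < z i)"
    then obtain i where "\<not> z i > 0" by auto
    then have p: "?p z = 0"
      by (intro prod_zero bexI[of _ i]) (simp_all add: frechet_density_def)
    show "ennreal (?p z) * (?w z * F (normalize_sum z)) = 0" unfolding p by simp
  qed measurable
  also have "\<dots> = (\<integral>\<^sup>+u. ennreal (indicator prob_simplex (append_last u) * concrete_density \<beta> \<tau> (append_last u))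
      * F (append_last u) \<partial>(lborel :: (real^'m) measure))"
  proof (rule nn_integral_cong)
    fix u :: "real^'m"
    define x where "x = append_last u"
    show "(\<integral>\<^sup>+r. indicator {0<..} r * ennreal (r ^ CARD('m)) *
      (ennreal (?p (\<lambda>i. r * append_last u $ i)) * (?w (\<lambda>i. r * append_last u $ i)
        * F (normalize_sum (\<lambda>i. r * append_last u $ i)))) \<partial>lborel) =
      ennreal (indicator prob_simplex (append_last u) * concrete_density \<beta> \<tau> (append_last u)) * F (append_last u)"
      unfolding x_def[symmetric]
    proof (cases "\<forall>i. x $ i > 0")
      case True
      have norm: "normalize_sum (\<lambda>i. r * x $ i) = x" if "r > 0" for r
        using that by (simp add: normalize_sum_def vec_eq_iff x_def sum_append_last flip: sum_distrib_left)
      have "(\<integral>\<^sup>+r. indicator {0<..} r * ennreal (r ^ CARD('m)) *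
        (ennreal (?p (\<lambda>i. r * x $ i)) * (?w (\<lambda>i. r * x $ i) * F (normalize_sum (\<lambda>i. r * x $ i)))) \<partial>lborel) =
        (\<integral>\<^sup>+r. (indicator {0<..} r * ennreal (r ^ CARD('m)) *
          ennreal (?p (\<lambda>i. r * x $ i) * ((frechet_sum \<beta> \<tau> (\<lambda>i. r * x $ i))\<^sup>2 / (K * (K + 1))))) * F x \<partial>lborel)"
      proof (rule nn_integral_cong)
        fix r :: real
        show "indicator {0<..} r * ennreal (r ^ CARD('m)) *
          (ennreal (?p (\<lambda>i. r * x $ i)) * (?w (\<lambda>i. r * x $ i) * F (normalize_sum (\<lambda>i. r * x $ i)))) =
          (indicator {0<..} r * ennreal (r ^ CARD('m)) *
          ennreal (?p (\<lambda>i. r * x $ i) * ((frechet_sum \<beta> \<tau> (\<lambda>i. r * x $ i))\<^sup>2 / (K * (K + 1))))) * F x"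
        proof (cases "r > 0")
          case True
          have "ennreal (?p (\<lambda>i. r * x $ i) * ((frechet_sum \<beta> \<tau> (\<lambda>i. r * x $ i))\<^sup>2 / (K * (K + 1)))) =
              ennreal (?p (\<lambda>i. r * x $ i)) * ?w (\<lambda>i. r * x $ i)"
            by (intro ennreal_mult prod_nonneg fd) simp
          then show ?thesis unfolding norm[OF True] by (simp only: mult.assoc)
        qed simp
      qed
      also have "\<dots> = ennreal (concrete_density \<beta> \<tau> x) * F x"
      proof (subst nn_integral_multc)
        have [measurable]: "(\<lambda>r. frechet_sum \<beta> \<tau> (\<lambda>i. r * x $ i)) \<in> borel_measurable borel"
          unfolding frechet_sum_def by measurable
        show "(\<lambda>r. indicator {0<..} r * ennreal (r ^ CARD('m)) *
          ennreal (?p (\<lambda>i. r * x $ i) * ((frechet_sum \<beta> \<tau> (\<lambda>i. r * x $ i))\<^sup>2 / (K * (K + 1)))))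
          \<in> borel_measurable lborel"
          by measurable
      qed (simp only: nn_integral_ray[OF \<beta> \<tau> True[rule_format], folded K_def])
      finally show "(\<integral>\<^sup>+r. indicator {0<..} r * ennreal (r ^ CARD('m)) *
        (ennreal (?p (\<lambda>i. r * x $ i)) * (?w (\<lambda>i. r * x $ i) * F (normalize_sum (\<lambda>i. r * x $ i)))) \<partial>lborel) =
        ennreal (indicator prob_simplex x * concrete_density \<beta> \<tau> x) * F x"
        using True by (simp add: prob_simplex_def x_def sum_append_last less_imp_le)
    next
      case False
      then obtain i where i: "\<not> x $ i > 0" by auto
      have z1: "indicator {0<..} r * ennreal (r ^ CARD('m)) * (ennreal (?p (\<lambda>i. r * x $ i)) * y) = 0" for r y
      proof (cases "r > 0")
        case True
        then have "\<not> r * x $ i > 0" using i by (simp add: zero_less_mult_iff)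
        then have p: "?p (\<lambda>i. r * x $ i) = 0"
          by (intro prod_zero bexI[of _ i]) (simp_all add: frechet_density_def)
        show ?thesis unfolding p by simp
      qed simp
      \<comment> \<open>A negative coordinate lies outside the simplex. A zero coordinate stays
        inside, but there the formula vanishes because \<open>0 powr s = 0\<close> and division by 0
        yields 0.\<close>
      have z2: "indicator prob_simplex x * concrete_density \<beta> \<tau> x = 0"
      proof (cases "x $ i = 0")
        case True
        then have "(\<Prod>i\<in>UNIV. \<beta> $ i / x $ i powr (\<tau> + 1)) = 0"
          by (intro prod_zero bexI[of _ i]) simp_all
        then show ?thesis by (simp add: concrete_density_def)
      next
        case False
        then have "x \<notin> prob_simplex" using i by (auto simp: prob_simplex_def not_less intro!: exI[of _ i])
        then show ?thesis by simp
      qed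
      show "(\<integral>\<^sup>+r. indicator {0<..} r * ennreal (r ^ CARD('m)) *
        (ennreal (?p (\<lambda>i. r * x $ i)) * (?w (\<lambda>i. r * x $ i) * F (normalize_sum (\<lambda>i. r * x $ i)))) \<partial>lborel) =
        ennreal (indicator prob_simplex x * concrete_density \<beta> \<tau> x) * F x"
        by (simp only: z1 z2 nn_integral_const ennreal_0 mult_zero_left)
    qed
  qed
  also have "\<dots> = (\<integral>\<^sup>+x. F x \<partial>concrete_distribution \<beta> \<tau>)"
    unfolding concrete_distribution_def
    by (simp add: nn_integral_distr nn_integral_density)
  finally show ?thesis ..
qed

section \<open>The Fisher information\<close>

definition frechet_product :: "real^'k \<Rightarrow> real \<Rightarrow> ('k \<Rightarrow> real) measure"
  where "frechet_product \<beta> \<tau> = Pi\<^sub>M UNIV (\<lambda>i. density lborel (frechet_density (\<beta> $ i) \<tau>))"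

lemma sets_frechet_product [measurable_cong]:
  "sets (frechet_product \<beta> \<tau>) = sets (Pi\<^sub>M UNIV (\<lambda>_. lborel))"
  unfolding frechet_product_def by (intro sets_PiM_cong) auto

lemma concrete_distribution_eq_distr:
  fixes \<beta> :: "real^'m::finite option"
  defines "K \<equiv> CARD('m option)"
  assumes \<beta>: "\<And>i. \<beta> $ i > 0" and \<tau>: "\<tau> > 0"
  shows "concrete_distribution \<beta> \<tau> =
    distr (density (frechet_product \<beta> \<tau>) (\<lambda>z. (frechet_sum \<beta> \<tau> z)\<^sup>2 / (K * (K + 1)))) borel normalize_sum"
    (is "_ = ?R")
proof (rule measure_eqI)
  show "sets (concrete_distribution \<beta> \<tau>) = sets ?R"
    by (simp add: concrete_distribution_def)
  fix A assume "A \<in> sets (concrete_distribution \<beta> \<tau>)"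
  then have A [measurable]: "A \<in> sets borel" by (simp add: concrete_distribution_def)
  have "emeasure (concrete_distribution \<beta> \<tau>) A = (\<integral>\<^sup>+x. indicator A x \<partial>concrete_distribution \<beta> \<tau>)"
    by (rule nn_integral_indicator[symmetric]) (simp add: concrete_distribution_def)
  also have "\<dots> = (\<integral>\<^sup>+z. ennreal ((frechet_sum \<beta> \<tau> z)\<^sup>2 / (K * (K + 1))) * indicator A (normalize_sum z)
      \<partial>frechet_product \<beta> \<tau>)"
    unfolding frechet_product_def K_def by (rule nn_integral_concrete_distribution) (auto simp: \<beta> \<tau>)
  also have "\<dots> = (\<integral>\<^sup>+x. indicator A x \<partial>?R)"
    by (subst nn_integral_distr; (subst nn_integral_density)?) auto
  also have "\<dots> = emeasure ?R A"
    by (rule nn_integral_indicator) simp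
  finally show "emeasure (concrete_distribution \<beta> \<tau>) A = emeasure ?R A" .
qed

lemma AE_frechet_product_pos:
  fixes \<beta> :: "real^'k::finite"
  assumes \<beta>: "\<And>i. \<beta> $ i > 0" and \<tau>: "\<tau> > 0"
  shows "AE z in frechet_product \<beta> \<tau>. \<forall>i. z i > 0"
proof -
  have "AE z in frechet_product \<beta> \<tau>. z i > 0" for i
    unfolding frechet_product_def
  proof (rule AE_PiM_component)
    show "prob_space (density lborel (frechet_density (\<beta> $ i) \<tau>))" for i
      by (intro prob_space_frechet \<beta> \<tau>)
    show "AE x in density lborel (frechet_density (\<beta> $ i) \<tau>). 0 < x"
      by (subst AE_density) (auto simp: frechet_density_def)
  qed simp
  then show ?thesis by (simp add: AE_all_countable)
qed

section \<open>The score and its second moments\<close>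

definition last_diff :: "real^'m::finite \<Rightarrow> 'm option \<Rightarrow> real"
  where "last_diff a i = (case i of Some j \<Rightarrow> a $ j | None \<Rightarrow> - (\<Sum>j\<in>UNIV. a $ j))"

lemma append_last_add: "append_last (b + t *\<^sub>R a) $ i = append_last b $ i + t * last_diff a i"
  by (auto simp: append_last_def last_diff_def sum.distrib sum_distrib_left split: option.splits)

text \<open>The derivative of the log density in the direction \<open>(d, c)\<close>, grouped by the
  factors 1 - K e_i / T. These are invariant under scaling of \<open>x\<close> and add up to
  zero.\<close>

definition concrete_score :: "real^'k \<Rightarrow> real \<Rightarrow> ('k \<Rightarrow> real) \<Rightarrow> real \<Rightarrow> ('k \<Rightarrow> real) \<Rightarrow> real"
  where "concrete_score \<beta> \<tau> d c x = (real CARD('k) - 1) * (c / \<tau>) +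
    (\<Sum>i\<in>UNIV. (d i / \<beta> $ i - c * ln (x i)) * (1 - CARD('k) * (\<beta> $ i * x i powr - \<tau>) / frechet_sum \<beta> \<tau> x))"

lemma concrete_params_pos:
  assumes "p \<in> concrete_params"
  shows "append_last (fst p) $ i > 0" "snd p > 0"
  using assms by (auto simp: concrete_params_def)

text \<open>
  The formula must hold for all \<open>x\<close>, also outside the simplex, since the score has to be measurable on the
  whole space. It does because \<open>x powr s = exp (s * ln x)\<close> for every \<open>x \<noteq> 0\<close>, with \<open>ln x = ln \<bar>x\<bar>\<close>, and
  because a zero coordinate makes the density vanish for all parameters (\<open>0 powr s = 0\<close> and \<open>b / 0 = 0\<close>).
\<close>

lemma dir_deriv_concrete_log_likelihood:
  fixes p a :: "(real^'m::finite) \<times> real" and x :: "real^'m option"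
  assumes p: "p \<in> concrete_params"
  shows "dir_deriv (concrete_log_likelihood x) p a =
    (if \<exists>i. x $ i = 0 then 0
     else concrete_score (append_last (fst p)) (snd p) (last_diff (fst a)) (snd a) (\<lambda>i. x $ i))"
proof (cases "\<exists>i. x $ i = 0")
  case True
  then obtain i where i: "x $ i = 0" ..
  have "concrete_density \<beta> \<tau> x = 0" for \<beta> \<tau>
  proof -
    have "(\<Prod>i\<in>UNIV. \<beta> $ i / x $ i powr (\<tau> + 1)) = 0"
      using i by (intro prod_zero bexI[of _ i]) simp_all
    then show ?thesis by (simp add: concrete_density_def)
  qed
  then have "concrete_log_likelihood x = (\<lambda>_. ln 0)"
    by (simp add: concrete_log_likelihood_def fun_eq_iff)
  then show ?thesis
    using True by (simp add: dir_deriv_def)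
next
  case False
  define n K where "n = CARD('m)" and "K = real CARD('m option)"
  define \<beta> \<tau> d c where "\<beta> i = append_last (fst p) $ i" and "\<tau> = snd p" and "d = last_diff (fst a)" and "c = snd a"
    for i
  define lx where "lx i = ln (x $ i)" for i
  have \<beta>: "\<beta> i > 0" and \<tau>: "\<tau> > 0" for i
    using concrete_params_pos[OF p] by (simp_all add: \<beta>_def \<tau>_def)
  have powr: "x $ i powr s = exp (s * lx i)" for i s
    using False by (simp add: powr_def lx_def)
  have K: "K = real n + 1" by (simp add: K_def n_def)
  \<comment> \<open>The log likelihood along the line, expanded. The expansion relies on positive
    parameters and so is used only for \<open>t\<close> near 0.\<close>
  define F where "F t = ln (fact n) + n * ln (\<tau> + t * c)
      - K * ln (\<Sum>i\<in>UNIV. (\<beta> i + t * d i) * exp (- (\<tau> + t * c) * lx i))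
      + (\<Sum>i\<in>UNIV. ln (\<beta> i + t * d i) - (\<tau> + t * c + 1) * lx i)" for t
  have "\<forall>\<^sub>F t in nhds 0. \<tau> + t * c > 0"
    using \<tau> by (intro order_tendstoD(1)[of _ \<tau>]) (auto intro!: tendsto_eq_intros filterlim_ident)
  moreover have "\<forall>\<^sub>F t in nhds 0. \<forall>i. \<beta> i + t * d i > 0"
    using \<beta> by (intro eventually_all_finite order_tendstoD(1)[of _ "\<beta> _"]) (auto intro!: tendsto_eq_intros filterlim_ident)
  ultimately have "\<forall>\<^sub>F t in nhds 0. concrete_log_likelihood x (p + t *\<^sub>R a) = F t"
  proof eventually_elim
    case (elim t)
    let ?S = "\<Sum>i\<in>UNIV. (\<beta> i + t * d i) * exp (- (\<tau> + t * c) * lx i)"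
    have S: "?S > 0" using elim by (intro sum_pos) auto
    have P: "(\<Prod>i\<in>UNIV. (\<beta> i + t * d i) * exp (- (\<tau> + t * c + 1) * lx i)) > 0"
      using elim by (intro prod_pos) auto
    have 1: "(\<Sum>j\<in>UNIV. append_last (fst (p + t *\<^sub>R a)) $ j / x $ j powr snd (p + t *\<^sub>R a)) = ?S"
      unfolding powr
      by (intro sum.cong refl) (simp only: fst_add snd_add fst_scaleR snd_scaleR append_last_add \<beta>_def[symmetric] d_def[symmetric] \<tau>_def[symmetric] c_def[symmetric]
          mult_minus_left exp_minus divide_inverse real_scaleR_def)
    have 2: "(\<Prod>i\<in>UNIV. append_last (fst (p + t *\<^sub>R a)) $ i / x $ i powr (snd (p + t *\<^sub>R a) + 1)) =
        (\<Prod>i\<in>UNIV. (\<beta> i + t * d i) * exp (- (\<tau> + t * c + 1) * lx i))"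
      unfolding powr
      by (intro prod.cong refl) (simp only: fst_add snd_add fst_scaleR snd_scaleR append_last_add \<beta>_def[symmetric] d_def[symmetric] \<tau>_def[symmetric] c_def[symmetric]
          mult_minus_left exp_minus divide_inverse real_scaleR_def)
    have "concrete_log_likelihood x (p + t *\<^sub>R a) =
      ln (fact n * (\<tau> + t * c) ^ n / ?S ^ CARD('m option) * (\<Prod>i\<in>UNIV. (\<beta> i + t * d i) * exp (- (\<tau> + t * c + 1) * lx i)))"
      unfolding concrete_log_likelihood_def concrete_density_def 1 2
      by (simp add: \<tau>_def c_def n_def)
    also have "\<dots> = ln (fact n * (\<tau> + t * c) ^ n / ?S ^ CARD('m option))
        + ln (\<Prod>i\<in>UNIV. (\<beta> i + t * d i) * exp (- (\<tau> + t * c + 1) * lx i))"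
      using elim S P by (intro ln_mult_pos) auto
    also have "ln (fact n * (\<tau> + t * c) ^ n / ?S ^ CARD('m option)) =
        ln (fact n) + n * ln (\<tau> + t * c) - K * ln ?S"
    proof -
      have "ln (f * A ^ n / B ^ k) = ln f + n * ln A - real k * ln B" if "f > 0" "A > 0" "B > 0" for f A B :: real and k
        using that by (simp add: ln_div ln_mult_pos ln_realpow)
      from this[OF fact_gt_zero elim(1) S] show ?thesis unfolding K_def .
    qed
    also have "ln (\<Prod>i\<in>UNIV. (\<beta> i + t * d i) * exp (- (\<tau> + t * c + 1) * lx i)) =
        (\<Sum>i\<in>UNIV. ln (\<beta> i + t * d i) - (\<tau> + t * c + 1) * lx i)"
    proof (subst ln_prod)
      have pos: "\<beta> i + t * d i > 0" for i using elim(2) by blast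
      show "(\<beta> i + t * d i) * exp (- (\<tau> + t * c + 1) * lx i) \<noteq> 0" for i
        using pos[of i] by simp
      have "ln ((\<beta> i + t * d i) * exp (- (\<tau> + t * c + 1) * lx i)) =
          ln (\<beta> i + t * d i) - (\<tau> + t * c + 1) * lx i" for i
        using ln_mult_pos[OF pos[of i] exp_gt_zero[of "- (\<tau> + t * c + 1) * lx i"]] by (simp only: ln_exp)
      then show "(\<Sum>i\<in>UNIV. ln ((\<beta> i + t * d i) * exp (- (\<tau> + t * c + 1) * lx i))) =
          (\<Sum>i\<in>UNIV. ln (\<beta> i + t * d i) - (\<tau> + t * c + 1) * lx i)"
        by (simp only:)
    qed simp
    finally show ?case by (simp add: F_def)
  qed
  moreover have "(F has_real_derivative concrete_score (append_last (fst p)) \<tau> d c (\<lambda>i. x $ i)) (at 0)"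
  proof -
    define S where "S = (\<Sum>i\<in>UNIV. \<beta> i * exp (- \<tau> * lx i))"
    have S: "S > 0" unfolding S_def using \<beta> by (intro sum_pos) auto
    have nz: "\<beta> i \<noteq> 0" for i using \<beta>[of i] by simp
    have "(F has_real_derivative n * (c / \<tau>)
        - K * ((\<Sum>i\<in>UNIV. d i * exp (- \<tau> * lx i) + \<beta> i * (exp (- \<tau> * lx i) * (- c * lx i))) / S)
        + (\<Sum>i\<in>UNIV. d i / \<beta> i - c * lx i)) (at 0)"
      unfolding F_def S_def using \<tau> \<beta> nz S[unfolded S_def]
      by (auto intro!: derivative_eq_intros simp: mult_ac)
    also have "n * (c / \<tau>)
        - K * ((\<Sum>i\<in>UNIV. d i * exp (- \<tau> * lx i) + \<beta> i * (exp (- \<tau> * lx i) * (- c * lx i))) / S)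
        + (\<Sum>i\<in>UNIV. d i / \<beta> i - c * lx i) =
        n * (c / \<tau>) + (\<Sum>i\<in>UNIV. (d i / \<beta> i - c * lx i) * (1 - K * (\<beta> i * exp (- \<tau> * lx i)) / S))"
    proof -
      have "(d i / \<beta> i - c * lx i) * (1 - K * (\<beta> i * exp (- \<tau> * lx i)) / S) = (d i / \<beta> i - c * lx i)
        - K / S * (d i * exp (- \<tau> * lx i) + \<beta> i * (exp (- \<tau> * lx i) * (- c * lx i)))" for i
        using nz[of i] S by (simp add: field_simps)
      then show ?thesis
        by (simp only: sum_subtractf sum_distrib_left[symmetric]) simp
    qed
    also have "\<dots> = concrete_score (append_last (fst p)) \<tau> d c (\<lambda>i. x $ i)"
      unfolding concrete_score_def frechet_sum_def \<beta>_def[symmetric] K_def[symmetric] powr lx_def[symmetric] S_def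
      by (simp add: K)
    finally show ?thesis .
  qed
  ultimately have "((\<lambda>t. concrete_log_likelihood x (p + t *\<^sub>R a)) has_real_derivative
      concrete_score (append_last (fst p)) \<tau> d c (\<lambda>i. x $ i)) (at 0)"
    by (subst DERIV_cong_ev[OF refl _ refl])
  then have "dir_deriv (concrete_log_likelihood x) p a = concrete_score (append_last (fst p)) \<tau> d c (\<lambda>i. x $ i)"
    by (rule dir_deriv_has_field_derivative)
  then show ?thesis using False by (simp add: \<tau>_def d_def c_def)
qed

lemma sum_offdiag:
  fixes f g :: "'k::finite \<Rightarrow> real"
  shows "(\<Sum>(j, k)\<in>{(j, k). j \<noteq> k}. f j * g k) = sum f UNIV * sum g UNIV - (\<Sum>j\<in>UNIV. f j * g j)"
proof -
  have diag: "{(j::'k, k). j \<noteq> k} = UNIV \<times> UNIV - (\<lambda>j. (j, j)) ` UNIV" by auto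
  have "(\<Sum>p\<in>(\<lambda>j. (j, j)) ` UNIV. case p of (j, k) \<Rightarrow> f j * g k) = (\<Sum>j\<in>UNIV. f j * g j)"
    by (subst sum.reindex) (auto simp: inj_on_def)
  moreover have "(\<Sum>p\<in>UNIV \<times> UNIV. case p of (j, k) \<Rightarrow> f j * g k) = sum f UNIV * sum g UNIV"
    by (simp add: sum_product sum.cartesian_product)
  ultimately show ?thesis
    unfolding diag by (subst sum_diff) auto
qed

text \<open>The algebra behind the orthogonal decomposition: the diagonal of the double sum of (e_j
  - 1) W_k is split off and absorbed into the Q terms. The shift \<gamma> cancels because the
  factors E - K e_i add up to zero.\<close>

lemma score_algebra:
  fixes e W y :: "'k::finite \<Rightarrow> real"
  defines "K \<equiv> real CARD('k)" and "E \<equiv> sum e UNIV" and "Y \<equiv> sum y UNIV"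
  shows "(\<Sum>i\<in>UNIV. (y i + c * (W i - \<gamma>)) * (E - K * e i)) + (K - 1) * c * E =
    (\<Sum>j\<in>UNIV. c * (K - 1) * (1 + (e j - 1) * (1 - W j)) + (Y - K * y j) * (e j - 1))
    + c * (\<Sum>(j, k)\<in>{(j, k). j \<noteq> k}. (e j - 1) * W k)"
proof -
  have card: "(\<Sum>i\<in>(UNIV::'k set). x) = K * x" for x by (simp add: K_def)
  have L: "(y i + c * (W i - \<gamma>)) * (E - K * e i) =
      E * y i - K * (e i * y i) + c * E * W i - c * K * (e i * W i) - c * \<gamma> * E + c * \<gamma> * K * e i" for i
    by (simp add: algebra_simps)
  have R: "c * (K - 1) * (1 + (e j - 1) * (1 - W j)) + (Y - K * y j) * (e j - 1) =
      c * (K - 1) * e j - c * (K - 1) * (e j * W j) + c * (K - 1) * W j + Y * e j - Y - K * (e j * y j) + K * y j" for j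
    by (simp add: algebra_simps)
  have D: "(e j - 1) * W j = e j * W j - W j" for j by (simp add: algebra_simps)
  show ?thesis
    unfolding sum_offdiag L R D sum.distrib sum_subtractf sum_distrib_left[symmetric] card
      E_def[symmetric] Y_def[symmetric]
    by (simp add: algebra_simps)
qed

lemma score_product_frechet:
  fixes \<beta> :: "real^'k::finite"
  assumes \<beta>: "\<And>i. \<beta> $ i > 0" and \<tau>: "\<tau> > 0"
  shows "score_product (\<lambda>i. density lborel (frechet_density (\<beta> $ i) \<tau>))
    (\<lambda>i x. exp_dev (\<beta> $ i * x powr - \<tau>)) (\<lambda>i x. clog (\<beta> $ i * x powr - \<tau>)) (\<lambda>i x. exp_proj (\<beta> $ i * x powr - \<tau>)) (pi\<^sup>2 / 6)"
proof (rule score_product.intro)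
  fix i
  let ?N = "density lborel (frechet_density (\<beta> $ i) \<tau>)"
  note F = has_bochner_integral_frechet[OF \<beta> \<tau>]
  show "prob_space ?N"
    by (rule prob_space_frechet[OF \<beta> \<tau>])
  show "has_bochner_integral ?N (\<lambda>x. exp_dev (\<beta> $ i * x powr - \<tau>)) 0"
    by (rule F[OF exp1_score_moments(1)])
  show "has_bochner_integral ?N (\<lambda>x. exp_proj (\<beta> $ i * x powr - \<tau>)) 0"
    by (rule F[OF exp1_score_moments(2)])
  show "has_bochner_integral ?N (\<lambda>x. clog (\<beta> $ i * x powr - \<tau>)) 0"
    by (rule F[OF exp1_score_moments(3)])
  show "has_bochner_integral ?N (\<lambda>x. exp_dev (\<beta> $ i * x powr - \<tau>) * exp_dev (\<beta> $ i * x powr - \<tau>)) 1"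
    by (rule F[OF exp1_score_moments(4)])
  show "has_bochner_integral ?N (\<lambda>x. exp_proj (\<beta> $ i * x powr - \<tau>) * exp_proj (\<beta> $ i * x powr - \<tau>)) (pi\<^sup>2 / 6)"
    by (rule F[OF exp1_score_moments(5)])
  show "has_bochner_integral ?N (\<lambda>x. clog (\<beta> $ i * x powr - \<tau>) * clog (\<beta> $ i * x powr - \<tau>)) (pi\<^sup>2 / 6)"
    by (rule F[OF exp1_score_moments(6)])
  show "has_bochner_integral ?N (\<lambda>x. exp_dev (\<beta> $ i * x powr - \<tau>) * clog (\<beta> $ i * x powr - \<tau>)) 1"
    by (rule F[OF exp1_score_moments(7)])
  show "has_bochner_integral ?N (\<lambda>x. exp_proj (\<beta> $ i * x powr - \<tau>) * exp_dev (\<beta> $ i * x powr - \<tau>)) 0"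
    by (rule F[OF exp1_score_moments(8)])
  show "integrable ?N (\<lambda>x. exp_proj (\<beta> $ i * x powr - \<tau>) * clog (\<beta> $ i * x powr - \<tau>))"
    using F[OF exp1_score_moments(9)] by (simp add: has_bochner_integral_iff)
qed

lemma frechet_sum_pos:
  fixes \<beta> :: "real^'k::finite"
  assumes "\<And>i. \<beta> $ i > 0" "\<And>i. z i > 0"
  shows "frechet_sum \<beta> \<tau> z > 0"
  unfolding frechet_sum_def using assms
  by (intro sum_pos mult_pos_pos) (auto simp: less_imp_neq[symmetric])

text \<open>Scaling leaves the shares e_i / T unchanged and adds the same constant to every
  logarithm; that constant is killed because the factors 1 - K e_i / T add up to zero. Thus the
  score can be evaluated at \<open>z\<close> itself.\<close>

lemma concrete_score_normalize:
  fixes \<beta> :: "real^'k::finite"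
  assumes \<beta>: "\<And>i. \<beta> $ i > 0" and z: "\<And>i. z i > 0"
  shows "concrete_score \<beta> \<tau> d c (\<lambda>i. normalize_sum z $ i) = concrete_score \<beta> \<tau> d c z"
proof -
  define s where "s = (\<Sum>j\<in>UNIV. z j)"
  have s: "s > 0" unfolding s_def using z by (intro sum_pos) auto
  define k where "k = (1 / s) powr - \<tau>"
  have k: "k > 0" using s by (simp add: k_def)
  have powr: "(z i / s) powr - \<tau> = k * z i powr - \<tau>" for i
    using z[of i] s powr_mult[of "1 / s" "z i" "- \<tau>"] by (simp add: k_def less_imp_le)
  have S: "frechet_sum \<beta> \<tau> (\<lambda>i. z i / s) = k * frechet_sum \<beta> \<tau> z"
    unfolding frechet_sum_def powr by (simp add: sum_distrib_left mult_ac)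
  have pos: "frechet_sum \<beta> \<tau> z > 0" by (rule frechet_sum_pos[OF \<beta> z])
  let ?r = "\<lambda>i. 1 - CARD('k) * (\<beta> $ i * z i powr - \<tau>) / frechet_sum \<beta> \<tau> z"
  have r: "1 - CARD('k) * (\<beta> $ i * (z i / s) powr - \<tau>) / frechet_sum \<beta> \<tau> (\<lambda>i. z i / s) = ?r i" for i
    unfolding S powr using k pos by (simp add: field_simps)
  have "(\<Sum>i\<in>UNIV. ?r i) = 0"
    using pos by (simp add: sum_subtractf sum_divide_distrib[symmetric] sum_distrib_left[symmetric]) (simp add: frechet_sum_def)
  moreover have "(d i / \<beta> $ i - c * ln (z i / s)) * ?r i = (d i / \<beta> $ i - c * ln (z i)) * ?r i + c * ln s * ?r i" for i
  proof -
    have "ln (z i / s) = ln (z i) - ln s" using s z[of i] by (simp add: ln_div)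
    moreover have "(A - c * (u - v)) * R = (A - c * u) * R + c * v * R" for A u v R
      by (simp add: algebra_simps)
    ultimately show ?thesis by simp
  qed
  ultimately have "(\<Sum>i\<in>UNIV. (d i / \<beta> $ i - c * ln (z i / s)) * ?r i) = (\<Sum>i\<in>UNIV. (d i / \<beta> $ i - c * ln (z i)) * ?r i)"
    by (simp only: sum.distrib sum_distrib_left[symmetric] mult_zero_right add_0_right)
  then show ?thesis
    unfolding concrete_score_def normalize_sum_def s_def[symmetric] vec_lambda_beta r by simp
qed

text \<open>This is \<tau> times the differential of ln \<beta>_i / \<tau> in the direction
  \<open>(d, c)\<close>, the origin of the coordinates \<phi>.\<close>

definition score_coeff :: "real^'k::finite \<Rightarrow> real \<Rightarrow> ('k \<Rightarrow> real) \<Rightarrow> real \<Rightarrow> 'k \<Rightarrow> real"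
  where "score_coeff \<beta> \<tau> d c i = d i / \<beta> $ i - c / \<tau> * ln (\<beta> $ i)"

text \<open>The factor T clears the denominators e_i / T, and ln e_i = ln \<beta>_i - \<tau> ln z_i
  trades the logarithms of z for those of the exponential variables; \<open>score_coeff\<close> is
  what remains.\<close>

lemma frechet_sum_times_score:
  fixes \<beta> :: "real^'k::finite" and \<tau> c :: real and d y z :: "'k \<Rightarrow> real"
  assumes \<beta>: "\<And>i. \<beta> $ i > 0" and \<tau>: "\<tau> > 0" and z: "\<And>i. z i > 0"
  defines "y \<equiv> score_coeff \<beta> \<tau> d c"
  shows "frechet_sum \<beta> \<tau> z * concrete_score \<beta> \<tau> d c z =
    score_product.score_poly (\<lambda>i x. exp_dev (\<beta> $ i * x powr - \<tau>)) (\<lambda>i x. clog (\<beta> $ i * x powr - \<tau>)) (\<lambda>i x. exp_proj (\<beta> $ i * x powr - \<tau>))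
      (c / \<tau>) (\<lambda>j. sum y UNIV - real CARD('k) * y j) z"
proof -
  define e where "e i = \<beta> $ i * z i powr - \<tau>" for i
  let ?S = "frechet_sum \<beta> \<tau> z"
  have S: "?S = sum e UNIV" by (simp add: frechet_sum_def e_def)
  have pos: "?S > 0" by (rule frechet_sum_pos[OF \<beta> z])
  have lne: "ln (e i) = ln (\<beta> $ i) - \<tau> * ln (z i)" for i
    using \<beta>[of i] z[of i] by (simp add: e_def ln_mult_pos ln_powr)
  have y: "d i / \<beta> $ i - c * ln (z i) = y i + c / \<tau> * (clog (e i) - euler_mascheroni)" for i
    using \<tau> by (simp add: y_def score_coeff_def clog_def lne right_diff_distrib)
  have "?S * concrete_score \<beta> \<tau> d c z = (real CARD('k) - 1) * (c / \<tau>) * ?S +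
     (\<Sum>i\<in>UNIV. ?S * ((d i / \<beta> $ i - c * ln (z i)) * (1 - CARD('k) * e i / ?S)))"
    unfolding concrete_score_def e_def by (simp add: algebra_simps sum_distrib_left)
  also have "\<dots> = (real CARD('k) - 1) * (c / \<tau>) * ?S +
      (\<Sum>i\<in>UNIV. (y i + c / \<tau> * (clog (e i) - euler_mascheroni)) * (?S - CARD('k) * e i))"
    unfolding y using pos by (intro arg_cong2[of _ _ _ _ "(+)"] sum.cong refl) (simp add: field_simps)
  also have "\<dots> = (\<Sum>j\<in>UNIV. c / \<tau> * (real CARD('k) - 1) * (1 + (e j - 1) * (1 - clog (e j)))
        + (sum y UNIV - CARD('k) * y j) * (e j - 1))
      + c / \<tau> * (\<Sum>(j, k)\<in>{(j, k). j \<noteq> k}. (e j - 1) * clog (e k))"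
    unfolding S score_algebra[of y "c / \<tau>" "\<lambda>i. clog (e i)" euler_mascheroni e, symmetric] by simp
  finally show ?thesis
    unfolding score_product.score_poly_def[OF score_product_frechet[OF \<beta> \<tau>]]
    unfolding exp_proj_def exp_dev_def e_def .
qed

text \<open>After passing to the reweighted product law, T^2 is shared between the two scores. The
  result is the second moment of two score polynomials over the mean of T^2.\<close>

lemma fisher_information_eq:
  fixes p a a' :: "(real^'m::finite) \<times> real"
  assumes p: "p \<in> concrete_params"
  defines "\<beta> \<equiv> append_last (fst p)" and "\<tau> \<equiv> snd p" and "K \<equiv> real CARD('m option)"
  defines "y \<equiv> \<lambda>a. score_coeff \<beta> \<tau> (last_diff (fst a)) (snd a)"
  shows "fisher_information p a a' =
    ((\<Sum>j\<in>UNIV. (sum (y a) UNIV - K * y a j) * (sum (y a') UNIV - K * y a' j))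
      + snd a / \<tau> * (snd a' / \<tau>) * (K * (K - 1) * (K * (pi\<^sup>2 / 6) + 1))) / (K * (K + 1))"
proof -
  have \<beta>: "\<beta> $ i > 0" and \<tau>: "\<tau> > 0" for i
    using concrete_params_pos[OF p] by (simp_all add: \<beta>_def \<tau>_def)
  interpret SP: score_product "\<lambda>i. density lborel (frechet_density (\<beta> $ i) \<tau>)"
    "\<lambda>i x. exp_dev (\<beta> $ i * x powr - \<tau>)" "\<lambda>i x. clog (\<beta> $ i * x powr - \<tau>)" "\<lambda>i x. exp_proj (\<beta> $ i * x powr - \<tau>)" "pi\<^sup>2 / 6"
    by (rule score_product_frechet[OF \<beta> \<tau>])
  define sc where "sc a x = (if \<exists>i. x $ i = 0 then 0
      else concrete_score \<beta> \<tau> (last_diff (fst a)) (snd a) (\<lambda>i. x $ i))" for a :: "(real^'m) \<times> real" and x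
  have [measurable]: "sc a \<in> borel_measurable borel" for a
    unfolding sc_def concrete_score_def frechet_sum_def by measurable
  define w where "w z = (frechet_sum \<beta> \<tau> z)\<^sup>2 / (K * (K + 1))" for z
  have [measurable]: "w \<in> borel_measurable (frechet_product \<beta> \<tau>)"
    unfolding w_def by measurable
  define T where "T a = SP.score_poly (snd a / \<tau>) (\<lambda>j. sum (y a) UNIV - K * y a j)" for a
  have HB: "has_bochner_integral (frechet_product \<beta> \<tau>) (\<lambda>z. T a z * T a' z)
      ((\<Sum>j\<in>UNIV. (sum (y a) UNIV - K * y a j) * (sum (y a') UNIV - K * y a' j))
      + snd a / \<tau> * (snd a' / \<tau>) * (K * (K - 1) * (K * (pi\<^sup>2 / 6) + 1)))" for a a'
    unfolding frechet_product_def T_def K_def by (rule SP.has_bochner_integral_score)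
  have "fisher_information p a a' = (\<integral>x. sc a x * sc a' x \<partial>concrete_distribution \<beta> \<tau>)"
    unfolding fisher_information_def dir_deriv_concrete_log_likelihood[OF p] sc_def \<beta>_def \<tau>_def ..
  also have "concrete_distribution \<beta> \<tau> = distr (density (frechet_product \<beta> \<tau>) w) borel normalize_sum"
    using concrete_distribution_eq_distr[OF \<beta> \<tau>] unfolding w_def[abs_def] K_def
    by (simp only: of_nat_mult of_nat_add of_nat_1)
  also have "(\<integral>x. sc a x * sc a' x \<partial>distr (density (frechet_product \<beta> \<tau>) w) borel normalize_sum) =
      (\<integral>z. sc a (normalize_sum z) * sc a' (normalize_sum z) \<partial>density (frechet_product \<beta> \<tau>) w)"
    by (rule integral_distr) measurable
  also have "\<dots> = (\<integral>z. w z *\<^sub>R (sc a (normalize_sum z) * sc a' (normalize_sum z)) \<partial>frechet_product \<beta> \<tau>)"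
    by (rule integral_density) (auto simp: w_def K_def)
  also have "\<dots> = (\<integral>z. (T a z * T a' z) / (K * (K + 1)) \<partial>frechet_product \<beta> \<tau>)"
  proof (rule integral_cong_AE)
    \<comment> \<open>Almost surely all coordinates are positive, so the zero branch of
      \<open>sc\<close> is avoided and the scale invariance of the score applies.\<close>
    show "AE z in frechet_product \<beta> \<tau>. w z *\<^sub>R (sc a (normalize_sum z) * sc a' (normalize_sum z)) = (T a z * T a' z) / (K * (K + 1))"
      using AE_frechet_product_pos[OF \<beta> \<tau>]
    proof eventually_elim
      case (elim z)
      then have z: "z i > 0" for i by blast
      have "(\<Sum>j\<in>UNIV. z j) > 0" using z by (intro sum_pos) auto
      then have nz: "normalize_sum z $ i \<noteq> 0" for i
        using z[of i] by (simp add: normalize_sum_def)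
      have "sc a (normalize_sum z) = concrete_score \<beta> \<tau> (last_diff (fst a)) (snd a) z" for a
        using nz by (simp add: sc_def concrete_score_normalize[OF \<beta> z])
      moreover have "T a z = frechet_sum \<beta> \<tau> z * concrete_score \<beta> \<tau> (last_diff (fst a)) (snd a) z" for a
        unfolding T_def y_def K_def by (rule frechet_sum_times_score[OF \<beta> \<tau> z, symmetric])
      ultimately show ?case
        by (simp add: w_def power2_eq_square)
    qed
    have "(\<lambda>z. T a z * T a' z) \<in> borel_measurable (frechet_product \<beta> \<tau>)"
      using HB[of a a'] by (auto simp: has_bochner_integral_iff)
    then show "(\<lambda>z. (T a z * T a' z) / (K * (K + 1))) \<in> borel_measurable (frechet_product \<beta> \<tau>)"
      by measurable
  qed measurable
  also have "\<dots> = (\<integral>z. T a z * T a' z \<partial>frechet_product \<beta> \<tau>) / (K * (K + 1))"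
    by simp
  finally show ?thesis
    using has_bochner_integral_integral_eq[OF HB[of a a']] by simp
qed

section \<open>The isometry with the half-space\<close>

lemma sum_option: "sum f (UNIV :: 'm::finite option set) = f None + (\<Sum>j\<in>UNIV. f (Some j))"
  by (simp add: UNIV_option_conv sum.reindex)

lemma Ck_on_vec:
  fixes f :: "'a::euclidean_space \<Rightarrow> 'n::finite \<Rightarrow> real"
  assumes "open S" "\<And>j. Ck_on k S (\<lambda>x. f x j)"
  shows "Ck_on k S (\<lambda>x. \<chi> j. f x j)"
  by (rule Ck_on_componentwise[OF assms(1)]) (auto simp: Basis_vec_real inner_axis assms(2))

lemma has_derivative_vec_lambda:
  fixes f :: "'a::real_normed_vector \<Rightarrow> 'n::finite \<Rightarrow> real"
  assumes "\<And>i. ((\<lambda>x. f x i) has_derivative (\<lambda>h. f' h i)) (at x)"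
  shows "((\<lambda>x. \<chi> i. f x i) has_derivative (\<lambda>h. \<chi> i. f' h i)) (at x)"
  by (subst has_derivative_componentwise_within) (auto simp: Basis_vec_real inner_axis assms)

lemma Ck_on_Pair:
  assumes "open S" "Ck_on k S f" "Ck_on k S g"
  shows "Ck_on k S (\<lambda>x. (f x, g x))"
proof -
  have "Ck_on k S (\<lambda>x. (f x, 0))"
    by (rule Ck_on_bounded_linear_compose[OF assms(1) _ assms(2)])
       (intro bounded_linear_Pair bounded_linear_ident bounded_linear_zero)
  moreover have "Ck_on k S (\<lambda>x. (0, g x))"
    by (rule Ck_on_bounded_linear_compose[OF assms(1) _ assms(3)])
       (intro bounded_linear_Pair bounded_linear_ident bounded_linear_zero)
  ultimately have "Ck_on k S (\<lambda>x. (f x, 0) + (0, g x))"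
    by (rule Ck_on_add[OF assms(1)])
  then show ?thesis by simp
qed

lemma open_half_space: "open (half_space :: ((real^'m) \<times> real) set)"
  unfolding half_space_def by (intro open_Collect_less continuous_intros)

lemma open_concrete_params: "open (concrete_params :: ((real^'m::finite) \<times> real) set)"
proof -
  have "continuous_on UNIV (\<lambda>p::(real^'m) \<times> real. append_last (fst p) $ i)" for i
    by (cases i) (auto simp: append_last_def intro!: continuous_intros)
  then have "open {p::(real^'m) \<times> real. append_last (fst p) $ i > 0}" for i
    by (intro open_Collect_less continuous_on_const)
  then have "open ((\<Inter>i. {p::(real^'m) \<times> real. append_last (fst p) $ i > 0}) \<inter> {p. snd p > 0})"
    by (intro open_Int open_INT open_Collect_less continuous_intros) auto
  also have "\<dots> = concrete_params" by (auto simp: concrete_params_def)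
  finally show ?thesis .
qed

text \<open>
  For \<open>s\<^sup>2 = K = CARD('m) + 1\<close> this is a square root of \<open>K I - J\<close>, where \<open>J\<close> is the all-ones matrix. The
  coefficient \<open>1 / (s + 1)\<close> makes it preserve the sum of the coordinates, which gives the explicit inverse.
\<close>

definition simplex_root :: "real \<Rightarrow> real^'m \<Rightarrow> real^'m"
  where "simplex_root s x = s *\<^sub>R x - ((\<Sum>j\<in>UNIV. x $ j) / (s + 1)) *\<^sub>R (\<chi> j. 1)"

definition simplex_root_inv :: "real \<Rightarrow> real^'m \<Rightarrow> real^'m"
  where "simplex_root_inv s x = (1 / s) *\<^sub>R (x + ((\<Sum>j\<in>UNIV. x $ j) / (s + 1)) *\<^sub>R (\<chi> j. 1))"

lemma bounded_linear_sum_vec_nth: "bounded_linear (\<lambda>x::real^'m. \<Sum>j\<in>UNIV. x $ j)"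
  by (intro bounded_linear_sum bounded_linear_vec_nth)

lemma bounded_linear_simplex_root: "bounded_linear (simplex_root s)"
  unfolding simplex_root_def divide_inverse
  by (intro bounded_linear_sub bounded_linear_scaleR_right bounded_linear_ident
      bounded_linear_scaleR_const bounded_linear_mult_const bounded_linear_sum_vec_nth)

lemma bounded_linear_simplex_root_inv: "bounded_linear (simplex_root_inv s)"
  unfolding simplex_root_inv_def divide_inverse
  by (intro bounded_linear_add bounded_linear_const_scaleR bounded_linear_ident
      bounded_linear_scaleR_const bounded_linear_mult_const bounded_linear_sum_vec_nth)

context
  fixes s :: real
  assumes s: "s > 0" and s2: "s\<^sup>2 = real CARD('m::finite) + 1"
begin

text \<open>The sum is multiplied by s - (s^2 - 1) / (s + 1) = 1, since the all-ones vector has s^2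
  - 1 entries.\<close>

lemma sum_simplex_root: "(\<Sum>j\<in>UNIV. simplex_root s (x :: real^'m) $ j) = (\<Sum>j\<in>UNIV. x $ j)"
proof -
  have n: "real CARD('m) = (s - 1) * (s + 1)" using s2 by (simp add: algebra_simps power2_eq_square)
  show ?thesis
    unfolding simplex_root_def using s
    by (simp add: sum_subtractf sum_distrib_left[symmetric] n) (simp add: algebra_simps)
qed

lemma sum_simplex_root_inv: "(\<Sum>j\<in>UNIV. simplex_root_inv s (x :: real^'m) $ j) = (\<Sum>j\<in>UNIV. x $ j)"
proof -
  have n: "real CARD('m) = (s - 1) * (s + 1)" using s2 by (simp add: algebra_simps power2_eq_square)
  show ?thesis
    unfolding simplex_root_inv_def using s
    by (simp add: sum.distrib sum_divide_distrib[symmetric] n) (simp add: field_simps)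
qed

lemma simplex_root_inverse:
  "simplex_root_inv s (simplex_root s (x :: real^'m)) = x" "simplex_root s (simplex_root_inv s (x :: real^'m)) = x"
  unfolding simplex_root_inv_def[of s "simplex_root s x"] sum_simplex_root
    simplex_root_def[of s "simplex_root_inv s x"] sum_simplex_root_inv
  unfolding simplex_root_def simplex_root_inv_def
  using s by (simp_all add: vec_eq_iff)

text \<open>The coefficient of the product of the two sums is - 2 s / (s + 1) + (s^2 - 1) / (s +
  1)^2 = - 1.\<close>

lemma inner_simplex_root:
  "simplex_root s (x :: real^'m) \<bullet> simplex_root s y =
    s\<^sup>2 * (x \<bullet> y) - (\<Sum>j\<in>UNIV. x $ j) * (\<Sum>j\<in>UNIV. y $ j)"
proof -
  have n: "real CARD('m) = (s - 1) * (s + 1)" using s2 by (simp add: algebra_simps power2_eq_square)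
  have one: "x \<bullet> (\<chi> j. 1) = (\<Sum>j\<in>UNIV. x $ j)" "(\<chi> j. 1) \<bullet> x = (\<Sum>j\<in>UNIV. x $ j)" for x :: "real^'m"
    by (simp_all add: inner_vec_def)
  define X Y where "X = (\<Sum>j\<in>UNIV. x $ j)" and "Y = (\<Sum>j\<in>UNIV. y $ j)"
  have "(s *\<^sub>R x - a *\<^sub>R u) \<bullet> (s *\<^sub>R y - b *\<^sub>R u) =
      s * (s * (x \<bullet> y)) - s * (b * (x \<bullet> u)) - a * (s * (u \<bullet> y)) + a * (b * (u \<bullet> u))" for a b and u :: "real^'m"
    by (simp add: inner_diff_left inner_diff_right right_diff_distrib)
  from this[of "X / (s + 1)" "\<chi> j. 1" "Y / (s + 1)"]
  have "simplex_root s x \<bullet> simplex_root s y =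
      s * (s * (x \<bullet> y)) - s * (Y / (s + 1) * X) - X / (s + 1) * (s * Y) + X / (s + 1) * (Y / (s + 1) * real CARD('m))"
    unfolding simplex_root_def X_def[symmetric] Y_def[symmetric] one
    by (simp add: X_def[symmetric] Y_def[symmetric])
  also have "\<dots> = s\<^sup>2 * (x \<bullet> y) - X * Y"
  proof -
    define A B where "A = X / (s + 1)" and "B = Y / (s + 1)"
    have XY: "X = A * (s + 1)" "Y = B * (s + 1)" using s by (simp_all add: A_def B_def)
    show ?thesis
      unfolding n A_def[symmetric] B_def[symmetric] unfolding XY by (simp add: algebra_simps power2_eq_square)
  qed
  finally show ?thesis by (simp add: X_def Y_def)
qed

end

text \<open>The coordinates \<phi> modulo constants, represented by their differences to the entry
  at \<open>None\<close>.\<close>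

definition log_ratio :: "(real^'m::finite) \<times> real \<Rightarrow> real^'m"
  where "log_ratio p = (\<chi> j. (ln (append_last (fst p) $ Some j) - ln (append_last (fst p) $ None)) / snd p)"

text \<open>A softmax in which the entry at \<open>None\<close> has weight 1; that entry itself is
  restored by \<open>append_last\<close>.\<close>

definition log_ratio_inv :: "(real^'m::finite) \<times> real \<Rightarrow> real^'m"
  where "log_ratio_inv q = (\<chi> j. exp (snd q * fst q $ j) / (1 + (\<Sum>k\<in>UNIV. exp (snd q * fst q $ k))))"

lemma append_last_log_ratio_inv:
  "append_last (log_ratio_inv q) $ i =
    (case i of None \<Rightarrow> 1 | Some j \<Rightarrow> exp (snd q * fst q $ j)) / (1 + (\<Sum>k\<in>UNIV. exp (snd q * fst q $ k)))"
proof -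
  have "1 + (\<Sum>k\<in>UNIV. exp (snd q * fst q $ k)) > 0"
    by (intro add_pos_nonneg sum_nonneg) auto
  then show ?thesis
    by (cases i) (simp_all add: append_last_def log_ratio_inv_def sum_divide_distrib[symmetric] field_simps)
qed

lemma log_ratio_inv_pos: "append_last (log_ratio_inv q) $ i > 0"
proof -
  have "1 + (\<Sum>k\<in>UNIV. exp (snd q * fst q $ k)) > 0"
    by (intro add_pos_nonneg sum_nonneg) auto
  then show ?thesis unfolding append_last_log_ratio_inv by (cases i) simp_all
qed

lemma log_ratio_log_ratio_inv:
  assumes "\<tau> > 0"
  shows "log_ratio (log_ratio_inv (x, \<tau>), \<tau>) = x"
proof -
  have "1 + (\<Sum>k\<in>UNIV. exp (\<tau> * x $ k)) > 0"
    by (intro add_pos_nonneg sum_nonneg) auto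
  then show ?thesis
    using assms by (simp add: log_ratio_def append_last_log_ratio_inv vec_eq_iff ln_div)
qed

lemma log_ratio_inv_log_ratio:
  assumes "(b, \<tau>) \<in> concrete_params"
  shows "log_ratio_inv (log_ratio (b, \<tau>), \<tau>) = b"
proof -
  have \<tau>: "\<tau> > 0" and pos: "append_last b $ i > 0" for i
    using concrete_params_pos[OF assms] by simp_all
  have e: "exp (\<tau> * log_ratio (b, \<tau>) $ j) = append_last b $ Some j / append_last b $ None" for j
    using \<tau> pos by (simp add: log_ratio_def exp_diff)
  have "append_last b $ None + (\<Sum>k\<in>UNIV. append_last b $ Some k) = 1"
    using sum_append_last[of b] by (simp add: sum_option)
  then have "1 + (\<Sum>k\<in>UNIV. append_last b $ Some k / append_last b $ None) = 1 / append_last b $ None"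
    using pos[of None] by (simp add: sum_divide_distrib[symmetric] field_simps)
  then show ?thesis
    unfolding log_ratio_inv_def vec_eq_iff using pos[of None]
    by (simp add: e) (simp add: append_last_def)
qed

lemma bounded_linear_last_diff: "bounded_linear (\<lambda>p. last_diff (fst p) i)"
proof (cases i)
  case None
  have "bounded_linear (\<lambda>p. - (\<Sum>j\<in>UNIV. fst p $ j))"
    by (intro bounded_linear_minus bounded_linear_sum bounded_linear_compose[OF bounded_linear_vec_nth bounded_linear_fst])
  then show ?thesis by (simp add: None last_diff_def)
next
  case (Some j)
  have "bounded_linear (\<lambda>p. fst p $ j)"
    by (intro bounded_linear_compose[OF bounded_linear_vec_nth bounded_linear_fst])
  then show ?thesis by (simp add: Some last_diff_def)
qed

lemma append_last_eq: "append_last b $ i = append_last 0 $ i + last_diff b i"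
  using append_last_add[of 0 1 b i] by simp

lemma has_derivative_append_last:
  "((\<lambda>p. append_last (fst p) $ i) has_derivative (\<lambda>a. last_diff (fst a) i)) (at p)"
proof -
  have "((\<lambda>p. append_last 0 $ i + last_diff (fst p) i) has_derivative (\<lambda>a. last_diff (fst a) i)) (at p)"
    using has_derivative_add[OF has_derivative_const bounded_linear_imp_has_derivative[OF bounded_linear_last_diff]]
    by simp
  then show ?thesis by (simp add: append_last_eq[symmetric])
qed

lemma Ck_on_append_last: "open S \<Longrightarrow> Ck_on k S (\<lambda>p. append_last (fst p) $ i)"
  using Ck_on_add[OF _ Ck_on_const Ck_on_bounded_linear[OF _ bounded_linear_last_diff], of S k "append_last 0 $ i" i]
  by (simp add: append_last_eq[symmetric])

text \<open>Here the score coefficients become differentials of the chart: the quotient rule applied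
  to ln \<beta>_i / \<tau> yields \<open>score_coeff\<close> divided by \<tau>.\<close>

lemma has_derivative_log_ratio:
  assumes p: "p \<in> concrete_params"
  defines "y \<equiv> \<lambda>a. score_coeff (append_last (fst p)) (snd p) (last_diff (fst a)) (snd a)"
  shows "(log_ratio has_derivative (\<lambda>a. \<chi> j. (y a (Some j) - y a None) / snd p)) (at p)"
  unfolding log_ratio_def
proof (rule has_derivative_vec_lambda)
  fix j
  note pos = concrete_params_pos[OF p]
  have ln: "((\<lambda>p. ln (append_last (fst p) $ i)) has_derivative (\<lambda>a. last_diff (fst a) i / append_last (fst p) $ i)) (at p)" for i
    using DERIV_compose_FDERIV[OF DERIV_ln[OF pos(1)] has_derivative_append_last] by (simp add: divide_inverse)
  have "snd p \<noteq> 0" using pos(2) by simp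
  from has_derivative_divide'[OF has_derivative_diff[OF ln ln] has_derivative_snd[OF has_derivative_ident] this]
  have "((\<lambda>p. (ln (append_last (fst p) $ Some j) - ln (append_last (fst p) $ None)) / snd p) has_derivative
      (\<lambda>a. ((last_diff (fst a) (Some j) / append_last (fst p) $ Some j - last_diff (fst a) None / append_last (fst p) $ None) * snd p
         - (ln (append_last (fst p) $ Some j) - ln (append_last (fst p) $ None)) * snd a) / (snd p * snd p))) (at p)" .
  also have "(\<lambda>a. ((last_diff (fst a) (Some j) / append_last (fst p) $ Some j - last_diff (fst a) None / append_last (fst p) $ None) * snd p
         - (ln (append_last (fst p) $ Some j) - ln (append_last (fst p) $ None)) * snd a) / (snd p * snd p)) =
      (\<lambda>a. (y a (Some j) - y a None) / snd p)"
    using pos(2) by (simp add: y_def score_coeff_def fun_eq_iff field_simps)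
  finally show "((\<lambda>p. (ln (append_last (fst p) $ Some j) - ln (append_last (fst p) $ None)) / snd p) has_derivative
      (\<lambda>a. (y a (Some j) - y a None) / snd p)) (at p)" .
qed

text \<open>Collapses the double sum over coordinates in \<open>information_metric\<close> once the
  Fisher matrix is known to be a pulled back inner product.\<close>

lemma inner_linear_expansion:
  fixes F :: "'a::euclidean_space \<Rightarrow> 'b::real_inner"
  assumes "linear F"
  shows "(\<Sum>a\<in>Basis. \<Sum>b\<in>Basis. (F a \<bullet> F b) * (u \<bullet> a) * (v \<bullet> b)) = F u \<bullet> F v"
proof -
  have F: "F u = (\<Sum>a\<in>Basis. (u \<bullet> a) *\<^sub>R F a)" for u
  proof -
    have "F u = F (\<Sum>a\<in>Basis. (u \<bullet> a) *\<^sub>R a)" by (simp add: euclidean_representation)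
    then show ?thesis by (simp add: linear_sum[OF assms] linear_scale[OF assms])
  qed
  show ?thesis
    unfolding F[of u] F[of v] inner_sum_left unfolding inner_sum_right
    by (intro sum.cong refl) simp
qed

text \<open>Adding a constant to all coefficients y_j leaves the K differences sum y - K y_j
  unchanged, so only the differences \<delta> to the \<open>None\<close> entry matter.\<close>

lemma fisher_information_log_ratio:
  fixes p a a' :: "(real^'m::finite) \<times> real"
  assumes p: "p \<in> concrete_params"
  defines "K \<equiv> real CARD('m) + 1"
  defines "\<delta> \<equiv> \<lambda>a. snd p *\<^sub>R frechet_derivative log_ratio (at p) a"
  shows "fisher_information p a a' =
    (K * (\<delta> a \<bullet> \<delta> a') - (\<Sum>j\<in>UNIV. \<delta> a $ j) * (\<Sum>j\<in>UNIV. \<delta> a' $ j)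
      + snd a / snd p * (snd a' / snd p) * ((K - 1) * (K * pi\<^sup>2 / 6 + 1))) / (K + 1)"
proof -
  define y where "y a = score_coeff (append_last (fst p)) (snd p) (last_diff (fst a)) (snd a)" for a
  have pos: "snd p > 0" using concrete_params_pos[OF p] by simp
  have K0: "K > 0" by (simp add: K_def add_pos_nonneg)
  have Kopt: "real CARD('m option) = K" by (simp add: K_def)
  have card: "(\<Sum>i\<in>(UNIV::'m set). x) = (K - 1) * x" for x :: real by (simp add: K_def)
  have "frechet_derivative log_ratio (at p) a = (\<chi> j. (y a (Some j) - y a None) / snd p)" for a
    unfolding frechet_derivative_at[OF has_derivative_log_ratio[OF p], symmetric] y_def ..
  then have \<delta>: "\<delta> a $ j = y a (Some j) - y a None" for a j
    using pos by (simp add: \<delta>_def)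
  then have y: "y a (Some j) = \<delta> a $ j + y a None" for a j by simp
  let ?s = "\<lambda>a. \<Sum>j\<in>UNIV. \<delta> a $ j"
  have Y: "sum (y a) UNIV = ?s a + K * y a None" for a
    unfolding sum_option y sum.distrib card by (simp add: algebra_simps)
  have F: "sum (y a) UNIV - K * y a None = ?s a" "sum (y a) UNIV - K * y a (Some j) = ?s a - K * \<delta> a $ j" for a j
    unfolding Y y by (simp_all add: algebra_simps)
  have "(\<Sum>j\<in>UNIV. (sum (y a) UNIV - K * y a j) * (sum (y a') UNIV - K * y a' j)) =
      ?s a * ?s a' + (\<Sum>j\<in>UNIV. (?s a - K * \<delta> a $ j) * (?s a' - K * \<delta> a' $ j))"
    by (subst sum_option) (simp only: F)
  also have "(\<Sum>j\<in>UNIV. (?s a - K * \<delta> a $ j) * (?s a' - K * \<delta> a' $ j)) =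
      (\<Sum>j\<in>UNIV. ?s a * ?s a' - K * ?s a * \<delta> a' $ j - K * ?s a' * \<delta> a $ j + K * K * (\<delta> a $ j * \<delta> a' $ j))"
    by (intro sum.cong refl) (simp add: algebra_simps)
  also have "\<dots> = (K - 1) * (?s a * ?s a') - K * ?s a * ?s a' - K * ?s a' * ?s a + K * K * (\<delta> a \<bullet> \<delta> a')"
    unfolding sum.distrib sum_subtractf sum_distrib_left[symmetric] card by (simp add: inner_vec_def)
  \<comment> \<open>The product of the two sums has coefficient (K - 1) - 2 K from the
    \<open>Some\<close> entries plus 1 from the \<open>None\<close> entry, which is - K.\<close>
  finally have *: "(\<Sum>j\<in>UNIV. (sum (y a) UNIV - K * y a j) * (sum (y a') UNIV - K * y a' j)) =
      K * (K * (\<delta> a \<bullet> \<delta> a') - ?s a * ?s a')"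
    by (simp add: algebra_simps)
  have red: "(K * A + B * C * (K * (K - 1) * (K * (z / 6) + 1))) / (K * (K + 1)) =
      (A + B * C * ((K - 1) * (K * z / 6 + 1))) / (K + 1)" for A B C z
  proof -
    have "K * A + B * C * (K * (K - 1) * (K * (z / 6) + 1)) = K * (A + B * C * ((K - 1) * (K * z / 6 + 1)))"
      by (simp add: algebra_simps)
    then show ?thesis using K0 by (simp only:) simp
  qed
  show ?thesis
    using fisher_information_eq[OF p, of a a'] unfolding Kopt y_def[symmetric] * red .
qed

text \<open>The height is 1 / \<tau> because d\<tau> / \<tau> is then - dy / y. The parameter
  \<open>s\<close> diagonalises the horizontal form and \<kappa> adjusts its scale to that of the
  vertical term.\<close>

definition hyperbolic_chart :: "real \<Rightarrow> real \<Rightarrow> (real^'m::finite) \<times> real \<Rightarrow> (real^'m) \<times> real"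
  where "hyperbolic_chart \<kappa> s p = (\<kappa> *\<^sub>R simplex_root s (log_ratio p), inverse (snd p))"

definition hyperbolic_chart_inv :: "real \<Rightarrow> real \<Rightarrow> (real^'m::finite) \<times> real \<Rightarrow> (real^'m) \<times> real"
  where "hyperbolic_chart_inv \<kappa> s q =
    (log_ratio_inv (simplex_root_inv s (inverse \<kappa> *\<^sub>R fst q), inverse (snd q)), inverse (snd q))"

lemma has_derivative_hyperbolic_chart:
  assumes p: "p \<in> concrete_params"
  shows "(hyperbolic_chart \<kappa> s has_derivative (\<lambda>a.
    (\<kappa> *\<^sub>R simplex_root s (frechet_derivative log_ratio (at p) a), - (snd a / (snd p)\<^sup>2)))) (at p)"
proof -
  have "snd p \<noteq> 0" using concrete_params_pos(2)[OF p] by simp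
  from has_derivative_compose[OF has_derivative_snd[OF has_derivative_ident] Deriv.has_derivative_inverse'[OF this]]
  have 1: "((\<lambda>p. inverse (snd p)) has_derivative (\<lambda>a. - (snd a / (snd p)\<^sup>2))) (at p)"
    by (simp add: divide_inverse power2_eq_square mult_ac)
  have "(log_ratio has_derivative frechet_derivative log_ratio (at p)) (at p)"
    using has_derivative_log_ratio[OF p] by (simp add: frechet_derivative_works[symmetric] differentiableI)
  then have 2: "((\<lambda>p. \<kappa> *\<^sub>R simplex_root s (log_ratio p)) has_derivative
      (\<lambda>a. \<kappa> *\<^sub>R simplex_root s (frechet_derivative log_ratio (at p) a))) (at p)"
    by (intro has_derivative_scaleR_right bounded_linear.has_derivative[OF bounded_linear_simplex_root])
  show ?thesis
    unfolding hyperbolic_chart_def using 2 1 by (rule has_derivative_Pair)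
qed

lemma Ck_on_snd: "open S \<Longrightarrow> Ck_on k S snd"
  by (intro Ck_on_bounded_linear bounded_linear_snd)

lemma smooth_hyperbolic_chart: "smooth_on concrete_params (hyperbolic_chart \<kappa> s)"
  unfolding smooth_on_def hyperbolic_chart_def
proof (intro allI Ck_on_Pair open_concrete_params)
  fix k
  let ?S = "concrete_params :: ((real^'m) \<times> real) set"
  have "snd p \<noteq> 0" if "p \<in> ?S" for p
    using concrete_params_pos(2)[OF that] by simp
  then have inv: "Ck_on k ?S (\<lambda>p. inverse (snd p))"
    by (intro Ck_on_inverse open_concrete_params Ck_on_snd)
  then show "Ck_on k ?S (\<lambda>p. inverse (snd p))" .
  have ln: "Ck_on k ?S (\<lambda>p. ln (append_last (fst p) $ i))" for i
    using concrete_params_pos(1) by (intro Ck_on_ln open_concrete_params Ck_on_append_last) auto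
  have "Ck_on k ?S (\<lambda>p. (ln (append_last (fst p) $ Some j) + - 1 * ln (append_last (fst p) $ None)) * inverse (snd p))" for j
    by (intro Ck_on_mult[OF open_concrete_params _ inv] Ck_on_add[OF open_concrete_params ln]
        Ck_on_mult[OF open_concrete_params Ck_on_const[OF open_concrete_params] ln])
  then have "Ck_on k ?S log_ratio"
    unfolding log_ratio_def by (intro Ck_on_vec open_concrete_params) (simp add: divide_inverse)
  then show "Ck_on k ?S (\<lambda>p. \<kappa> *\<^sub>R simplex_root s (log_ratio p))"
    by (rule Ck_on_bounded_linear_compose[OF open_concrete_params, rotated])
       (intro bounded_linear_const_scaleR bounded_linear_simplex_root)
qed

lemma smooth_hyperbolic_chart_inv: "smooth_on half_space (hyperbolic_chart_inv \<kappa> s)"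
  unfolding smooth_on_def hyperbolic_chart_inv_def
proof (intro allI Ck_on_Pair open_half_space)
  fix k
  let ?S = "half_space :: ((real^'m) \<times> real) set"
  let ?x = "\<lambda>q::(real^'m) \<times> real. simplex_root_inv s (inverse \<kappa> *\<^sub>R fst q)"
  have inv: "Ck_on k ?S (\<lambda>p. inverse (snd p))"
    by (intro Ck_on_inverse open_half_space Ck_on_snd) (auto simp: half_space_def)
  then show "Ck_on k ?S (\<lambda>p. inverse (snd p))" .
  have "bounded_linear ?x"
    by (rule bounded_linear_compose[OF bounded_linear_simplex_root_inv
        bounded_linear_const_scaleR[OF bounded_linear_fst]])
  then have x: "Ck_on k ?S (\<lambda>q. ?x q $ j)" for j
    by (intro Ck_on_bounded_linear[OF open_half_space] bounded_linear_compose[OF bounded_linear_vec_nth])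
  have e: "Ck_on k ?S (\<lambda>q. exp (inverse (snd q) * ?x q $ j))" for j
    by (rule Ck_on_exp[OF open_half_space Ck_on_mult[OF open_half_space inv x]])
  have pos: "1 + (\<Sum>j\<in>UNIV. exp (inverse (snd q) * ?x q $ j)) \<noteq> 0" for q
  proof -
    have "1 + (\<Sum>j\<in>UNIV. exp (inverse (snd q) * ?x q $ j)) > 0"
      by (intro add_pos_nonneg sum_nonneg) auto
    then show ?thesis by simp
  qed
  have "Ck_on k ?S (\<lambda>q. exp (inverse (snd q) * ?x q $ j) * inverse (1 + (\<Sum>j\<in>UNIV. exp (inverse (snd q) * ?x q $ j))))" for j
    by (rule Ck_on_mult[OF open_half_space e Ck_on_inverse[OF open_half_space
        Ck_on_add[OF open_half_space Ck_on_const[OF open_half_space] Ck_on_sum[OF open_half_space e]] pos]])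
  then show "Ck_on k ?S (\<lambda>q. log_ratio_inv (?x q, inverse (snd q)))"
    unfolding log_ratio_inv_def fst_conv snd_conv divide_inverse by (rule Ck_on_vec[OF open_half_space])
qed

lemma hyperbolic_chart_bij:
  assumes s: "s > 0" "s\<^sup>2 = real CARD('m::finite) + 1" and \<kappa>: "\<kappa> \<noteq> 0"
  shows "p \<in> concrete_params \<Longrightarrow> hyperbolic_chart \<kappa> s (p :: (real^'m) \<times> real) \<in> half_space"
    and "q \<in> half_space \<Longrightarrow> hyperbolic_chart_inv \<kappa> s (q :: (real^'m) \<times> real) \<in> concrete_params"
    and "p \<in> concrete_params \<Longrightarrow> hyperbolic_chart_inv \<kappa> s (hyperbolic_chart \<kappa> s p) = p"
    and "q \<in> half_space \<Longrightarrow> hyperbolic_chart \<kappa> s (hyperbolic_chart_inv \<kappa> s q) = q"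
proof -
  show "p \<in> concrete_params \<Longrightarrow> hyperbolic_chart \<kappa> s p \<in> half_space"
    using concrete_params_pos(2)[of p] by (simp add: hyperbolic_chart_def half_space_def)
  show "q \<in> half_space \<Longrightarrow> hyperbolic_chart_inv \<kappa> s q \<in> concrete_params"
    by (auto simp: hyperbolic_chart_inv_def half_space_def concrete_params_def log_ratio_inv_pos)
  show "p \<in> concrete_params \<Longrightarrow> hyperbolic_chart_inv \<kappa> s (hyperbolic_chart \<kappa> s p) = p"
    using \<kappa> log_ratio_inv_log_ratio[of "fst p" "snd p"]
    by (simp add: hyperbolic_chart_inv_def hyperbolic_chart_def simplex_root_inverse[OF s])
  show "q \<in> half_space \<Longrightarrow> hyperbolic_chart \<kappa> s (hyperbolic_chart_inv \<kappa> s q) = q"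
    using \<kappa> by (simp add: hyperbolic_chart_inv_def hyperbolic_chart_def half_space_def
        log_ratio_log_ratio_inv simplex_root_inverse[OF s])
qed

text \<open>At height 1 / \<tau> the half-space metric is l^2 \<tau>^2 times the Euclidean one. The
  vertical part gives l^2 (d\<tau> / \<tau>)^2 and the horizontal part the form K I - J over K + 1,
  matching the Fisher information.\<close>

lemma hyperbolic_chart_isometry:
  fixes l :: real
  defines "K \<equiv> real CARD('m::finite) + 1"
  assumes l: "l = sqrt ((K - 1) * (K * pi\<^sup>2 / 6 + 1) / (K + 1))"
  shows "riemannian_isometry (hyperbolic_chart (1 / (l * sqrt (K + 1))) (sqrt K))
    (concrete_params :: ((real^'m) \<times> real) set) information_metric half_space (hyperbolic_metric l)"
proof -
  \<comment> \<open>\<open>s\<close> is the square root of K, so that \<open>simplex_root s\<close>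
    pulls the Euclidean form back to K I - J; \<kappa> solves l^2 \<kappa>^2 = 1 / (K + 1), the
    denominator of the Fisher information.\<close>
  define \<kappa> s where "\<kappa> = 1 / (l * sqrt (K + 1))" and "s = sqrt K"
  let ?\<Phi> = "hyperbolic_chart \<kappa> s :: (real^'m) \<times> real \<Rightarrow> _"
  let ?S = "concrete_params :: ((real^'m) \<times> real) set"
  have K: "K > 1" by (simp add: K_def)
  have s: "s > 0" "s\<^sup>2 = real CARD('m) + 1" using K by (simp_all add: s_def K_def)
  have l2: "l\<^sup>2 = (K - 1) * (K * pi\<^sup>2 / 6 + 1) / (K + 1)" and l0: "l > 0"
    unfolding l using K by (simp_all add: add_nonneg_pos divide_pos_pos mult_pos_pos)
  have \<kappa>: "\<kappa> \<noteq> 0" and \<kappa>2: "l\<^sup>2 * \<kappa>\<^sup>2 = 1 / (K + 1)"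
    using l0 K by (simp_all add: \<kappa>_def power_divide power_mult_distrib)
  note bij = hyperbolic_chart_bij[OF s \<kappa>]
  have bb: "bij_betw ?\<Phi> ?S half_space"
    by (rule bij_betwI[where g = "hyperbolic_chart_inv \<kappa> s"]) (use bij in auto)
  have "smooth_on half_space (inv_into ?S ?\<Phi>)"
    unfolding smooth_on_def
  proof
    fix k
    \<comment> \<open>\<open>inv_into\<close> is arbitrary off the image, so it is identified with
      the explicit inverse on the half-space only, which is enough for smoothness there.\<close>
    have inv: "inv_into ?S ?\<Phi> q = hyperbolic_chart_inv \<kappa> s q" if "q \<in> half_space" for q
      by (rule inv_into_f_eq[OF bij_betw_imp_inj_on[OF bb] bij(2)[OF that] bij(4)[OF that]])
    show "Ck_on k half_space (inv_into ?S ?\<Phi>)"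
    proof (rule Ck_on_cong[OF open_half_space])
      show "Ck_on k half_space (hyperbolic_chart_inv \<kappa> s :: (real^'m) \<times> real \<Rightarrow> _)"
        using smooth_hyperbolic_chart_inv[of \<kappa> s] unfolding smooth_on_def ..
      show "hyperbolic_chart_inv \<kappa> s q = inv_into ?S ?\<Phi> q" if "q \<in> half_space" for q
        by (rule inv[OF that, symmetric])
    qed
  qed
  moreover have "hyperbolic_metric l (?\<Phi> p) (frechet_derivative ?\<Phi> (at p) u) (frechet_derivative ?\<Phi> (at p) v) =
      information_metric p u v" if p: "p \<in> ?S" for p u v
  proof -
    define \<Phi>' where "\<Phi>' = frechet_derivative ?\<Phi> (at p)"
    define D where "D = frechet_derivative log_ratio (at p)"
    have \<tau>: "snd p > 0" using concrete_params_pos(2)[OF p] .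
    have d: "(?\<Phi> has_derivative (\<lambda>a. (\<kappa> *\<^sub>R simplex_root s (D a), - (snd a / (snd p)\<^sup>2)))) (at p)"
      unfolding D_def by (rule has_derivative_hyperbolic_chart[OF p])
    have \<Phi>': "\<Phi>' = (\<lambda>a. (\<kappa> *\<^sub>R simplex_root s (D a), - (snd a / (snd p)\<^sup>2)))"
      unfolding \<Phi>'_def using frechet_derivative_at[OF d] by simp
    have lin: "linear \<Phi>'"
      unfolding \<Phi>' by (rule bounded_linear.linear[OF has_derivative_bounded_linear[OF d]])
    have metric: "hyperbolic_metric l (?\<Phi> p) x y = l\<^sup>2 * (snd p)\<^sup>2 * (x \<bullet> y)" for x y
      using \<tau> by (simp add: hyperbolic_metric_def hyperbolic_chart_def power_inverse field_simps)
    have fisher: "fisher_information p a b = l\<^sup>2 * (snd p)\<^sup>2 * (\<Phi>' a \<bullet> \<Phi>' b)" for a b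
    proof -
      let ?I = "K * (D a \<bullet> D b) - (\<Sum>j\<in>UNIV. D a $ j) * (\<Sum>j\<in>UNIV. D b $ j)"
      have s2: "s\<^sup>2 = K" using K by (simp add: s_def)
      have "fisher_information p a b = ((snd p)\<^sup>2 * ?I
          + snd a / snd p * (snd b / snd p) * ((K - 1) * (K * pi\<^sup>2 / 6 + 1))) / (K + 1)"
        unfolding fisher_information_log_ratio[OF p] D_def[symmetric] K_def[symmetric]
        by (simp add: sum_distrib_left[symmetric] algebra_simps power2_eq_square)
      also have "\<dots> = (snd p)\<^sup>2 * ?I * (1 / (K + 1)) + snd a / snd p * (snd b / snd p) * l\<^sup>2"
        unfolding l2 by (simp add: add_divide_distrib)
      also have "\<dots> = l\<^sup>2 * (snd p)\<^sup>2 * (\<Phi>' a \<bullet> \<Phi>' b)"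
        unfolding \<kappa>2[symmetric] \<Phi>' inner_Pair inner_scaleR_left inner_scaleR_right inner_simplex_root[OF s] s2
        using \<tau> by (simp add: field_simps power2_eq_square)
      finally show ?thesis .
    qed
    have "information_metric p u v = l\<^sup>2 * (snd p)\<^sup>2 * (\<Sum>a\<in>Basis. \<Sum>b\<in>Basis. (\<Phi>' a \<bullet> \<Phi>' b) * (u \<bullet> a) * (v \<bullet> b))"
      unfolding information_metric_def fisher by (simp add: sum_distrib_left mult.assoc)
    then show ?thesis
      unfolding inner_linear_expansion[OF lin] metric \<Phi>'_def[symmetric] by simp
  qed
  ultimately show ?thesis
    unfolding riemannian_isometry_def \<kappa>_def[symmetric] s_def[symmetric]
    using bb smooth_hyperbolic_chart open_concrete_params open_half_space by blast
qed

theorem theorem4p4: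
  fixes K :: nat and l :: real
  assumes "K \<ge> 2"
    and "CARD('m::finite) = K - 1"
    and "l = sqrt ((real K - 1) * (real K * pi\<^sup>2 / 6 + 1) / (real K + 1))"
  shows "has_constant_curvature (half_space :: ((real^'m) \<times> real) set) (hyperbolic_metric l) (- 1 / l\<^sup>2) \<and>
    (\<exists>\<Phi>. riemannian_isometry \<Phi> (concrete_params :: ((real^'m) \<times> real) set) information_metric
           (half_space :: ((real^'m) \<times> real) set) (hyperbolic_metric l))"
proof (intro conjI exI)
  have K: "real K = real CARD('m) + 1" using assms(1,2) by simp
  have "(real K - 1) * (real K * pi\<^sup>2 / 6 + 1) / (real K + 1) > 0"
    using assms(1) by (intro divide_pos_pos mult_pos_pos add_nonneg_pos) auto
  then have "l > 0" unfolding assms(3) by (rule real_sqrt_gt_zero)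
  then have "l \<noteq> 0" by simp
  then show "has_constant_curvature (half_space :: ((real^'m) \<times> real) set) (hyperbolic_metric l) (- 1 / l\<^sup>2)"
    by (rule hyperbolic_metric_constant_curvature)
  show "riemannian_isometry (hyperbolic_chart (1 / (l * sqrt (real CARD('m) + 1 + 1))) (sqrt (real CARD('m) + 1)))
      (concrete_params :: ((real^'m) \<times> real) set) information_metric half_space (hyperbolic_metric l)"
    by (rule hyperbolic_chart_isometry) (use assms(3) in \<open>simp only: K\<close>)
qed

end
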